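(* Consider the one-dimensional It\^o--L\'evy process $X(t)\in\mathbb{R}$ defined by $$dX(t)=f(X(t))\,dt+g(X(t))\,dW(t)+\int_{\mathbb{R}} y\,\tilde N(dt,dy),$$ where $f,g:\mathbb{R}\to\mathbb{R}$, $W$ is a Wiener process, $\tilde N$ is a compensated Poisson measure with L\'evy measure $\nu$, and the driving L\'evy process has finite variance. Assume that a stationary distribution exists. Assuming that $f$ and $g^2$ are polynomials of degrees $d_f\in\mathbb{N}$ and $d_g\in\mathbb{N}$, $$f(x)=\sum_{l=0}^{d_f}a_{f_l}x^l,\qquad g(x)^2=\sum_{l=0}^{d_g}a_{g_l}x^l,\qquad a_{f_l},a_{g_l}\in\mathbb{R},$$ let $n=\max\{d_f,d_g\}$ and $k\in\{1,\dots,n\}$. Then a lower bound on the stationary moment $\mu_k$ can be obtained via the semidefinite program $$\begin{aligned} \min\ & \mu_k\\ \text{subject to}\ & j\omega\sum_{l=0}^{d_f}a_{f_l}\,j^{-l}\,\frac{\partial^l\varphi}{\partial\omega^l}+\frac12 (j\omega)^2\sum_{l=0}^{d_g}a_{g_l}\,j^{-l}\,\frac{\partial^l\varphi}{\partial\omega^l}+\eta(\omega)\varphi=0,\\ & \frac{\partial^l\varphi}{\partial\omega^l}\Big|_{\omega=0}=j^l\mu_l,\quad l=1,2,\dots,n,\\ & \varphi(0)=1,\\ & M\succeq 0, \end{aligned}$$ where $\eta(\omega)=\int_{\mathbb{R}}\left(e^{j\omega y}-1-j\omega y\right)\nu(dy)$ and $M=\left(\varphi(\omega_r-\omega_s)\right)_{r,s=1}^{q}$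 for an arbitrary choice of $q\in\mathbb{N}$ and test points $\omega_1,\dots,\omega_q\in\mathbb{R}$. Further, the minimum value obtained by the program increases as the size of $M$ is increased by including more test points.
   Context: Here $j$ denotes the square root of $-1$, $\mathbb{E}$ denotes expectation, and $M\succeq 0$ means that the matrix $M$ is positive semidefinite. In the program, the unknowns are $\varphi:\mathbb{R}\to\mathbb{C}$, which represents the characteristic function $\varphi(\omega)=\mathbb{E}(e^{j\omega X})$ of the stationary distribution, and $\mu_l\in\mathbb{R}$, which represents the $l$-th order moment $\mathbb{E}(X^l)$ of the stationary distribution. The Poisson random measure $N(t,\cdot)$ is a measure-valued stochastic process such that, for a Borel set $S$, $N(t,S)$ is a Poisson process that counts the number of jumps that took values in $S$. Its intensity is given by the L\'evy measure $\nu$, i.e. $\mathbb{E}[N(t,S)]=t\,\nu(S)$. The compensated Poisson measure is $\tilde N(t,S)=N(t,S)-t\,\nu(S)$. *)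

theory Defs
  imports
    "HOL-Probability.Probability"
    "HOL-Library.Multiset"
    "Jordan_Normal_Form.Matrix"
begin

section \<open>Driving noise\<close>

text \<open>
  Continuous time is the half-line \<open>{0..}\<close> inside \<^typ>\<open>real\<close>; processes are functions of type
  \<open>real \<Rightarrow> 'w \<Rightarrow> real\<close> whose values at negative times are irrelevant.  A filtration given only on
  \<open>{0..}\<close> is extended to negative times by its value at \<open>0\<close>.
\<close>

definition filtration_of :: "'w measure \<Rightarrow> (real \<Rightarrow> 'w measure) \<Rightarrow> bool" where
  "filtration_of M F \<longleftrightarrow> filtration (space M) F \<and> (\<forall>t. sets (F t) \<subseteq> sets M)"

text \<open>The sigma-algebra generated by all increments after time \<open>s\<close> of a family of processes.\<close>

definition increment_events ::
    "'w measure \<Rightarrow> (real \<Rightarrow> 'w \<Rightarrow> real) set \<Rightarrow> real \<Rightarrow> 'w set set" where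
  "increment_events M P s = sigma_sets (space M)
     {(\<lambda>\<omega>. Y u \<omega> - Y v \<omega>) -` B \<inter> space M | Y u v B.
        Y \<in> P \<and> s \<le> v \<and> v \<le> u \<and> B \<in> sets borel}"

definition wiener_process ::
    "'w measure \<Rightarrow> (real \<Rightarrow> 'w measure) \<Rightarrow> (real \<Rightarrow> 'w \<Rightarrow> real) \<Rightarrow> bool" where
  "wiener_process M F W \<longleftrightarrow>
     (\<forall>t\<ge>0. W t \<in> borel_measurable (F t)) \<and>
     (AE \<omega> in M. W 0 \<omega> = 0) \<and>
     (AE \<omega> in M. continuous_on {0..} (\<lambda>t. W t \<omega>)) \<and>
     (\<forall>s t. 0 \<le> s \<longrightarrow> s < t \<longrightarrow>
        distributed M lborel (\<lambda>\<omega>. W t \<omega> - W s \<omega>) (normal_density 0 (sqrt (t - s)))) \<and>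
     (\<forall>s\<ge>0. prob_space.indep_set M (sets (F s)) (increment_events M {W} s))"

definition levy_measure :: "real measure \<Rightarrow> bool" where
  "levy_measure \<nu> \<longleftrightarrow>
     sets \<nu> = sets borel \<and> emeasure \<nu> {0} = 0 \<and>
     (\<integral>\<^sup>+y. ennreal (min 1 (y\<^sup>2)) \<partial>\<nu>) < \<infinity>"

text \<open>Borel sets of jump sizes bounded away from 0; a Levy measure is finite on them.\<close>

definition jump_sets :: "real set set" where
  "jump_sets = {S \<in> sets borel. 0 \<notin> closure S}"

definition jump_count ::
    "(real \<Rightarrow> 'w \<Rightarrow> real measure) \<Rightarrow> real set \<Rightarrow> real \<Rightarrow> 'w \<Rightarrow> real" where
  "jump_count N S t \<omega> = measure (N t \<omega>) S"

text \<open>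
  \<open>N t \<omega>\<close> is the (random) counting measure of the jump sizes occurring in \<open>{0<..t}\<close>.  The Poisson
  probabilities are written out because \<^const>\<open>poisson_pmf\<close> is only meaningful for a strictly
  positive rate, and \<open>\<nu> S\<close> may be 0.
\<close>

definition poisson_random_measure ::
    "'w measure \<Rightarrow> (real \<Rightarrow> 'w measure) \<Rightarrow> (real \<Rightarrow> 'w \<Rightarrow> real measure) \<Rightarrow> real measure \<Rightarrow> bool"
  where
  "poisson_random_measure M F N \<nu> \<longleftrightarrow>
     (\<forall>t\<ge>0. \<forall>\<omega>\<in>space M. sets (N t \<omega>) = sets borel) \<and>
     (\<forall>\<omega>\<in>space M. \<forall>S\<in>jump_sets.
        (\<forall>t\<ge>0. emeasure (N t \<omega>) S \<in> range of_nat) \<and>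
        jump_count N S 0 \<omega> = 0 \<and>
        mono_on {0..} (\<lambda>t. jump_count N S t \<omega>) \<and>
        (\<forall>t\<ge>0. ((\<lambda>u. jump_count N S u \<omega>) \<longlongrightarrow> jump_count N S t \<omega>) (at_right t))) \<and>
     (\<forall>S\<in>jump_sets. \<forall>t\<ge>0. jump_count N S t \<in> borel_measurable (F t)) \<and>
     (\<forall>S\<in>jump_sets. \<forall>s t k. 0 \<le> s \<longrightarrow> s \<le> t \<longrightarrow>
        measure M {\<omega> \<in> space M. jump_count N S t \<omega> - jump_count N S s \<omega> = real k} =
          ((t - s) * measure \<nu> S) ^ k / fact k * exp (- ((t - s) * measure \<nu> S))) \<and>
     (\<forall>A :: nat \<Rightarrow> real set. range A \<subseteq> jump_sets \<longrightarrow> disjoint_family A \<longrightarrow>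
        prob_space.indep_sets M (\<lambda>i. increment_events M {jump_count N (A i)} 0) UNIV) \<and>
     (\<forall>s\<ge>0. prob_space.indep_set M (sets (F s))
        (increment_events M (jump_count N ` jump_sets) s))"

text \<open>
  The Wiener process and the Poisson random measure are independent of each other, and their
  increments after time \<open>s\<close> are jointly independent of the past \<open>F s\<close>.
\<close>

definition driving_noise ::
    "'w measure \<Rightarrow> (real \<Rightarrow> 'w measure) \<Rightarrow> (real \<Rightarrow> 'w \<Rightarrow> real) \<Rightarrow>
     (real \<Rightarrow> 'w \<Rightarrow> real measure) \<Rightarrow> real measure \<Rightarrow> bool" where
  "driving_noise M F W N \<nu> \<longleftrightarrow>
     wiener_process M F W \<and>
     poisson_random_measure M F N \<nu> \<and>
     prob_space.indep_set M
       (increment_events M {W} 0) (increment_events M (jump_count N ` jump_sets) 0) \<and>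
     (\<forall>s\<ge>0. prob_space.indep_set M (sets (F s))
       (increment_events M (insert W (jump_count N ` jump_sets)) s))"

section \<open>Stochastic integrals\<close>

definition tendsto_in_prob ::
    "'w measure \<Rightarrow> ('i \<Rightarrow> 'w \<Rightarrow> real) \<Rightarrow> ('w \<Rightarrow> real) \<Rightarrow> 'i filter \<Rightarrow> bool" where
  "tendsto_in_prob M Y Z G \<longleftrightarrow>
     (\<forall>\<delta>>0. ((\<lambda>i. measure M {\<omega> \<in> space M. \<delta> < \<bar>Y i \<omega> - Z \<omega>\<bar>}) \<longlongrightarrow> 0) G)"

text \<open>
  The simple process with grid \<open>\<tau> 0 \<le> \<dots> \<le> \<tau> m\<close> and weights \<open>K\<close> equals \<open>K i\<close> on \<open>{\<tau> i<..\<tau> (Suc i)}\<close>.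
\<close>

definition simple_process ::
    "'w measure \<Rightarrow> (real \<Rightarrow> 'w measure) \<Rightarrow> nat \<Rightarrow> (nat \<Rightarrow> real) \<Rightarrow> (nat \<Rightarrow> 'w \<Rightarrow> real) \<Rightarrow> bool"
  where
  "simple_process M F m \<tau> K \<longleftrightarrow>
     0 \<le> \<tau> 0 \<and> (\<forall>i<m. \<tau> i \<le> \<tau> (Suc i)) \<and>
     (\<forall>i<m. K i \<in> borel_measurable (F (\<tau> i)) \<and> (\<exists>C. \<forall>\<omega>\<in>space M. \<bar>K i \<omega>\<bar> \<le> C))"

definition simple_value ::
    "nat \<Rightarrow> (nat \<Rightarrow> real) \<Rightarrow> (nat \<Rightarrow> 'w \<Rightarrow> real) \<Rightarrow> real \<Rightarrow> 'w \<Rightarrow> real" where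
  "simple_value m \<tau> K s \<omega> = (\<Sum>i<m. K i \<omega> * indicator {\<tau> i<..\<tau> (Suc i)} s)"

definition simple_integral ::
    "(real \<Rightarrow> 'w \<Rightarrow> real) \<Rightarrow> nat \<Rightarrow> (nat \<Rightarrow> real) \<Rightarrow> (nat \<Rightarrow> 'w \<Rightarrow> real) \<Rightarrow> real \<Rightarrow> 'w \<Rightarrow> real" where
  "simple_integral W m \<tau> K t \<omega> =
     (\<Sum>i<m. K i \<omega> * (W (min t (\<tau> (Suc i))) \<omega> - W (min t (\<tau> i)) \<omega>))"

text \<open>
  \<open>Z\<close> is a version of the Ito integral of \<open>H\<close> with respect to \<open>W\<close> over \<open>{0..t}\<close>: \<open>H\<close> is progressively
  measurable and is approximated by simple processes \<open>K p\<close> such that the integral of \<open>(K p - H)\<^sup>2\<close>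
  over \<open>{0..t}\<close> tends to 0 in probability and the elementary integrals of \<open>K p\<close> tend to \<open>Z\<close> in
  probability.
\<close>

definition has_ito_integral ::
    "'w measure \<Rightarrow> (real \<Rightarrow> 'w measure) \<Rightarrow> (real \<Rightarrow> 'w \<Rightarrow> real) \<Rightarrow> (real \<Rightarrow> 'w \<Rightarrow> real) \<Rightarrow>
     real \<Rightarrow> ('w \<Rightarrow> real) \<Rightarrow> bool" where
  "has_ito_integral M F W H t Z \<longleftrightarrow>
     (\<forall>r\<in>{0..t}. (\<lambda>(s, \<omega>). H s \<omega>)
        \<in> borel_measurable (restrict_space borel {0..r} \<Otimes>\<^sub>M F r)) \<and>
     Z \<in> borel_measurable M \<and>
     (\<exists>(m :: nat \<Rightarrow> nat) (\<tau> :: nat \<Rightarrow> nat \<Rightarrow> real) (K :: nat \<Rightarrow> nat \<Rightarrow> 'w \<Rightarrow> real).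
        (\<forall>p. simple_process M F (m p) (\<tau> p) (K p)) \<and>
        (\<forall>\<delta>>0. (\<lambda>p. measure M {\<omega> \<in> space M. ennreal \<delta> <
            (\<integral>\<^sup>+s\<in>{0..t}. ennreal ((simple_value (m p) (\<tau> p) (K p) s \<omega> - H s \<omega>)\<^sup>2) \<partial>lborel)})
          \<longlonglongrightarrow> 0) \<and>
        tendsto_in_prob M (\<lambda>p. simple_integral W (m p) (\<tau> p) (K p) t) Z sequentially)"

text \<open>
  \<open>Z\<close> is a version of \<open>\<integral> y \<tilde>N(t,dy)\<close>, where \<open>\<tilde>N(t,dy) = N(t,dy) - t \<nu>(dy)\<close>.  As the jumps near 0
  need not be absolutely summable, it is the limit in probability of the compensated integrals over
  the jumps of modulus greater than \<open>\<epsilon>\<close> as \<open>\<epsilon>\<close> tends to 0.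
\<close>

definition has_compensated_integral ::
    "'w measure \<Rightarrow> (real \<Rightarrow> 'w \<Rightarrow> real measure) \<Rightarrow> real measure \<Rightarrow> real \<Rightarrow> ('w \<Rightarrow> real) \<Rightarrow> bool"
  where
  "has_compensated_integral M N \<nu> t Z \<longleftrightarrow>
     Z \<in> borel_measurable M \<and>
     (\<forall>\<epsilon>>0. set_integrable \<nu> {y. \<epsilon> < \<bar>y\<bar>} (\<lambda>y. y)) \<and>
     tendsto_in_prob M
       (\<lambda>\<epsilon> \<omega>. (LINT y:{y. \<epsilon> < \<bar>y\<bar>}|N t \<omega>. y) - t * (LINT y:{y. \<epsilon> < \<bar>y\<bar>}|\<nu>. y))
       Z (at_right 0)"

section \<open>Ito--Levy processes and stationary distributions\<close>

definition cadlag :: "(real \<Rightarrow> real) \<Rightarrow> bool" where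
  "cadlag x \<longleftrightarrow>
     (\<forall>t\<ge>0. (x \<longlongrightarrow> x t) (at_right t)) \<and> (\<forall>t>0. \<exists>l. (x \<longlongrightarrow> l) (at_left t))"

text \<open>
  The equation \<open>dX = f(X) dt + g(X) dW + dL\<close> in integrated form, where the jump part \<open>L\<close> of the
  driving Levy process is \<open>L t = \<integral> y \<tilde>N(t,dy)\<close>.
\<close>

definition ito_levy_process ::
    "'w measure \<Rightarrow> (real \<Rightarrow> 'w measure) \<Rightarrow> (real \<Rightarrow> 'w \<Rightarrow> real) \<Rightarrow>
     (real \<Rightarrow> 'w \<Rightarrow> real measure) \<Rightarrow> real measure \<Rightarrow> (real \<Rightarrow> 'w \<Rightarrow> real) \<Rightarrow>
     (real \<Rightarrow> real) \<Rightarrow> (real \<Rightarrow> real) \<Rightarrow> (real \<Rightarrow> 'w \<Rightarrow> real) \<Rightarrow> bool" where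
  "ito_levy_process M F W N \<nu> L f g X \<longleftrightarrow>
     filtration_of M F \<and> levy_measure \<nu> \<and> driving_noise M F W N \<nu> \<and>
     (\<forall>t\<ge>0. has_compensated_integral M N \<nu> t (L t)) \<and>
     (\<forall>t\<ge>0. X t \<in> borel_measurable (F t)) \<and>
     (\<forall>\<omega>\<in>space M. cadlag (\<lambda>t. X t \<omega>)) \<and>
     (\<forall>t\<ge>0. \<exists>I. has_ito_integral M F W (\<lambda>s \<omega>. g (X s \<omega>)) t I \<and>
        (AE \<omega> in M.
           set_integrable lborel {0..t} (\<lambda>s. f (X s \<omega>)) \<and>
           X t \<omega> = X 0 \<omega> + (LINT s:{0..t}|lborel. f (X s \<omega>)) + I \<omega> + L t \<omega>))"

text \<open>\<open>\<pi>\<close> is the law of the process at every time; in particular \<open>X 0\<close> is started from \<open>\<pi>\<close>.\<close>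

definition stationary_distribution ::
    "'w measure \<Rightarrow> (real \<Rightarrow> 'w \<Rightarrow> real) \<Rightarrow> real measure \<Rightarrow> bool" where
  "stationary_distribution M X \<pi> \<longleftrightarrow> (\<forall>t\<ge>0. distr M borel (X t) = \<pi>)"

section \<open>The semidefinite program\<close>

primrec iter_deriv :: "nat \<Rightarrow> (real \<Rightarrow> complex) \<Rightarrow> real \<Rightarrow> complex" where
  "iter_deriv 0 \<phi> = \<phi>"
| "iter_deriv (Suc l) \<phi> = (\<lambda>w. vector_derivative (iter_deriv l \<phi>) (at w))"

definition times_differentiable :: "nat \<Rightarrow> (real \<Rightarrow> complex) \<Rightarrow> bool" where
  "times_differentiable n \<phi> \<longleftrightarrow> (\<forall>l<n. \<forall>w. iter_deriv l \<phi> differentiable (at w))"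

definition levy_exponent :: "real measure \<Rightarrow> real \<Rightarrow> complex" where
  "levy_exponent \<nu> w =
     (\<integral>y. (exp (\<i> * complex_of_real (w * y)) - 1 - \<i> * complex_of_real (w * y)) \<partial>\<nu>)"

text \<open>
  In the order on complex numbers \<open>0 \<le> z\<close> says that \<open>z\<close> is real and nonnegative; quantifying over
  all complex vectors, this forces \<open>A\<close> to be Hermitian.
\<close>

definition positive_semidefinite :: "complex mat \<Rightarrow> bool" where
  "positive_semidefinite A \<longleftrightarrow>
     square_mat A \<and> (\<forall>v \<in> carrier_vec (dim_row A). 0 \<le> scalar_prod (A *\<^sub>v v) (conjugate v))"

definition test_matrix :: "(real \<Rightarrow> complex) \<Rightarrow> real list \<Rightarrow> complex mat" where
  "test_matrix \<phi> ws =
     Matrix.mat (length ws) (length ws) (\<lambda>(r, s). \<phi> (ws ! r - ws ! s))"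

text \<open>
  The arguments \<open>pf\<close>, \<open>pg\<close> are the polynomials representing \<open>f\<close> and \<open>g\<^sup>2\<close>; \<open>ws\<close> lists the test
  points.  Of the unknown sequence \<open>\<mu>\<close> only the entries \<open>1, \<dots>, n\<close> matter.
\<close>

definition sdp_feasible ::
    "real poly \<Rightarrow> real poly \<Rightarrow> real measure \<Rightarrow> real list \<Rightarrow>
     (real \<Rightarrow> complex) \<Rightarrow> (nat \<Rightarrow> real) \<Rightarrow> bool" where
  "sdp_feasible pf pg \<nu> ws \<phi> \<mu> \<longleftrightarrow>
     (let n = max (degree pf) (degree pg) in
        times_differentiable n \<phi> \<and>
        (\<forall>w :: real.
           \<i> * complex_of_real w *
             (\<Sum>l\<le>degree pf. complex_of_real (poly.coeff pf l) * \<i> powi (- int l) * iter_deriv l \<phi> w)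
           + 1 / 2 * (\<i> * complex_of_real w)\<^sup>2 *
             (\<Sum>l\<le>degree pg. complex_of_real (poly.coeff pg l) * \<i> powi (- int l) * iter_deriv l \<phi> w)
           + levy_exponent \<nu> w * \<phi> w = 0) \<and>
        (\<forall>l\<in>{1..n}. iter_deriv l \<phi> 0 = \<i> ^ l * complex_of_real (\<mu> l)) \<and>
        \<phi> 0 = 1 \<and>
        positive_semidefinite (test_matrix \<phi> ws))"

text \<open>
  Optimal value of the program, as an infimum in the extended reals; it equals the minimum whenever
  the minimum is attained, and is \<open>-\<infinity>\<close> if the program is unbounded.
\<close>

definition sdp_value ::
    "real poly \<Rightarrow> real poly \<Rightarrow> real measure \<Rightarrow> nat \<Rightarrow> real list \<Rightarrow> ereal" where
  "sdp_value pf pg \<nu> k ws = Inf {ereal (\<mu> k) | \<phi> \<mu>. sdp_feasible pf pg \<nu> ws \<phi> \<mu>}"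

end

theory Submission
  imports Defs
begin

text \<open>
  The characteristic function \<open>\<phi>\<close> and the moments of \<open>\<pi>\<close> form a feasible point: positive
  semidefiniteness is Bochner's easy direction, and by differentiation under the integral the
  differential equation says that
  \<open>E [exp (\<i>wX) (\<i>w f(X) - w\<^sup>2/2 g(X)\<^sup>2 + \<eta>(w))] = 0\<close> under \<open>\<pi>\<close>.  This is obtained without Ito's
  formula: by stationarity \<open>E exp (\<i>wX h) = E exp (\<i>wX 0)\<close> for every \<open>h\<close>, and a first-order expansion
  of the left side at \<open>h = 0\<close> suffices.  For a simple integrand \<open>K\<close>, conditioning on the past grid
  point by grid point gives
  \<open>E [V exp (\<i>w \<integral>K dW + w\<^sup>2/2 \<integral>K\<^sup>2 ds + \<i>wL h)] = E V exp (h \<eta>(w))\<close> for bounded \<open>V\<close> known at time 0.  Working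
  with the quadratic variation rather than with \<open>K\<close> itself matters, because only \<open>g\<^sup>2\<close>, not
  \<open>g\<close>, need be continuous.  Replacing \<open>\<integral>f(X) ds\<close> and \<open>\<integral>g(X)\<^sup>2 ds\<close> by \<open>h f(X 0)\<close> and \<open>h g(X 0)\<^sup>2\<close> costs
  only \<open>o(h)\<close> in mean.  Enlarging the list of test points makes the old matrix a principal submatrix of
  the new one.
\<close>

section \<open>Exponential functionals of the driving noise\<close>

text \<open>The weight \<open>exp (w\<^sup>2 / 2 * simple_variation m \<tau> K t \<omega>)\<close>
  has no bound uniform along an approximating sequence, so integrands are stopped before their
  variation passes 1. The price is the probability that the variation over \<open>{0..h}\<close>
  exceeds 1, and it has to be \<open>o(h)\<close>. That variation is close to h g(X 0)^2, and
  Markov's inequality gives only O(h) for the event h g(X 0)^2 > 1/4; the missing factor is the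
  expectation of g(X 0)^2 over this event, which vanishes with h because g^2 is integrable.
  Stationarity enters twice: it makes the left side constant in h, and the equal laws supply the
  equality of absolute means that Scheffe's lemma needs at time 0. Limits are taken in a fixed
  order: for fixed h first the cut-off of small jumps, then the simple integrands, and only at the
  end h. The last passage is dominated because the exponents have nonpositive real part, so
  integrability of f and g^2 under the stationary law is enough and no moment beyond the order n is
  called for.\<close>

lemma (in prob_space) expectation_indep_fubini:
  fixes h :: "_ \<Rightarrow> complex"
  assumes ind: "indep_var S X T Y"
    and h[measurable]: "h \<in> borel_measurable (S \<Otimes>\<^sub>M T)"
    and bdd: "\<And>x y. x \<in> space S \<Longrightarrow> y \<in> space T \<Longrightarrow> norm (h (x, y)) \<le> C"
  shows "expectation (\<lambda>\<omega>. h (X \<omega>, Y \<omega>)) = expectation (\<lambda>\<omega>. expectation (\<lambda>\<omega>'. h (X \<omega>, Y \<omega>')))"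
proof -
  have [measurable]: "X \<in> measurable M S" "Y \<in> measurable M T"
    using indep_var_rv1[OF ind] indep_var_rv2[OF ind] by auto
  interpret X: prob_space "distr M S X" by (rule prob_space_distr) simp
  interpret Y: prob_space "distr M T Y" by (rule prob_space_distr) simp
  interpret XY: pair_prob_space "distr M S X" "distr M T Y" ..
  have eq: "distr M (S \<Otimes>\<^sub>M T) (\<lambda>x. (X x, Y x)) = distr M S X \<Otimes>\<^sub>M distr M T Y"
    using indep_var_distribution_eq[of S X T Y] ind by simp
  have int: "integrable (distr M S X \<Otimes>\<^sub>M distr M T Y) h"
    by (rule XY.integrable_const_bound[where B=C])
       (auto simp: space_pair_measure bdd intro!: AE_I2)
  have "expectation (\<lambda>\<omega>. h (X \<omega>, Y \<omega>)) = integral\<^sup>L (distr M (S \<Otimes>\<^sub>M T) (\<lambda>x. (X x, Y x))) h"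
    by (subst integral_distr) auto
  also have "\<dots> = integral\<^sup>L (distr M S X \<Otimes>\<^sub>M distr M T Y) h"
    unfolding eq ..
  also have "\<dots> = (\<integral>x. \<integral>y. h (x, y) \<partial>distr M T Y \<partial>distr M S X)"
    using XY.integral_fst'[OF int] by simp
  also have "\<dots> = (\<integral>\<omega>. \<integral>y. h (X \<omega>, y) \<partial>distr M T Y \<partial>M)"
    by (subst integral_distr) auto
  also have "\<dots> = (\<integral>\<omega>. \<integral>\<omega>'. h (X \<omega>, Y \<omega>') \<partial>M \<partial>M)"
  proof (rule Bochner_Integration.integral_cong[OF refl])
    fix \<omega> assume w: "\<omega> \<in> space M"
    then have [measurable]: "(\<lambda>y. h (X \<omega>, y)) \<in> borel_measurable T"
      by (intro measurable_Pair2[OF h] measurable_space[OF \<open>X \<in> measurable M S\<close>])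
    show "(\<integral>y. h (X \<omega>, y) \<partial>distr M T Y) = (\<integral>\<omega>'. h (X \<omega>, Y \<omega>') \<partial>M)"
      by (subst integral_distr) auto
  qed
  finally show ?thesis .
qed

lemma (in prob_space) indep_var_from_indep_set:
  assumes ind: "indep_set (sets A) (sets B)"
    and sp: "space A = space M" "space B = space M"
    and X: "X \<in> measurable A S" and Y: "Y \<in> measurable B T"
  shows "indep_var S X T Y"
proof -
  have sA: "sets A \<subseteq> events" and sB: "sets B \<subseteq> events"
    using ind by (auto simp: indep_sets2_eq)
  have "subalgebra M A" "subalgebra M B"
    using sp sA sB by (auto simp: subalgebra_def)
  then have rv: "random_variable S X" "random_variable T Y"
    using X Y by (auto intro: measurable_from_subalg)
  have "sigma_sets (space M) {X -` C \<inter> space M | C. C \<in> sets S} \<subseteq> sets A"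
    unfolding sp(1)[symmetric] using X by (intro sets.sigma_sets_subset) (auto simp: measurable_sets)
  moreover have "sigma_sets (space M) {Y -` C \<inter> space M | C. C \<in> sets T} \<subseteq> sets B"
    unfolding sp(2)[symmetric] using Y by (intro sets.sigma_sets_subset) (auto simp: measurable_sets)
  ultimately have "indep_set (sigma_sets (space M) {X -` C \<inter> space M | C. C \<in> sets S})
      (sigma_sets (space M) {Y -` C \<inter> space M | C. C \<in> sets T})"
    using ind unfolding indep_sets2_eq by (meson subsetD subset_trans)
  then show ?thesis
    using rv by (simp add: indep_var_eq)
qed

lemma (in prob_space) char_poisson:
  assumes [measurable]: "Y \<in> borel_measurable M" and "0 \<le> r"
    and nat: "\<And>\<omega>. \<omega> \<in> space M \<Longrightarrow> Y \<omega> \<in> \<nat>"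
    and P: "\<And>k::nat. prob {\<omega> \<in> space M. Y \<omega> = real k} = r ^ k / fact k * exp (- r)"
  shows "expectation (\<lambda>\<omega>. iexp (\<theta> * Y \<omega>)) = exp (of_real r * (iexp \<theta> - 1))"
proof -
  let ?S = "\<lambda>k::nat. {\<omega> \<in> space M. Y \<omega> = real k}"
  let ?f = "\<lambda>k \<omega>. indicator (?S k) \<omega> *\<^sub>R iexp (\<theta> * real k)"
  have fin: "?f k \<omega> = 0" if "k \<notin> {nat \<lfloor>Y \<omega>\<rfloor>}" for k \<omega>
    using that by (auto simp: indicator_def)
  have eq: "(\<Sum>k. ?f k \<omega>) = iexp (\<theta> * Y \<omega>)" if w: "\<omega> \<in> space M" for \<omega>
  proof -
    obtain k where "Y \<omega> = real k" using nat[OF w] by (auto simp: Nats_def)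
    then have "(\<Sum>k. ?f k \<omega>) = ?f k \<omega>"
      using w by (subst suminf_finite[where N="{k}"]) (auto simp: indicator_def)
    then show ?thesis using \<open>Y \<omega> = real k\<close> w by simp
  qed
  have int: "integrable M (?f k)" for k
    by (rule integrable_const_bound[where B=1]) (auto simp: indicator_def)
  have "(\<lambda>k. integral\<^sup>L M (?f k)) sums (\<integral>\<omega>. (\<Sum>k. ?f k \<omega>) \<partial>M)"
  proof (rule sums_integral[OF int])
    show "AE \<omega> in M. summable (\<lambda>k. norm (?f k \<omega>))"
    proof (rule AE_I2)
      fix \<omega> show "summable (\<lambda>k. norm (?f k \<omega>))"
        by (rule summable_finite[of "{nat \<lfloor>Y \<omega>\<rfloor>}"]) (use fin in force)+
    qed
    have "(\<integral>\<omega>. norm (?f k \<omega>) \<partial>M) = (r ^ k /\<^sub>R fact k) * exp (- r)" for k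
    proof -
      have "(\<integral>\<omega>. norm (?f k \<omega>) \<partial>M) = (\<integral>\<omega>. indicator (?S k) \<omega> \<partial>M)"
        by (intro Bochner_Integration.integral_cong) (auto simp: indicator_def)
      then show ?thesis using P[of k] by (simp add: field_simps)
    qed
    then show "summable (\<lambda>k. \<integral>\<omega>. norm (?f k \<omega>) \<partial>M)"
      using summable_mult2[OF summable_exp_generic[of r], of "exp (-r)"] by simp
  qed
  also have "(\<integral>\<omega>. (\<Sum>k. ?f k \<omega>) \<partial>M) = expectation (\<lambda>\<omega>. iexp (\<theta> * Y \<omega>))"
    by (intro Bochner_Integration.integral_cong refl eq)
  finally have 1: "(\<lambda>k. integral\<^sup>L M (?f k)) sums expectation (\<lambda>\<omega>. iexp (\<theta> * Y \<omega>))" .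
  have "integral\<^sup>L M (?f k) = ((of_real r * iexp \<theta>) ^ k /\<^sub>R fact k) * of_real (exp (- r))" for k
  proof -
    have "integral\<^sup>L M (?f k) = (\<integral>\<omega>. indicator (?S k) \<omega> \<partial>M) *\<^sub>R iexp (\<theta> * real k)"
      by (rule integral_scaleR_left) (simp add: less_top[symmetric])
    also have "(\<integral>\<omega>. indicator (?S k) \<omega> \<partial>M) = prob (?S k)"
      by simp
    also have "prob (?S k) *\<^sub>R iexp (\<theta> * real k) = (r ^ k / fact k * exp (- r)) *\<^sub>R iexp \<theta> ^ k"
    proof -
      have e: "iexp (\<theta> * real k) = iexp \<theta> ^ k"
        by (simp add: exp_of_nat_mult[symmetric] mult_ac)
      show ?thesis unfolding P e ..
    qed
    also have "\<dots> = ((of_real r * iexp \<theta>) ^ k /\<^sub>R fact k) * of_real (exp (- r))"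
      by (simp add: scaleR_conv_of_real field_simps power_mult_distrib)
    finally show ?thesis .
  qed
  then have "(\<lambda>k. ((of_real r * iexp \<theta>) ^ k /\<^sub>R fact k) * of_real (exp (- r)))
      sums expectation (\<lambda>\<omega>. iexp (\<theta> * Y \<omega>))"
    using 1 by simp
  moreover have "(\<lambda>k. ((of_real r * iexp \<theta>) ^ k /\<^sub>R fact k) * of_real (exp (- r)))
      sums (exp (of_real r * iexp \<theta>) * of_real (exp (- r)))"
    by (intro sums_mult2 exp_converges)
  ultimately have "expectation (\<lambda>\<omega>. iexp (\<theta> * Y \<omega>)) = exp (of_real r * iexp \<theta>) * of_real (exp (- r))"
    by (rule sums_unique2)
  then show ?thesis
    by (simp add: exp_of_real[symmetric] exp_add[symmetric] algebra_simps del: exp_of_real)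
qed

lemma (in prob_space) char_normal:
  assumes "distributed M lborel Y (normal_density 0 \<sigma>)" "0 < \<sigma>"
  shows "expectation (\<lambda>\<omega>. iexp (\<theta> * Y \<omega>)) = of_real (exp (- (\<theta>\<^sup>2 * \<sigma>\<^sup>2 / 2)))"
proof -
  have "distributed M lborel (\<lambda>\<omega>. (Y \<omega> - 0) / \<sigma>) std_normal_density"
    using normal_standard_normal_convert[of \<sigma> Y 0] assms by simp
  then have d: "distributed M lborel (\<lambda>\<omega>. Y \<omega> / \<sigma>) std_normal_density" by simp
  then have [measurable]: "(\<lambda>\<omega>. Y \<omega> / \<sigma>) \<in> borel_measurable M"
    by (auto dest: distributed_measurable)
  have "expectation (\<lambda>\<omega>. iexp (\<theta> * Y \<omega>)) = expectation (\<lambda>\<omega>. iexp ((\<theta> * \<sigma>) * (Y \<omega> / \<sigma>)))"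
    using assms(2) by simp
  also have "\<dots> = (\<integral>x. iexp ((\<theta> * \<sigma>) * x) \<partial>distr M lborel (\<lambda>\<omega>. Y \<omega> / \<sigma>))"
    by (subst integral_distr) auto
  also have "\<dots> = char std_normal_distribution (\<theta> * \<sigma>)"
    using d by (simp add: distributed_def char_def)
  finally show ?thesis
    by (simp add: char_std_normal_distribution power_mult_distrib)
qed

text \<open>Wraps the set system \<open>increment_events\<close> as a measure, so that measurability
  of functions with respect to it can be expressed and handed to
  \<open>indep_var_from_indep_set\<close>.\<close>

definition increment_algebra ::
    "'w measure \<Rightarrow> (real \<Rightarrow> 'w \<Rightarrow> real) set \<Rightarrow> real \<Rightarrow> 'w measure" where
  "increment_algebra M P s = sigma (space M)
     {(\<lambda>\<omega>. Y u \<omega> - Y v \<omega>) -` B \<inter> space M | Y u v B.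
        Y \<in> P \<and> s \<le> v \<and> v \<le> u \<and> B \<in> sets borel}"

lemma space_increment_algebra[simp]: "space (increment_algebra M P s) = space M"
  by (simp add: increment_algebra_def space_measure_of_conv)

lemma sets_increment_algebra: "sets (increment_algebra M P s) = increment_events M P s"
  unfolding increment_algebra_def increment_events_def by (rule sets_measure_of) auto

lemma measurable_increment_algebra:
  assumes "Y \<in> P" "s \<le> v" "v \<le> u"
  shows "(\<lambda>\<omega>. Y u \<omega> - Y v \<omega>) \<in> borel_measurable (increment_algebra M P s)"
proof (rule measurableI)
  fix B :: "real set" assume "B \<in> sets borel"
  then show "(\<lambda>\<omega>. Y u \<omega> - Y v \<omega>) -` B \<inter> space (increment_algebra M P s) \<in> sets (increment_algebra M P s)"
    unfolding sets_increment_algebra space_increment_algebra increment_events_def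
    using assms by (intro sigma_sets.Basic) auto
qed auto

section \<open>Laws of the increments of the driving noise\<close>

locale levy_noise = prob_space M for M :: "'w measure" +
  fixes F :: "real \<Rightarrow> 'w measure" and W :: "real \<Rightarrow> 'w \<Rightarrow> real"
    and N :: "real \<Rightarrow> 'w \<Rightarrow> real measure" and \<nu> :: "real measure"
  assumes filtration_F: "filtration_of M F"
    and levy_nu: "levy_measure \<nu>"
    and noise: "driving_noise M F W N \<nu>"
begin

lemma space_F: "space (F t) = space M"
  using filtration_F by (auto simp: filtration_of_def filtration.space_F)

lemma sets_F_mono: "s \<le> t \<Longrightarrow> sets (F s) \<subseteq> sets (F t)"
  using filtration_F filtration.sets_F_mono unfolding filtration_of_def by blast

lemma measurable_F_mono: "X \<in> measurable (F s) S \<Longrightarrow> s \<le> t \<Longrightarrow> X \<in> measurable (F t) S"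
  by (rule measurable_from_subalg[of "F t" "F s"]) (auto simp: subalgebra_def space_F sets_F_mono)

lemma subalgebra_F: "subalgebra M (F t)"
  using filtration_F by (auto simp: filtration_of_def subalgebra_def space_F)

lemma measurable_F: "X \<in> measurable (F s) S \<Longrightarrow> X \<in> measurable M S"
  by (rule measurable_from_subalg[OF subalgebra_F])

lemmas wiener_conds = noise[unfolded driving_noise_def, THEN conjunct1, unfolded wiener_process_def]
lemmas poisson_conds = noise[unfolded driving_noise_def, THEN conjunct2, THEN conjunct1,
  unfolded poisson_random_measure_def]
lemmas sets_N_cond = poisson_conds[THEN conjunct1]
lemmas path_cond = poisson_conds[THEN conjunct2, THEN conjunct1]
lemmas adapted_cond = poisson_conds[THEN conjunct2, THEN conjunct2, THEN conjunct1]
lemmas law_cond = poisson_conds[THEN conjunct2, THEN conjunct2, THEN conjunct2, THEN conjunct1]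
lemmas disjoint_cond = poisson_conds[THEN conjunct2, THEN conjunct2, THEN conjunct2, THEN conjunct2,
  THEN conjunct1]
lemmas joint_noise_conds = noise[unfolded driving_noise_def, THEN conjunct2, THEN conjunct2]

lemma measurable_W: "0 \<le> t \<Longrightarrow> W t \<in> borel_measurable (F t)"
  using wiener_conds[THEN conjunct1] by simp

lemma measurable_W'[measurable]: "0 \<le> t \<Longrightarrow> W t \<in> borel_measurable M"
  by (rule measurable_F[OF measurable_W])

lemma measurable_jump_count:
  "S \<in> jump_sets \<Longrightarrow> 0 \<le> t \<Longrightarrow> jump_count N S t \<in> borel_measurable (F t)"
  using adapted_cond by simp

lemma measurable_jump_count'[measurable]:
  "S \<in> jump_sets \<Longrightarrow> 0 \<le> t \<Longrightarrow> jump_count N S t \<in> borel_measurable M"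
  by (rule measurable_F[OF measurable_jump_count])

lemma sets_N:
  "0 \<le> t \<Longrightarrow> \<omega> \<in> space M \<Longrightarrow> sets (N t \<omega>) = sets borel"
  using sets_N_cond by simp

lemma emeasure_N:
  assumes "0 \<le> t" "\<omega> \<in> space M" "S \<in> jump_sets"
  obtains k where "emeasure (N t \<omega>) S = of_nat k" "jump_count N S t \<omega> = real k"
proof -
  have "emeasure (N t \<omega>) S \<in> range of_nat"
    using path_cond assms by simp
  then obtain k where "emeasure (N t \<omega>) S = of_nat k" by auto
  moreover then have "jump_count N S t \<omega> = real k"
    by (simp add: jump_count_def measure_def)
  ultimately show ?thesis by (rule that)
qed

lemma jump_increment_in_Nats:
  assumes "0 \<le> s" "s \<le> t" "\<omega> \<in> space M" "S \<in> jump_sets"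
  shows "jump_count N S t \<omega> - jump_count N S s \<omega> \<in> \<nat>"
proof -
  obtain k where k: "jump_count N S t \<omega> = real k"
    by (rule emeasure_N[of t \<omega> S]) (use assms in auto)
  obtain l where l: "jump_count N S s \<omega> = real l"
    by (rule emeasure_N[of s \<omega> S]) (use assms in auto)
  have "mono_on {0..} (\<lambda>t. jump_count N S t \<omega>)"
    using path_cond assms by simp
  then have "jump_count N S s \<omega> \<le> jump_count N S t \<omega>"
    using assms by (auto simp: mono_on_def)
  then show ?thesis
    unfolding k l by (simp add: of_nat_diff[symmetric] del: of_nat_diff)
qed

lemma char_jump_increment:
  assumes "0 \<le> s" "s \<le> t" "S \<in> jump_sets"
  shows "expectation (\<lambda>\<omega>. iexp (\<theta> * (jump_count N S t \<omega> - jump_count N S s \<omega>)))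
    = exp (of_real ((t - s) * measure \<nu> S) * (iexp \<theta> - 1))"
proof (rule char_poisson)
  show "(\<lambda>\<omega>. jump_count N S t \<omega> - jump_count N S s \<omega>) \<in> borel_measurable M"
    using assms by (intro borel_measurable_diff measurable_jump_count') auto
  show "jump_count N S t \<omega> - jump_count N S s \<omega> \<in> \<nat>" if "\<omega> \<in> space M" for \<omega>
    using jump_increment_in_Nats that assms by blast
  show "prob {\<omega> \<in> space M. jump_count N S t \<omega> - jump_count N S s \<omega> = real k} =
     ((t - s) * measure \<nu> S) ^ k / fact k * exp (- ((t - s) * measure \<nu> S))" for k
    using law_cond assms by blast
qed (use assms in simp)

lemma char_wiener_increment:
  assumes "0 \<le> s" "s \<le> t"
  shows "expectation (\<lambda>\<omega>. iexp (\<theta> * (W t \<omega> - W s \<omega>))) = of_real (exp (- (\<theta>\<^sup>2 * (t - s) / 2)))"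
\<comment> \<open>A zero increment has no density, so the normal law is available only for
  \<open>s < t\<close>; for \<open>s = t\<close> both sides are 1.\<close>
proof (cases "s = t")
  case False
  then have "distributed M lborel (\<lambda>\<omega>. W t \<omega> - W s \<omega>) (normal_density 0 (sqrt (t - s)))"
    using wiener_conds[THEN conjunct2, THEN conjunct2, THEN conjunct2, THEN conjunct1] assms by simp
  from char_normal[OF this, of \<theta>] False assms show ?thesis by simp
qed (simp add: prob_space)

text \<open>For disjoint \<open>A i\<close> this is the integral, over the jumps in
  \<open>{s<..t}\<close>, of the simple function with value \<open>z i\<close> on
  \<open>A i\<close>. Correspondingly, \<open>jump_rate\<close> is the integral of
  \<open>iexp (w * y) - 1\<close> for the same simple function; the compensating linear term appears
  only when small jumps are let in.\<close>

definition jump_sum :: "nat \<Rightarrow> (nat \<Rightarrow> real) \<Rightarrow> (nat \<Rightarrow> real set) \<Rightarrow> real \<Rightarrow> real \<Rightarrow> 'w \<Rightarrow> real" where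
  "jump_sum m z A s t \<omega> = (\<Sum>i<m. z i * (jump_count N (A i) t \<omega> - jump_count N (A i) s \<omega>))"

definition jump_rate :: "real \<Rightarrow> nat \<Rightarrow> (nat \<Rightarrow> real) \<Rightarrow> (nat \<Rightarrow> real set) \<Rightarrow> complex" where
  "jump_rate w m z A = (\<Sum>i<m. of_real (measure \<nu> (A i)) * (iexp (w * z i) - 1))"

lemma jump_sum_add: "jump_sum m z A s t \<omega> + jump_sum m z A t u \<omega> = jump_sum m z A s u \<omega>"
  by (simp add: jump_sum_def sum.distrib[symmetric] algebra_simps)

lemma measurable_jump_sum:
  assumes "range A \<subseteq> jump_sets" "0 \<le> s" "s \<le> t"
  shows "jump_sum m z A s t \<in> borel_measurable (F t)"
  unfolding jump_sum_def[abs_def]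
proof (intro borel_measurable_sum borel_measurable_times borel_measurable_diff)
  fix i
  have "A i \<in> jump_sets" using assms by auto
  then show "(\<lambda>_. z i) \<in> borel_measurable (F t)"
    "jump_count N (A i) t \<in> borel_measurable (F t)" "jump_count N (A i) s \<in> borel_measurable (F t)"
    using assms by (auto intro: measurable_jump_count measurable_F_mono[OF measurable_jump_count, where t=t])
qed

text \<open>Counts over disjoint sets are independent, so the characteristic function is a product
  of Poisson ones and the exponents add up.\<close>

lemma char_jump_sum:
  assumes A: "range A \<subseteq> jump_sets" "disjoint_family A" and st: "0 \<le> s" "s \<le> t"
  shows "expectation (\<lambda>\<omega>. iexp (w * jump_sum m z A s t \<omega>)) = exp (of_real (t - s) * jump_rate w m z A)"
proof -
  let ?Y = "\<lambda>i \<omega>. jump_count N (A i) t \<omega> - jump_count N (A i) s \<omega>"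
  have Aj: "A i \<in> jump_sets" for i using A by auto
  have "indep_sets (\<lambda>i. increment_events M {jump_count N (A i)} 0) UNIV"
    using disjoint_cond A by simp
  then have 1: "indep_sets (\<lambda>i. sets (increment_algebra M {jump_count N (A i)} 0)) {..<m}"
    unfolding sets_increment_algebra by (rule indep_sets_mono_index[OF subset_UNIV])
  have "indep_vars (\<lambda>_. borel) ?Y {..<m}"
    unfolding indep_vars_def
  proof (intro conjI ballI)
    show "random_variable borel (?Y i)" for i
      using Aj st by (intro borel_measurable_diff measurable_jump_count') auto
    show "indep_sets (\<lambda>i. sigma_sets (space M) {?Y i -` B \<inter> space M |B. B \<in> sets borel}) {..<m}"
    proof (rule indep_sets_mono_sets[OF 1])
      fix i
      have Y: "?Y i \<in> borel_measurable (increment_algebra M {jump_count N (A i)} 0)"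
        using st by (intro measurable_increment_algebra) auto
      show "sigma_sets (space M) {?Y i -` B \<inter> space M |B. B \<in> sets borel}
         \<subseteq> sets (increment_algebra M {jump_count N (A i)} 0)"
        using sets.sigma_sets_subset[of "{?Y i -` B \<inter> space M |B. B \<in> sets borel}" "increment_algebra M {jump_count N (A i)} 0"]
          measurable_sets[OF Y] by auto
    qed
  qed
  then have ind: "indep_vars (\<lambda>_. borel) (\<lambda>i \<omega>. iexp (w * z i * ?Y i \<omega>)) {..<m}"
    by (rule indep_vars_compose2) measurable
  have "expectation (\<lambda>\<omega>. iexp (w * jump_sum m z A s t \<omega>))
      = expectation (\<lambda>\<omega>. \<Prod>i<m. iexp (w * z i * ?Y i \<omega>))"
    by (simp add: jump_sum_def exp_sum[symmetric] sum_distrib_left mult_ac)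
  also have "\<dots> = (\<Prod>i<m. expectation (\<lambda>\<omega>. iexp (w * z i * ?Y i \<omega>)))"
  proof (rule indep_vars_lebesgue_integral[OF _ ind])
    fix i show "integrable M (\<lambda>\<omega>. iexp (w * z i * ?Y i \<omega>))"
      using Aj st by (intro integrable_iexp) auto
  qed simp
  also have "\<dots> = (\<Prod>i<m. exp (of_real (t - s) * (of_real (measure \<nu> (A i)) * (iexp (w * z i) - 1))))"
    by (intro prod.cong refl, subst char_jump_increment[OF st Aj]) (simp add: mult.assoc)
  also have "\<dots> = exp (of_real (t - s) * jump_rate w m z A)"
    by (simp add: jump_rate_def exp_sum[symmetric] sum_distrib_left)
  finally show ?thesis .
qed

lemma char_joint_increment:
  assumes A: "range A \<subseteq> jump_sets" "disjoint_family A" and st: "0 \<le> s" "s \<le> t"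
  shows "expectation (\<lambda>\<omega>. iexp (\<theta> * (W t \<omega> - W s \<omega>)) * iexp (w * jump_sum m z A s t \<omega>))
    = of_real (exp (- (\<theta>\<^sup>2 * (t - s) / 2))) * exp (of_real (t - s) * jump_rate w m z A)"
proof -
  have [measurable]: "jump_sum m z A s t \<in> borel_measurable M"
    using A st by (intro measurable_F[OF measurable_jump_sum])
  have [measurable]: "W t \<in> borel_measurable M" "W s \<in> borel_measurable M"
    using st by auto
  have 0: "indep_set (sets (increment_algebra M {W} 0)) (sets (increment_algebra M (jump_count N ` jump_sets) 0))"
    unfolding sets_increment_algebra using joint_noise_conds[THEN conjunct1] .
  have "(\<lambda>\<omega>. iexp (\<theta> * (W t \<omega> - W s \<omega>))) \<in> borel_measurable (increment_algebra M {W} 0)"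
    using st measurable_increment_algebra[of W "{W}" 0 s t M] by measurable
  moreover have "jump_sum m z A s t \<in> borel_measurable (increment_algebra M (jump_count N ` jump_sets) 0)"
    unfolding jump_sum_def[abs_def] using A st
    by (intro borel_measurable_sum borel_measurable_times measurable_const measurable_increment_algebra) auto
  then have "(\<lambda>\<omega>. iexp (w * jump_sum m z A s t \<omega>)) \<in> borel_measurable (increment_algebra M (jump_count N ` jump_sets) 0)"
    by measurable
  ultimately have "indep_var borel (\<lambda>\<omega>. iexp (\<theta> * (W t \<omega> - W s \<omega>))) borel (\<lambda>\<omega>. iexp (w * jump_sum m z A s t \<omega>))"
    by (intro indep_var_from_indep_set[OF 0]) auto
  then show ?thesis
    by (subst indep_var_lebesgue_integral)
      (auto simp del: of_real_mult of_real_diff simp add: char_wiener_increment[OF st] char_jump_sum[OF A st] intro!: integrable_iexp)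
qed

text \<open>Given the past at \<open>s\<close>, both \<open>V\<close> and \<open>K\<close> are
  constants, and the increments are independent of them. The Gaussian factor with exponent
  \<open>- (w * K \<omega>)\<^sup>2 * (t - s) / 2\<close> is cancelled by the weight, which leaves
  the deterministic jump factor.\<close>

lemma one_step_identity:
  fixes V :: "'w \<Rightarrow> complex" and K :: "'w \<Rightarrow> real"
  assumes A: "range A \<subseteq> jump_sets" "disjoint_family A" and st: "0 \<le> s" "s \<le> t"
    and V: "V \<in> borel_measurable (F s)" "\<And>\<omega>. \<omega> \<in> space M \<Longrightarrow> norm (V \<omega>) \<le> B"
    and K: "K \<in> borel_measurable (F s)" "\<And>\<omega>. \<omega> \<in> space M \<Longrightarrow> \<bar>K \<omega>\<bar> \<le> C"
  shows "expectation (\<lambda>\<omega>. V \<omega> * (iexp (w * (K \<omega> * (W t \<omega> - W s \<omega>))) *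
           of_real (exp (w\<^sup>2 / 2 * ((K \<omega>)\<^sup>2 * (t - s)))) * iexp (w * jump_sum m z A s t \<omega>)))
    = expectation V * exp (of_real (t - s) * jump_rate w m z A)"
proof -
  let ?P = "insert W (jump_count N ` jump_sets)"
  \<comment> \<open>\<open>indep_var\<close> relates variables of one common type, so the real
    increment of \<open>W\<close> is embedded in the complex numbers to match the pair
    \<open>(V \<omega>, K \<omega>)\<close>.\<close>
  let ?R = "\<lambda>\<omega>. (complex_of_real (W t \<omega> - W s \<omega>), jump_sum m z A s t \<omega>)"
  let ?S = "\<lambda>\<omega>. iexp (w * (K \<omega> * (W t \<omega> - W s \<omega>))) *
    of_real (exp (w\<^sup>2 / 2 * ((K \<omega>)\<^sup>2 * (t - s)))) * iexp (w * jump_sum m z A s t \<omega>)"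
  \<comment> \<open>\<open>V\<close> and \<open>K\<close> are bounded only on
    \<open>space M\<close>, while \<open>expectation_indep_fubini\<close> wants a bound for all
    arguments of \<open>h\<close>. Clamping provides it and changes nothing on
    \<open>space M\<close>.\<close>
  define K' where "K' \<omega> = max (- C) (min C (K \<omega>))" for \<omega>
  have K': "K' \<omega> = K \<omega>" if "\<omega> \<in> space M" for \<omega>
    using K(2)[OF that] by (auto simp: K'_def)
  define h :: "(complex \<times> real) \<times> (complex \<times> real) \<Rightarrow> complex" where
    "h = (\<lambda>x. (if norm (fst (fst x)) \<le> B then fst (fst x) else 0) *
       (iexp (w * (max (- C) (min C (snd (fst x))) * Re (fst (snd x)))) *
        of_real (exp (w\<^sup>2 / 2 * ((max (- C) (min C (snd (fst x))))\<^sup>2 * (t - s)))) * iexp (w * snd (snd x))))"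
  have meas[measurable]: "h \<in> borel_measurable ((borel \<Otimes>\<^sub>M borel) \<Otimes>\<^sub>M (borel \<Otimes>\<^sub>M borel))"
    unfolding h_def by measurable
  have VK: "(\<lambda>\<omega>. (V \<omega>, K \<omega>)) \<in> F s \<rightarrow>\<^sub>M borel \<Otimes>\<^sub>M borel"
    using V K by measurable
  have Winc: "(\<lambda>\<omega>. W t \<omega> - W s \<omega>) \<in> borel_measurable (increment_algebra M ?P s)"
    using st by (intro measurable_increment_algebra) auto
  have Jinc: "jump_sum m z A s t \<in> borel_measurable (increment_algebra M ?P s)"
    unfolding jump_sum_def[abs_def] using A st
    by (intro borel_measurable_sum borel_measurable_times measurable_const measurable_increment_algebra) auto
  have DJ: "(\<lambda>\<omega>. ?R \<omega>) \<in> increment_algebra M ?P s \<rightarrow>\<^sub>M borel \<Otimes>\<^sub>M borel"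
    using Winc Jinc by measurable
  have "indep_set (sets (F s)) (sets (increment_algebra M ?P s))"
    unfolding sets_increment_algebra using joint_noise_conds[THEN conjunct2] st by simp
  then have ind: "indep_var (borel \<Otimes>\<^sub>M borel) (\<lambda>\<omega>. (V \<omega>, K \<omega>)) (borel \<Otimes>\<^sub>M borel) (\<lambda>\<omega>. ?R \<omega>)"
    by (rule indep_var_from_indep_set) (use VK DJ space_F in auto)
  have C0: "0 \<le> C" and B0: "0 \<le> B"
  proof -
    obtain \<omega> where "\<omega> \<in> space M" using not_empty by auto
    then show "0 \<le> C" "0 \<le> B"
      using K(2)[of \<omega>] V(2)[of \<omega>] norm_ge_zero[of "V \<omega>"] abs_ge_zero[of "K \<omega>"] by linarith+
  qed
  have "norm (h (x, y)) \<le> B * exp (w\<^sup>2 / 2 * (C\<^sup>2 * (t - s)))" for x y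
  proof -
    obtain v k d j where xy: "x = (v, k)" "y = (d, j)" by (metis surj_pair)
    have "\<bar>max (- C) (min C k)\<bar> \<le> C" using C0 by auto
    then have "(max (- C) (min C k))\<^sup>2 \<le> C\<^sup>2"
      by (metis C0 abs_le_square_iff abs_of_nonneg)
    then have "w\<^sup>2 / 2 * ((max (- C) (min C k))\<^sup>2 * (t - s)) \<le> w\<^sup>2 / 2 * (C\<^sup>2 * (t - s))"
      using st by (intro mult_left_mono mult_right_mono) auto
    then have "exp (w\<^sup>2 / 2 * ((max (- C) (min C k))\<^sup>2 * (t - s))) \<le> exp (w\<^sup>2 / 2 * (C\<^sup>2 * (t - s)))"
      by simp
    moreover have "norm (if norm v \<le> B then v else 0) \<le> B" using B0 by simp
    ultimately have "norm (if norm v \<le> B then v else 0) * exp (w\<^sup>2 / 2 * ((max (- C) (min C k))\<^sup>2 * (t - s)))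
        \<le> B * exp (w\<^sup>2 / 2 * (C\<^sup>2 * (t - s)))"
      using B0 by (intro mult_mono) auto
    moreover have "norm (h (x, y)) = norm (if norm v \<le> B then v else 0) * exp (w\<^sup>2 / 2 * ((max (- C) (min C k))\<^sup>2 * (t - s)))"
      unfolding h_def xy fst_conv snd_conv norm_mult norm_exp_i_times norm_of_real by simp
    ultimately show ?thesis by simp
  qed
  from expectation_indep_fubini[OF ind meas this]
  have "expectation (\<lambda>\<omega>. h ((V \<omega>, K \<omega>), ?R \<omega>)) =
      expectation (\<lambda>\<omega>. expectation (\<lambda>\<omega>'. h ((V \<omega>, K \<omega>), ?R \<omega>')))"
    by simp
  also have "\<dots> = expectation (\<lambda>\<omega>. V \<omega> * exp (of_real (t - s) * jump_rate w m z A))"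
  proof (rule Bochner_Integration.integral_cong[OF refl])
    fix \<omega> assume w: "\<omega> \<in> space M"
    have "expectation (\<lambda>\<omega>'. h ((V \<omega>, K \<omega>), ?R \<omega>'))
      = expectation (\<lambda>\<omega>'. (V \<omega> * of_real (exp (w\<^sup>2 / 2 * ((K \<omega>)\<^sup>2 * (t - s))))) *
          (iexp ((w * K \<omega>) * (W t \<omega>' - W s \<omega>')) * iexp (w * jump_sum m z A s t \<omega>')))"
      unfolding h_def fst_conv snd_conv Re_complex_of_real K'_def[symmetric] K'[OF w]
      using V(2)[OF w] by (simp only: if_True mult.assoc mult.commute mult.left_commute)
    also have "\<dots> = (V \<omega> * of_real (exp (w\<^sup>2 / 2 * ((K \<omega>)\<^sup>2 * (t - s))))) *
       (of_real (exp (- ((w * K \<omega>)\<^sup>2 * (t - s) / 2))) * exp (of_real (t - s) * jump_rate w m z A))"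
      by (simp only: integral_mult_right_zero char_joint_increment[OF A st])
    also have "\<dots> = V \<omega> * of_real (exp (w\<^sup>2 / 2 * ((K \<omega>)\<^sup>2 * (t - s))) * exp (- ((w * K \<omega>)\<^sup>2 * (t - s) / 2))) *
        exp (of_real (t - s) * jump_rate w m z A)"
      by simp
    also have "exp (w\<^sup>2 / 2 * ((K \<omega>)\<^sup>2 * (t - s))) * exp (- ((w * K \<omega>)\<^sup>2 * (t - s) / 2)) = 1"
      by (simp add: exp_add[symmetric] power_mult_distrib)
    finally show "expectation (\<lambda>\<omega>'. h ((V \<omega>, K \<omega>), ?R \<omega>')) =
      V \<omega> * exp (of_real (t - s) * jump_rate w m z A)" by simp
  qed
  also have "\<dots> = expectation V * exp (of_real (t - s) * jump_rate w m z A)"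
    by simp
  also have "expectation (\<lambda>\<omega>. h ((V \<omega>, K \<omega>), ?R \<omega>)) =
     expectation (\<lambda>\<omega>. V \<omega> * ?S \<omega>)"
  proof (rule Bochner_Integration.integral_cong[OF refl])
    fix \<omega> assume w: "\<omega> \<in> space M"
    show "h ((V \<omega>, K \<omega>), ?R \<omega>) =
      V \<omega> * ?S \<omega>"
      unfolding h_def fst_conv snd_conv Re_complex_of_real K'_def[symmetric] K'[OF w]
      using V(2)[OF w] by (simp only: if_True)
  qed
  finally show ?thesis .
qed

end

section \<open>Simple integrands\<close>

context levy_noise begin

lemma grid_identity:
  fixes V :: "'w \<Rightarrow> complex" and K :: "nat \<Rightarrow> 'w \<Rightarrow> real"
  assumes A: "range A \<subseteq> jump_sets" "disjoint_family A"
    and tau: "0 \<le> \<tau> 0" "\<And>i. i < m \<Longrightarrow> \<tau> i \<le> \<tau> (Suc i)"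
    and K: "\<And>i. i < m \<Longrightarrow> K i \<in> borel_measurable (F (\<tau> i))"
      "\<And>i. i < m \<Longrightarrow> \<exists>C. \<forall>\<omega>\<in>space M. \<bar>K i \<omega>\<bar> \<le> C"
    and V: "V \<in> borel_measurable (F (\<tau> 0))" "\<And>\<omega>. \<omega> \<in> space M \<Longrightarrow> norm (V \<omega>) \<le> B"
  shows "expectation (\<lambda>\<omega>. V \<omega> * (iexp (w * (\<Sum>i<m. K i \<omega> * (W (\<tau> (Suc i)) \<omega> - W (\<tau> i) \<omega>))) *
           of_real (exp (w\<^sup>2 / 2 * (\<Sum>i<m. (K i \<omega>)\<^sup>2 * (\<tau> (Suc i) - \<tau> i)))) *
           iexp (w * jump_sum k z A (\<tau> 0) (\<tau> m) \<omega>)))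
    = expectation V * exp (of_real (\<tau> m - \<tau> 0) * jump_rate w k z A)"
    (is "expectation (?U m) = _")
proof -
  \<comment> \<open>The product accumulated up to one grid point serves as \<open>V\<close> for the
    next step. Hence the induction also has to carry its boundedness and its measurability at that
    grid point.\<close>
  have "0 \<le> \<tau> m \<and> ?U m \<in> borel_measurable (F (\<tau> m)) \<and> (\<exists>B'. \<forall>\<omega>\<in>space M. norm (?U m \<omega>) \<le> B') \<and>
      expectation (?U m) = expectation V * exp (of_real (\<tau> m - \<tau> 0) * jump_rate w k z A)"
    using tau(2) K
  proof (induction m)
    case 0
    show ?case
      using tau(1) V by (auto simp: jump_sum_def intro!: exI[of _ B])
  next
    case (Suc m)
    let ?s = "\<tau> m" and ?t = "\<tau> (Suc m)"
    note IH0 = Suc.IH[OF Suc.prems(1)[OF less_SucI] Suc.prems(2)[OF less_SucI] Suc.prems(3)[OF less_SucI]]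
    have IH: "0 \<le> ?s" "?U m \<in> borel_measurable (F ?s)"
      "expectation (?U m) = expectation V * exp (of_real (?s - \<tau> 0) * jump_rate w k z A)"
      using IH0 by blast+
    obtain B' where B': "\<And>\<omega>. \<omega> \<in> space M \<Longrightarrow> norm (?U m \<omega>) \<le> B'"
      using IH0 by blast
    obtain C where C: "\<And>\<omega>. \<omega> \<in> space M \<Longrightarrow> \<bar>K m \<omega>\<bar> \<le> C"
      using Suc.prems(3)[of m] by auto
    have st: "?s \<le> ?t" using Suc.prems(1) by simp
    have Km: "K m \<in> borel_measurable (F ?s)" using Suc.prems(2) by simp
    let ?X = "\<lambda>\<omega>. iexp (w * (K m \<omega> * (W ?t \<omega> - W ?s \<omega>))) *
           of_real (exp (w\<^sup>2 / 2 * ((K m \<omega>)\<^sup>2 * (?t - ?s)))) * iexp (w * jump_sum k z A ?s ?t \<omega>)"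
    have split: "?U (Suc m) \<omega> = ?U m \<omega> * ?X \<omega>" for \<omega>
      unfolding sum.lessThan_Suc jump_sum_add[symmetric, of k z A "\<tau> 0" ?t \<omega> ?s]
      by (simp add: distrib_left exp_add mult_ac)
    have "?X \<in> borel_measurable (F ?t)"
    proof -
      have [measurable]: "K m \<in> borel_measurable (F ?t)" "W ?t \<in> borel_measurable (F ?t)"
        "W ?s \<in> borel_measurable (F ?t)" "jump_sum k z A ?s ?t \<in> borel_measurable (F ?t)"
        using measurable_F_mono[OF Km st] measurable_F_mono[OF measurable_W st] IH(1) st
          measurable_jump_sum[OF A(1) IH(1) st] measurable_W[of ?t] by auto
      show ?thesis by measurable
    qed
    then have m: "?U (Suc m) \<in> borel_measurable (F ?t)"
      unfolding split by (rule borel_measurable_times[OF measurable_F_mono[OF IH(2) st]])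
    have "norm (?U (Suc m) \<omega>) \<le> B' * exp (w\<^sup>2 / 2 * (C\<^sup>2 * (?t - ?s)))" if \<omega>: "\<omega> \<in> space M" for \<omega>
    proof -
      have "\<bar>K m \<omega>\<bar> \<le> \<bar>C\<bar>" using C[OF \<omega>] by simp
      then have "(K m \<omega>)\<^sup>2 \<le> C\<^sup>2" by (simp only: abs_le_square_iff)
      then have "w\<^sup>2 / 2 * ((K m \<omega>)\<^sup>2 * (?t - ?s)) \<le> w\<^sup>2 / 2 * (C\<^sup>2 * (?t - ?s))"
        using st by (intro mult_left_mono mult_right_mono) auto
      then have "norm (?X \<omega>) \<le> exp (w\<^sup>2 / 2 * (C\<^sup>2 * (?t - ?s)))"
        unfolding norm_mult norm_exp_i_times norm_of_real by simp
      then show ?thesis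
        unfolding split norm_mult[of "?U m \<omega>"]
        by (intro mult_mono B'[OF \<omega>] order_trans[OF norm_ge_zero B'[OF \<omega>]]) auto
    qed
    moreover have "expectation (?U (Suc m)) = expectation V * exp (of_real (?t - \<tau> 0) * jump_rate w k z A)"
    proof -
      have "expectation (?U (Suc m)) = expectation (?U m) * exp (of_real (?t - ?s) * jump_rate w k z A)"
        unfolding split by (rule one_step_identity[OF A IH(1) st IH(2) B' Km C])
      then show ?thesis unfolding IH(3)
        by (simp add: mult.assoc exp_add[symmetric] distrib_right[symmetric])
    qed
    ultimately show ?case using m order_trans[OF IH(1) st] by blast
  qed
  then show ?thesis
    by blast
qed

lemma simple_process_mono:
  assumes K: "simple_process M F m \<tau> K" and "i \<le> j" "j \<le> m"
  shows "0 \<le> \<tau> i" "\<tau> i \<le> \<tau> j"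
proof -
  have st: "\<tau> i \<le> \<tau> (Suc i)" if "i < m" for i
    using K that by (auto simp: simple_process_def)
  have mono: "\<tau> i \<le> \<tau> j" if "i \<le> j" "j \<le> m" for i j
    using that
  proof (induction j rule: dec_induct)
    case (step n)
    then show ?case using st[of n] by simp
  qed simp
  show "\<tau> i \<le> \<tau> j" using mono assms by blast
  show "0 \<le> \<tau> i" using mono[of 0 i] K assms by (simp add: simple_process_def)
qed

text \<open>The integral of the squared simple process over \<open>{0..t}\<close> (see
  \<open>nn_integral_simple_value\<close>), as a finite sum whose measurability can be read off the
  weights.\<close>

definition simple_variation ::
    "nat \<Rightarrow> (nat \<Rightarrow> real) \<Rightarrow> (nat \<Rightarrow> 'w \<Rightarrow> real) \<Rightarrow> real \<Rightarrow> 'w \<Rightarrow> real" where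
  "simple_variation m \<tau> K t \<omega> = (\<Sum>i<m. (K i \<omega>)\<^sup>2 * (min t (\<tau> (Suc i)) - min t (\<tau> i)))"

lemma simple_process_identity:
  fixes V :: "'w \<Rightarrow> complex"
  assumes A: "range A \<subseteq> jump_sets" "disjoint_family A"
    and K: "simple_process M F m \<tau> K" and t: "0 \<le> t"
    and V: "V \<in> borel_measurable (F 0)" "\<And>\<omega>. \<omega> \<in> space M \<Longrightarrow> norm (V \<omega>) \<le> B"
  shows "expectation (\<lambda>\<omega>. V \<omega> * (iexp (w * simple_integral W m \<tau> K t \<omega>) *
           of_real (exp (w\<^sup>2 / 2 * simple_variation m \<tau> K t \<omega>)) * iexp (w * jump_sum k z A 0 t \<omega>)))
    = expectation V * exp (of_real t * jump_rate w k z A)"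
proof -
  \<comment> \<open>The grid is cut at \<open>t\<close> and extended to start at 0 and end at
    \<open>t\<close>, because the jump sum runs over all of \<open>{0<..t}\<close>. The added first
    and last intervals carry weight 0, which shifts the index of the old weights by one.\<close>
  define \<tau>' where "\<tau>' i = (case i of 0 \<Rightarrow> 0 | Suc j \<Rightarrow> if j \<le> m then min t (\<tau> j) else t)" for i
  \<comment> \<open>A weight with \<open>t \<le> \<tau> j\<close> need not be known at the cut grid
    point \<open>t\<close>. Its interval has shrunk to a point, so replacing it by 0 does not affect
    the sums.\<close>
  define K' where "K' i = (case i of 0 \<Rightarrow> \<lambda>_. 0 | Suc j \<Rightarrow> if j < m \<and> \<tau> j < t then K j else (\<lambda>_. 0))" for i
  note tau0 = simple_process_mono(1)[OF K order_refl]
  have tau': "\<tau>' 0 = 0" "\<tau>' (Suc (Suc m)) = t" by (auto simp: \<tau>'_def)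
  have mono: "\<tau>' i \<le> \<tau>' (Suc i)" if "i < Suc (Suc m)" for i
    using that tau0 t K by (cases i) (auto simp: \<tau>'_def simple_process_def Suc_le_eq min_le_iff_disj)
  have Kmeas: "K' i \<in> borel_measurable (F (\<tau>' i))" for i
  proof (cases i)
    case (Suc j)
    show ?thesis
    proof (cases "j < m \<and> \<tau> j < t")
      case True
      then have "\<tau>' i = \<tau> j" by (simp add: Suc \<tau>'_def)
      then show ?thesis using True K by (simp add: Suc K'_def simple_process_def)
    qed (auto simp: Suc K'_def)
  qed (simp add: K'_def)
  have Kbdd: "\<exists>C. \<forall>\<omega>\<in>space M. \<bar>K' i \<omega>\<bar> \<le> C" for i
    using K by (cases i) (auto simp: K'_def simple_process_def intro: exI[of _ 0])
  have 1: "(\<Sum>i<Suc (Suc m). K' i \<omega> * (W (\<tau>' (Suc i)) \<omega> - W (\<tau>' i) \<omega>)) = simple_integral W m \<tau> K t \<omega>" for \<omega>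
    unfolding simple_integral_def sum.lessThan_Suc_shift[of _ "Suc m"]
    using K by (auto simp: K'_def \<tau>'_def simple_process_def intro!: sum.cong)
  have 2: "(\<Sum>i<Suc (Suc m). (K' i \<omega>)\<^sup>2 * (\<tau>' (Suc i) - \<tau>' i)) = simple_variation m \<tau> K t \<omega>" for \<omega>
    unfolding simple_variation_def sum.lessThan_Suc_shift[of _ "Suc m"]
    using K by (auto simp: K'_def \<tau>'_def simple_process_def intro!: sum.cong)
  show ?thesis
    using grid_identity[OF A, of \<tau>' "Suc (Suc m)" K' V B w k z, unfolded 1 2 tau'] mono Kmeas Kbdd V by simp
qed

end

section \<open>Convergence in probability of bounded functionals\<close>

lemma (in prob_space) expectation_tendsto_0:
  fixes D :: "nat \<Rightarrow> 'a \<Rightarrow> real"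
  assumes [measurable]: "\<And>j. D j \<in> borel_measurable M"
    and bdd: "\<And>j \<omega>. \<omega> \<in> space M \<Longrightarrow> 0 \<le> D j \<omega>" "\<And>j \<omega>. \<omega> \<in> space M \<Longrightarrow> D j \<omega> \<le> C"
    and P: "\<And>\<delta>. 0 < \<delta> \<Longrightarrow> (\<lambda>j. prob {\<omega> \<in> space M. \<delta> < D j \<omega>}) \<longlonglongrightarrow> 0"
  shows "(\<lambda>j. expectation (D j)) \<longlonglongrightarrow> 0"
proof (rule LIMSEQ_I)
  fix e :: real assume e: "0 < e"
  obtain \<omega>0 where w0: "\<omega>0 \<in> space M" using not_empty by auto
  have C0: "0 \<le> C" using bdd[OF w0, of 0] by simp
  let ?S = "\<lambda>j. {\<omega> \<in> space M. e / 2 < D j \<omega>}"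
  have "(\<lambda>j. C * prob (?S j)) \<longlonglongrightarrow> C * 0"
    using e by (intro tendsto_mult_left P) simp
  then have "(\<lambda>j. C * prob (?S j)) \<longlonglongrightarrow> 0" by simp
  from LIMSEQ_D[OF this, of "e / 2"] e obtain n0 where n0: "\<And>j. n0 \<le> j \<Longrightarrow> C * prob (?S j) < e / 2"
    using C0 by (auto simp: abs_mult)
  show "\<exists>n0. \<forall>j\<ge>n0. norm (expectation (D j) - 0) < e"
  proof (intro exI allI impI)
    fix j assume j: "n0 \<le> j"
    have iD: "integrable M (D j)"
      using bdd by (intro integrable_const_bound[where B=C]) auto
    have iS: "integrable M (\<lambda>\<omega>. indicator (?S j) \<omega> :: real)"
      by (intro integrable_const_bound[where B=1]) (auto simp: indicator_def)
    have "expectation (D j) \<le> expectation (\<lambda>\<omega>. e / 2 + C * indicator (?S j) \<omega>)"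
      using iS C0 bdd(2) e by (intro integral_mono iD) (auto simp: indicator_def intro: add_increasing)
    also have "\<dots> = e / 2 + C * prob (?S j)"
      using iS by (simp add: prob_space)
    also have "\<dots> < e" using n0[OF j] by simp
    finally have "expectation (D j) < e" .
    moreover have "0 \<le> expectation (D j)" using bdd by (intro integral_nonneg_AE) auto
    ultimately show "norm (expectation (D j) - 0) < e" by simp
  qed
qed

lemma iexp_lipschitz: "norm (iexp x - iexp y) \<le> \<bar>x - y\<bar>"
proof -
  have "iexp x - iexp y = iexp y * (iexp (x - y) - 1)"
    by (simp add: exp_diff right_diff_distrib)
  then have "norm (iexp x - iexp y) = norm (iexp (x - y) - 1)"
    by (simp add: norm_mult del: of_real_diff)
  also have "\<dots> \<le> \<bar>x - y\<bar>"
    using iexp_approx1[of "x - y" 0] by simp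
  finally show ?thesis .
qed

lemma (in prob_space) iexp_tendsto_in_prob:
  assumes [measurable]: "\<And>j. Y j \<in> borel_measurable M" "Z \<in> borel_measurable M"
    and lim: "tendsto_in_prob M Y Z sequentially"
  shows "(\<lambda>j. expectation (\<lambda>\<omega>. norm (iexp (w * Y j \<omega>) - iexp (w * Z \<omega>)))) \<longlonglongrightarrow> 0"
proof (rule expectation_tendsto_0[where C=2])
  fix \<delta> :: real assume d: "0 < \<delta>"
  \<comment> \<open>The summand 1 covers \<open>w = 0\<close>.\<close>
  let ?d = "\<delta> / (\<bar>w\<bar> + 1)"
  let ?D = "\<lambda>j \<omega>. norm (iexp (w * Y j \<omega>) - iexp (w * Z \<omega>))"
  have d': "0 < ?d" using d by simp
  have le: "prob {\<omega> \<in> space M. \<delta> < ?D j \<omega>}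
      \<le> prob {\<omega> \<in> space M. ?d < \<bar>Y j \<omega> - Z \<omega>\<bar>}" for j
  proof (rule finite_measure_mono)
    show "{\<omega> \<in> space M. \<delta> < ?D j \<omega>}
        \<subseteq> {\<omega> \<in> space M. ?d < \<bar>Y j \<omega> - Z \<omega>\<bar>}"
    proof safe
      fix \<omega> assume "\<delta> < ?D j \<omega>"
      also have "\<dots> \<le> \<bar>w\<bar> * \<bar>Y j \<omega> - Z \<omega>\<bar>"
        using iexp_lipschitz[of "w * Y j \<omega>" "w * Z \<omega>"]
        unfolding right_diff_distrib[symmetric] abs_mult .
      also have "\<dots> \<le> (\<bar>w\<bar> + 1) * \<bar>Y j \<omega> - Z \<omega>\<bar>"
        by (intro mult_right_mono) auto
      finally show "?d < \<bar>Y j \<omega> - Z \<omega>\<bar>"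
        by (subst pos_divide_less_eq) (auto simp: mult.commute)
    qed
  qed measurable
  have "(\<lambda>j. prob {\<omega> \<in> space M. ?d < \<bar>Y j \<omega> - Z \<omega>\<bar>}) \<longlonglongrightarrow> 0"
    using lim d' unfolding tendsto_in_prob_def by blast
  then show "(\<lambda>j. prob {\<omega> \<in> space M. \<delta> < ?D j \<omega>}) \<longlonglongrightarrow> 0"
    by (rule tendsto_0_le[where K=1]) (intro always_eventually allI, use le in simp)
next
  fix j \<omega>
  show "norm (iexp (w * Y j \<omega>) - iexp (w * Z \<omega>)) \<le> 2"
    using norm_triangle_ineq4[of "iexp (w * Y j \<omega>)" "iexp (w * Z \<omega>)"]
    unfolding norm_exp_i_times by simp
qed simp_all

section \<open>From finite jump sums to the compensated integral\<close>

text \<open>The fibre of \<open>S\<close> over 0 may have infinite measure, as it contains a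
  neighbourhood of the origin in the applications; \<open>h 0 = 0\<close> removes it from the
  sum.\<close>

lemma integral_simple_function_sum:
  fixes S :: "'a \<Rightarrow> real" and h :: "real \<Rightarrow> 'b :: {banach, second_countable_topology}"
  assumes fin: "finite (range S)" and h0: "h 0 = 0"
    and S: "\<And>z. z \<noteq> 0 \<Longrightarrow> S -` {z} \<inter> space \<mu> \<in> sets \<mu>"
      "\<And>z. z \<noteq> 0 \<Longrightarrow> emeasure \<mu> (S -` {z} \<inter> space \<mu>) < \<infinity>"
  shows "(\<integral>y. h (S y) \<partial>\<mu>) = (\<Sum>z\<in>range S - {0}. measure \<mu> (S -` {z} \<inter> space \<mu>) *\<^sub>R h z)"
proof -
  have "(\<integral>y. h (S y) \<partial>\<mu>) = (\<integral>y. (\<Sum>z\<in>range S - {0}. indicator (S -` {z} \<inter> space \<mu>) y *\<^sub>R h z) \<partial>\<mu>)"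
  proof (rule Bochner_Integration.integral_cong[OF refl])
    fix y assume y: "y \<in> space \<mu>"
    have "(\<Sum>z\<in>range S - {0}. indicator (S -` {z} \<inter> space \<mu>) y *\<^sub>R h z)
      = (\<Sum>z\<in>range S - {0}. if z = S y then h z else 0)"
      using y by (intro sum.cong) (auto simp: indicator_def)
    then show "h (S y) = (\<Sum>z\<in>range S - {0}. indicator (S -` {z} \<inter> space \<mu>) y *\<^sub>R h z)"
      using fin h0 by (simp add: sum.delta)
  qed
  also have "\<dots> = (\<Sum>z\<in>range S - {0}. \<integral>y. indicator (S -` {z} \<inter> space \<mu>) y *\<^sub>R h z \<partial>\<mu>)"
    using S by (intro Bochner_Integration.integral_sum integrable_scaleR_left integrable_real_indicator) auto
  also have "\<dots> = (\<Sum>z\<in>range S - {0}. measure \<mu> (S -` {z} \<inter> space \<mu>) *\<^sub>R h z)"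
  proof (intro sum.cong refl)
    fix z assume "z \<in> range S - {0}"
    then have "integrable \<mu> (indicator (S -` {z} \<inter> space \<mu>) :: 'a \<Rightarrow> real)"
      using S by (intro integrable_real_indicator) auto
    then show "(\<integral>y. indicator (S -` {z} \<inter> space \<mu>) y *\<^sub>R h z \<partial>\<mu>) = measure \<mu> (S -` {z} \<inter> space \<mu>) *\<^sub>R h z"
      by (subst integral_scaleR_left) auto
  qed
  finally show ?thesis .
qed

lemma closure_outside_interval:
  assumes "S \<subseteq> {y::real. \<epsilon> < \<bar>y\<bar>}" "0 < \<epsilon>"
  shows "0 \<notin> closure S"
proof -
  have "closed {y::real. \<epsilon> \<le> \<bar>y\<bar>}"
    by (intro closed_Collect_le continuous_intros)
  then have "closure S \<subseteq> {y. \<epsilon> \<le> \<bar>y\<bar>}"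
    using assms by (intro closure_minimal) auto
  then show ?thesis using assms(2) by auto
qed

lemma jump_setsI:
  assumes "S \<in> sets borel" "S \<subseteq> {y::real. \<epsilon> < \<bar>y\<bar>}" "0 < \<epsilon>"
  shows "S \<in> jump_sets"
  using assms closure_outside_interval[of S \<epsilon>] by (simp add: jump_sets_def)

text \<open>An integer-valued measure has no mass far out, so its integrals over jumps bounded away
  from 0 are finite sums.\<close>
lemma integrable_counting_measure:
  fixes \<mu> :: "real measure"
  assumes sets: "sets \<mu> = sets borel"
    and nat: "\<And>S. S \<in> jump_sets \<Longrightarrow> emeasure \<mu> S \<in> range of_nat" and e: "0 < \<epsilon>"
  shows "integrable \<mu> (\<lambda>y. indicator {y. \<epsilon> < \<bar>y\<bar>} y * y)"
proof -
  \<comment> \<open>The lower bound \<open>\<epsilon>\<close> keeps \<open>B n\<close> away from 0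
    also for small \<open>n\<close>. So every \<open>B n\<close> has a finite natural number as
    mass, and continuity from above forces this number to 0 for large \<open>n\<close>.\<close>
  define B where "B n = {y::real. max \<epsilon> (real n) < \<bar>y\<bar>}" for n
  have Bs: "B n \<in> sets borel" for n unfolding B_def by measurable
  have Bj: "B n \<in> jump_sets" for n
    using e by (intro jump_setsI[OF Bs]) (auto simp: B_def)
  have fin: "emeasure \<mu> (B n) \<noteq> \<infinity>" for n
    using nat[OF Bj[of n]] by auto
  have "(\<lambda>n. emeasure \<mu> (B n)) \<longlonglongrightarrow> emeasure \<mu> (\<Inter>n. B n)"
    using Bs fin by (intro Lim_emeasure_decseq) (auto simp: sets B_def decseq_def)
  moreover have "(\<Inter>n. B n) = {}"
  proof -
    have "y \<notin> B (nat \<lceil>\<bar>y\<bar>\<rceil>)" for y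
      using real_nat_ceiling_ge[of "\<bar>y\<bar>"] unfolding B_def mem_Collect_eq max_less_iff_conj by linarith
    then show ?thesis by blast
  qed
  ultimately have "(\<lambda>n. emeasure \<mu> (B n)) \<longlonglongrightarrow> 0" by simp
  then have "eventually (\<lambda>n. emeasure \<mu> (B n) < 1) sequentially"
    by (rule order_tendstoD) simp
  then obtain n where "emeasure \<mu> (B n) < 1" by (auto simp: eventually_sequentially)
  then have Bn: "emeasure \<mu> (B n) = 0"
    using nat[OF Bj[of n]] by auto
  define S where "S = {y::real. \<epsilon> < \<bar>y\<bar>}"
  have S[measurable]: "S \<in> sets borel" unfolding S_def by measurable
  have "S \<in> jump_sets" using e by (intro jump_setsI[OF S]) (auto simp: S_def)
  then have Sfin: "emeasure \<mu> S < \<infinity>" using nat[of S] by (auto simp: less_top[symmetric])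
  have meas: "(\<lambda>y. indicator S y * y) \<in> borel_measurable \<mu>"
    by (subst measurable_cong_sets[OF sets refl]) measurable
  have "AE y in \<mu>. y \<notin> B n"
    by (rule AE_I[of _ _ "B n"]) (use Bn Bs sets in auto)
  then have "AE y in \<mu>. y \<in> S \<longrightarrow> norm (indicator S y * y) \<le> max \<epsilon> (real n)"
    by eventually_elim (auto simp: B_def S_def)
  then have "integrable \<mu> (\<lambda>y. indicator S y * y)"
    using S Sfin meas by (intro integrableI_bounded_set[where A=S and B="max \<epsilon> (real n)"]) (auto simp: sets)
  then show ?thesis unfolding S_def .
qed

context levy_noise begin

lemma sets_nu[measurable_cong]: "sets \<nu> = sets borel"
  using levy_nu by (simp add: levy_measure_def)

lemma space_nu[simp]: "space \<nu> = UNIV"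
  using sets_eq_imp_space_eq[OF sets_nu] by simp

text \<open>Chebyshev's inequality with the function \<open>min 1 (y\<^sup>2)\<close> from the
  definition of a Levy measure.\<close>

lemma nu_finite: "0 < \<epsilon> \<Longrightarrow> emeasure \<nu> {y. \<epsilon> < \<bar>y\<bar>} < \<infinity>"
proof -
  assume e: "0 < \<epsilon>"
  let ?c = "ennreal (min 1 (\<epsilon>\<^sup>2))"
  have c: "?c \<noteq> 0" "?c \<noteq> \<infinity>" using e by (auto simp: min_def)
  have "?c * emeasure \<nu> {y. \<epsilon> < \<bar>y\<bar>} = (\<integral>\<^sup>+y. ?c * indicator {y. \<epsilon> < \<bar>y\<bar>} y \<partial>\<nu>)"
    by (subst nn_integral_cmult_indicator) auto
  also have "\<dots> \<le> (\<integral>\<^sup>+y. ennreal (min 1 (y\<^sup>2)) \<partial>\<nu>)"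
  proof (rule nn_integral_mono)
    fix y show "?c * indicator {y. \<epsilon> < \<bar>y\<bar>} y \<le> ennreal (min 1 (y\<^sup>2))"
    proof (cases "\<epsilon> < \<bar>y\<bar>")
      case True
      then have "\<epsilon>\<^sup>2 \<le> y\<^sup>2" using e by (metis abs_le_square_iff abs_of_pos less_imp_le)
      then show ?thesis using True by (auto intro!: ennreal_leI)
    qed auto
  qed
  also have "\<dots> < \<infinity>" using levy_nu by (simp add: levy_measure_def)
  finally have "?c * emeasure \<nu> {y. \<epsilon> < \<bar>y\<bar>} < \<infinity>" .
  then show ?thesis using c by (auto simp: ennreal_mult_less_top)
qed

text \<open>The identity is approximated by simple functions, whose integrals against
  \<open>N t \<omega>\<close> are finite jump sums. Dominated convergence applies three times:
  pathwise for the counting measure, under \<open>M\<close> because \<open>Z\<close> is bounded, and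
  under \<open>\<nu>\<close> by \<open>int\<close>. The factor \<open>Z\<close> will be the
  exponential of the Wiener part, which is why the hypothesis \<open>id\<close> is joint.\<close>

lemma jump_char_limit:
  fixes Z :: "'w \<Rightarrow> complex"
  assumes Z[measurable]: "Z \<in> borel_measurable M" and Zb: "\<And>\<omega>. \<omega> \<in> space M \<Longrightarrow> norm (Z \<omega>) \<le> B"
    and t: "0 \<le> t" and e: "0 < \<epsilon>"
    and int: "set_integrable \<nu> {y. \<epsilon> < \<bar>y\<bar>} (\<lambda>y. y)"
    and id: "\<And>k z A. range A \<subseteq> jump_sets \<Longrightarrow> disjoint_family A \<Longrightarrow>
      expectation (\<lambda>\<omega>. Z \<omega> * iexp (w * jump_sum k z A 0 t \<omega>)) = c * exp (of_real t * jump_rate w k z A)"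
  shows "(\<lambda>\<omega>. LINT y:{y. \<epsilon> < \<bar>y\<bar>}|N t \<omega>. y) \<in> borel_measurable M"
    and "expectation (\<lambda>\<omega>. Z \<omega> * iexp (w * (LINT y:{y. \<epsilon> < \<bar>y\<bar>}|N t \<omega>. y)))
      = c * exp (of_real t * (\<integral>y. indicator {y. \<epsilon> < \<bar>y\<bar>} y *\<^sub>R (iexp (w * y) - 1) \<partial>\<nu>))"
proof -
  let ?E = "{y::real. \<epsilon> < \<bar>y\<bar>}"
  define J where "J \<omega> = (LINT y:?E|N t \<omega>. y)" for \<omega>
  have "(\<lambda>y::real. y) \<in> borel_measurable borel" by simp
  from borel_measurable_implies_sequence_metric[OF this, of 0] obtain s :: "nat \<Rightarrow> real \<Rightarrow> real" where
    s: "\<And>i. simple_function borel (s i)" "\<And>y. (\<lambda>i. s i y) \<longlonglongrightarrow> y" "\<And>i y. \<bar>s i y\<bar> \<le> 2 * \<bar>y\<bar>"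
    by (auto simp: dist_real_def)
  \<comment> \<open>Restricting to \<open>?E\<close> places every level set of a nonzero value
    inside \<open>?E\<close>, hence makes it a jump set.\<close>
  define S where "S i y = indicator ?E y * s i y" for i y
  have [measurable]: "s i \<in> borel_measurable borel" for i
    by (rule borel_measurable_simple_function[OF s(1)])
  have Sm[measurable]: "S i \<in> borel_measurable borel" for i unfolding S_def[abs_def] by measurable
  have fin: "finite (range (S i))" for i
  proof -
    have "range (S i) \<subseteq> insert 0 (range (s i))" by (auto simp: S_def indicator_def)
    then show ?thesis using s(1)[of i] by (auto simp: simple_function_def intro: finite_subset)
  qed
  have Slim: "(\<lambda>i. S i y) \<longlonglongrightarrow> indicator ?E y * y" for y
    unfolding S_def by (intro tendsto_intros s)
  have Sbd: "\<bar>S i y\<bar> \<le> 2 * \<bar>indicator ?E y * y\<bar>" for i y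
    using s(3)[of i y] by (auto simp: S_def indicator_def)
  have sub: "S i -` {z} \<subseteq> ?E" if "z \<noteq> 0" for i z
    using that by (auto simp: S_def indicator_def split: if_splits)
  have Sset[measurable]: "S i -` {z} \<in> sets borel" for i z
    using measurable_sets[OF Sm, of "{z}"] by simp
  have Sj: "S i -` {z} \<in> jump_sets" if "z \<noteq> 0" for i z
    by (rule jump_setsI[OF Sset sub[OF that] e])
  define k where "k i = card (range (S i) - {0})" for i
  have "\<exists>x. \<forall>i. bij_betw (x i) {..<k i} (range (S i) - {0})"
    unfolding k_def using fin by (intro choice allI) (metis ex_bij_betw_nat_finite finite_Diff atLeast0LessThan)
  then obtain x where x: "\<And>i. bij_betw (x i) {..<k i} (range (S i) - {0})" by blast
  \<comment> \<open>Padded with empty sets, since \<open>id\<close> speaks of families indexed by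
    all natural numbers.\<close>
  define A where "A i j = (if j < k i then S i -` {x i j} else {})" for i j
  have xn0: "x i j \<noteq> 0" if "j < k i" for i j
    using bij_betwE[OF x[of i]] that by auto
  have Aj: "range (A i) \<subseteq> jump_sets" for i
    using Sj xn0 by (auto simp: A_def jump_sets_def)
  have Ad: "disjoint_family (A i)" for i
  proof -
    have "inj_on (x i) {..<k i}" using x[of i] by (simp add: bij_betw_def)
    then show ?thesis by (auto simp: disjoint_family_on_def A_def inj_on_def)
  qed
  have Nfin: "emeasure (N t \<omega>) (S i -` {z}) < \<infinity>" if "\<omega> \<in> space M" "z \<noteq> 0" for \<omega> z i
    using emeasure_N[OF t that(1) Sj[OF that(2)], of i] by (metis ennreal_of_nat_neq_top infinity_ennreal_def less_top)
  have spN: "space (N t \<omega>) = UNIV" if "\<omega> \<in> space M" for \<omega>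
    using sets_eq_imp_space_eq[OF sets_N[OF t that]] by simp
  let ?J = "\<lambda>i. jump_sum (k i) (x i) (A i) 0 t"
  let ?u = "\<lambda>y. indicator ?E y *\<^sub>R (iexp (w * y) - 1)"
  have j: "?J i \<omega> = (\<integral>y. S i y \<partial>N t \<omega>)" if w: "\<omega> \<in> space M" for i \<omega>
  proof -
    have "(\<integral>y. S i y \<partial>N t \<omega>) = (\<Sum>z\<in>range (S i) - {0}. measure (N t \<omega>) (S i -` {z}) *\<^sub>R z)"
      using integral_simple_function_sum[OF fin[of i], of "\<lambda>z. z" "N t \<omega>"] Nfin[OF w] spN[OF w] sets_N[OF t w] by simp
    also have "\<dots> = (\<Sum>j<k i. measure (N t \<omega>) (S i -` {x i j}) *\<^sub>R x i j)"
      by (rule sum.reindex_bij_betw[OF x, symmetric])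
    also have "\<dots> = ?J i \<omega>"
      unfolding jump_sum_def
    proof (rule sum.cong[OF refl])
      fix j assume "j \<in> {..<k i}"
      moreover have "jump_count N (A i j) 0 \<omega> = 0"
        using path_cond w Aj[of i] by blast
      ultimately show "measure (N t \<omega>) (S i -` {x i j}) *\<^sub>R x i j =
         x i j * (jump_count N (A i j) t \<omega> - jump_count N (A i j) 0 \<omega>)"
        by (simp add: A_def jump_count_def)
    qed
    finally show ?thesis by simp
  qed
  have lim: "(\<lambda>i. ?J i \<omega>) \<longlonglongrightarrow> J \<omega>" if w: "\<omega> \<in> space M" for \<omega>
  proof -
    note [measurable_cong] = sets_N[OF t w]
    have "integrable (N t \<omega>) (\<lambda>y. indicator ?E y * y)"
      using emeasure_N[OF t w] by (intro integrable_counting_measure[OF sets_N[OF t w] _ e]) (metis rangeI)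
    then have i2: "integrable (N t \<omega>) (\<lambda>y. 2 * \<bar>indicator ?E y * y\<bar>)"
      by (intro integrable_mult_right integrable_abs)
    have "(\<lambda>i. \<integral>y. S i y \<partial>N t \<omega>) \<longlonglongrightarrow> (\<integral>y. indicator ?E y * y \<partial>N t \<omega>)"
      by (rule integral_dominated_convergence[OF _ _ i2]) (use Slim Sbd in auto)
    then show ?thesis unfolding j[OF w] by (simp add: J_def set_lebesgue_integral_def)
  qed
  have jm[measurable]: "?J i \<in> borel_measurable M" for i
    by (rule measurable_F[OF measurable_jump_sum[OF Aj order_refl t]])
  show Jm: "(\<lambda>\<omega>. LINT y:?E|N t \<omega>. y) \<in> borel_measurable M"
    using borel_measurable_LIMSEQ_real[OF lim jm] by (simp add: J_def[abs_def])
  then have [measurable]: "J \<in> borel_measurable M" by (simp add: J_def[abs_def])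
  have "(\<lambda>i. expectation (\<lambda>\<omega>. Z \<omega> * iexp (w * ?J i \<omega>)))
      \<longlonglongrightarrow> expectation (\<lambda>\<omega>. Z \<omega> * iexp (w * J \<omega>))"
  proof (rule integral_dominated_convergence[where w="\<lambda>_. B"])
    show "AE \<omega> in M. (\<lambda>i. Z \<omega> * iexp (w * ?J i \<omega>)) \<longlonglongrightarrow> Z \<omega> * iexp (w * J \<omega>)"
      by (rule AE_I2) (intro tendsto_intros lim)
    show "AE \<omega> in M. norm (Z \<omega> * iexp (w * ?J i \<omega>)) \<le> B" for i
      by (rule AE_I2) (unfold norm_mult norm_exp_i_times, simp add: Zb)
  qed simp_all
  moreover have "(\<lambda>i. expectation (\<lambda>\<omega>. Z \<omega> * iexp (w * ?J i \<omega>)))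
      \<longlonglongrightarrow> c * exp (of_real t * (\<integral>y. ?u y \<partial>\<nu>))"
  proof -
    have r: "jump_rate w (k i) (x i) (A i) = (\<integral>y. iexp (w * S i y) - 1 \<partial>\<nu>)" for i
    proof -
      have fn: "emeasure \<nu> (S i -` {z}) < \<infinity>" if "z \<noteq> 0" for z
        using emeasure_mono[OF sub[OF that, of i], of \<nu>] nu_finite[OF e] by (auto simp: sets_nu)
      have "(\<integral>y. iexp (w * S i y) - 1 \<partial>\<nu>) = (\<Sum>z\<in>range (S i) - {0}. measure \<nu> (S i -` {z}) *\<^sub>R (iexp (w * z) - 1))"
        using integral_simple_function_sum[OF fin[of i], of "\<lambda>z. iexp (w * z) - 1" "\<nu>"] fn by (simp add: sets_nu)
      also have "\<dots> = (\<Sum>j<k i. measure \<nu> (S i -` {x i j}) *\<^sub>R (iexp (w * x i j) - 1))"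
        by (rule sum.reindex_bij_betw[OF x, symmetric])
      also have "\<dots> = jump_rate w (k i) (x i) (A i)"
        unfolding jump_rate_def by (rule sum.cong) (auto simp: A_def scaleR_conv_of_real)
      finally show ?thesis by simp
    qed
    have i2: "integrable \<nu> (\<lambda>y. \<bar>w\<bar> * (2 * \<bar>indicator ?E y * y\<bar>))"
      using int by (intro integrable_mult_right integrable_abs) (simp add: set_integrable_def)
    have "(\<lambda>i. \<integral>y. iexp (w * S i y) - 1 \<partial>\<nu>) \<longlonglongrightarrow> (\<integral>y. ?u y \<partial>\<nu>)"
    proof (rule integral_dominated_convergence[OF _ _ i2])
      show "AE y in \<nu>. (\<lambda>i. iexp (w * S i y) - 1) \<longlonglongrightarrow> ?u y"
      proof (rule AE_I2)
        fix y
        have "(\<lambda>i. iexp (w * S i y) - 1) \<longlonglongrightarrow> iexp (w * (indicator ?E y * y)) - 1"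
          by (intro tendsto_intros Slim)
        then show "(\<lambda>i. iexp (w * S i y) - 1) \<longlonglongrightarrow> ?u y"
          by (auto simp: indicator_def split: if_splits)
      qed
      show "AE y in \<nu>. norm (iexp (w * S i y) - 1) \<le> \<bar>w\<bar> * (2 * \<bar>indicator ?E y * y\<bar>)" for i
      proof (rule AE_I2)
        fix y
        have "norm (iexp (w * S i y) - 1) \<le> \<bar>w * S i y\<bar>"
          using iexp_lipschitz[of "w * S i y" 0] by simp
        also have "\<dots> \<le> \<bar>w\<bar> * (2 * \<bar>indicator ?E y * y\<bar>)"
          unfolding abs_mult[of w] by (intro mult_left_mono Sbd) simp
        finally show "norm (iexp (w * S i y) - 1) \<le> \<bar>w\<bar> * (2 * \<bar>indicator ?E y * y\<bar>)" .
      qed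
    qed measurable
    then show ?thesis
      unfolding id[OF Aj Ad] r by (intro tendsto_intros)
  qed
  ultimately show "expectation (\<lambda>\<omega>. Z \<omega> * iexp (w * (LINT y:{y. \<epsilon> < \<bar>y\<bar>}|N t \<omega>. y)))
      = c * exp (of_real t * (\<integral>y. indicator {y. \<epsilon> < \<bar>y\<bar>} y *\<^sub>R (iexp (w * y) - 1) \<partial>\<nu>))"
    unfolding J_def by (rule LIMSEQ_unique)
qed

text \<open>The remainder exp(iu) - 1 - iu is at most u^2/2 and at most 2|u| in modulus. The first
  bound serves for small jumps through the Levy condition, the second for large jumps through their
  first moment.\<close>

lemma levy_integrand_integrable:
  assumes "set_integrable \<nu> {y. 1 < \<bar>y\<bar>} (\<lambda>y. y)"
  obtains G where "integrable \<nu> G"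
    "\<And>y. norm (iexp (w * y) - 1 - \<i> * of_real (w * y)) \<le> G y"
proof -
  define G where "G y = w\<^sup>2 / 2 * min 1 (y\<^sup>2) + 2 * \<bar>w\<bar> * \<bar>indicator {y. 1 < \<bar>y\<bar>} y * y\<bar>" for y :: real
  have "integrable \<nu> (\<lambda>y. min 1 (y\<^sup>2))"
    using levy_nu by (intro integrableI_bounded) (auto simp: levy_measure_def)
  then have "integrable \<nu> G"
    unfolding G_def using assms
    by (intro Bochner_Integration.integrable_add integrable_mult_right integrable_abs) (simp_all add: set_integrable_def)
  moreover have "norm (iexp (w * y) - 1 - \<i> * of_real (w * y)) \<le> G y" for y
  proof -
    have e: "iexp (w * y) - 1 - \<i> * of_real (w * y) = iexp (w * y) - (\<Sum>k\<le>1. (\<i> * of_real (w * y)) ^ k / fact k)"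
      by simp
    show ?thesis
    proof (cases "1 < \<bar>y\<bar>")
      case True
      have "norm (iexp (w * y) - 1 - \<i> * of_real (w * y)) \<le> 2 * \<bar>w * y\<bar>"
        unfolding e using iexp_approx2[of "w * y" 1] by simp
      also have "\<dots> \<le> G y" using True by (simp add: G_def abs_mult)
      finally show ?thesis .
    next
      case False
      then have "y\<^sup>2 \<le> 1" by (simp add: abs_square_le_1)
      have "norm (iexp (w * y) - 1 - \<i> * of_real (w * y)) \<le> \<bar>w * y\<bar>\<^sup>2 / 2"
        unfolding e using iexp_approx1[of "w * y" 1] by (simp add: numeral_2_eq_2)
      also have "\<dots> = G y" using False \<open>y\<^sup>2 \<le> 1\<close> by (simp add: G_def power_mult_distrib)
      finally show ?thesis .
    qed
  qed
  ultimately show ?thesis by (rule that)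
qed

text \<open>Subtracting \<open>t * b j\<close> multiplies the exponential by a deterministic phase,
  which turns \<open>iexp (w * y) - 1\<close> under the integral into
  \<open>iexp (w * y) - 1 - \<i> * of_real (w * y)\<close>. Only this combination is integrable down
  to 0; the two pieces may diverge separately as the cut-off is removed.\<close>

lemma compensated_char:
  fixes Z :: "'w \<Rightarrow> complex"
  assumes Z[measurable]: "Z \<in> borel_measurable M" and Zb: "\<And>\<omega>. \<omega> \<in> space M \<Longrightarrow> norm (Z \<omega>) \<le> B"
    and t: "0 \<le> t" and comp: "has_compensated_integral M N \<nu> t Y"
    and id: "\<And>k z A. range A \<subseteq> jump_sets \<Longrightarrow> disjoint_family A \<Longrightarrow>
      expectation (\<lambda>\<omega>. Z \<omega> * iexp (w * jump_sum k z A 0 t \<omega>)) = c * exp (of_real t * jump_rate w k z A)"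
  shows "expectation (\<lambda>\<omega>. Z \<omega> * iexp (w * Y \<omega>)) = c * exp (of_real t * levy_exponent \<nu> w)"
proof -
  define e where "e j = inverse (real (Suc j))" for j
  have e: "0 < e j" for j by (simp add: e_def)
  have elim: "e \<longlonglongrightarrow> 0" unfolding e_def by (rule LIMSEQ_inverse_real_of_nat)
  have efilt: "filterlim e (at_right 0) sequentially"
    unfolding at_within_def using e by (auto simp: filterlim_inf filterlim_principal elim)
  let ?E = "\<lambda>j. {y::real. e j < \<bar>y\<bar>}"
  have [measurable]: "Y \<in> borel_measurable M" and int: "\<And>\<epsilon>. 0 < \<epsilon> \<Longrightarrow> set_integrable \<nu> {y. \<epsilon> < \<bar>y\<bar>} (\<lambda>y. y)"
    using comp by (auto simp: has_compensated_integral_def)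
  define b where "b j = (LINT y:?E j|\<nu>. y)" for j
  define J where "J j \<omega> = (LINT y:?E j|N t \<omega>. y) - t * b j" for j \<omega>
  note jc = jump_char_limit[OF Z Zb t e int[OF e] id]
  have Jm[measurable]: "J j \<in> borel_measurable M" for j
    unfolding J_def[abs_def] using jc(1)[of j] by measurable
  let ?d = "\<lambda>j \<omega>. norm (iexp (w * J j \<omega>) - iexp (w * Y \<omega>))"
  let ?Z = "\<lambda>V \<omega>. Z \<omega> * iexp (w * V \<omega>)"
  have "tendsto_in_prob M J Y sequentially"
    unfolding tendsto_in_prob_def
  proof (intro allI impI)
    fix \<delta> :: real assume "0 < \<delta>"
    then have "((\<lambda>\<epsilon>. prob {\<omega> \<in> space M. \<delta> < \<bar>(LINT y:{y. \<epsilon> < \<bar>y\<bar>}|N t \<omega>. y)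
        - t * (LINT y:{y. \<epsilon> < \<bar>y\<bar>}|\<nu>. y) - Y \<omega>\<bar>}) \<longlongrightarrow> 0) (at_right 0)"
      using comp unfolding has_compensated_integral_def tendsto_in_prob_def by blast
    from filterlim_compose[OF this efilt]
    show "(\<lambda>j. prob {\<omega> \<in> space M. \<delta> < \<bar>J j \<omega> - Y \<omega>\<bar>}) \<longlonglongrightarrow> 0"
      by (simp add: J_def b_def)
  qed
  from iexp_tendsto_in_prob[OF Jm \<open>Y \<in> borel_measurable M\<close> this, of w]
  have 1: "(\<lambda>j. expectation (\<lambda>\<omega>. ?d j \<omega>)) \<longlonglongrightarrow> 0" .
  obtain \<omega>0 where w0: "\<omega>0 \<in> space M" using not_empty by auto
  have B0: "0 \<le> B" using Zb[OF w0] norm_ge_zero order_trans by blast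
  have iZ: "integrable M (\<lambda>\<omega>. Z \<omega> * iexp (w * V \<omega>))" if [measurable]: "V \<in> borel_measurable M" for V
    by (rule integrable_const_bound[where B=B]) (auto simp: norm_mult Zb simp del: of_real_mult intro!: AE_I2)
  have le: "norm (expectation (\<lambda>\<omega>. ?Z (J j) \<omega>) - expectation (\<lambda>\<omega>. ?Z Y \<omega>))
      \<le> B * expectation (\<lambda>\<omega>. ?d j \<omega>)" for j
  proof -
    have i1: "integrable M (\<lambda>\<omega>. ?d j \<omega>)"
      by (intro integrable_norm Bochner_Integration.integrable_diff integrable_iexp) measurable
    have "norm (expectation (\<lambda>\<omega>. ?Z (J j) \<omega>) - expectation (\<lambda>\<omega>. ?Z Y \<omega>))
      = norm (expectation (\<lambda>\<omega>. ?Z (J j) \<omega> - ?Z Y \<omega>))"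
      by (subst Bochner_Integration.integral_diff[OF iZ iZ]) measurable
    also have "\<dots> \<le> expectation (\<lambda>\<omega>. norm (?Z (J j) \<omega> - ?Z Y \<omega>))"
      by (rule integral_norm_bound)
    also have "\<dots> \<le> expectation (\<lambda>\<omega>. B * ?d j \<omega>)"
    proof (rule integral_mono)
      show "integrable M (\<lambda>\<omega>. norm (?Z (J j) \<omega> - ?Z Y \<omega>))"
        by (intro integrable_norm Bochner_Integration.integrable_diff iZ) measurable
      show "integrable M (\<lambda>\<omega>. B * ?d j \<omega>)"
        by (intro integrable_mult_right i1)
      show "norm (?Z (J j) \<omega> - ?Z Y \<omega>)
          \<le> B * ?d j \<omega>" if "\<omega> \<in> space M" for \<omega>
        unfolding right_diff_distrib[symmetric] norm_mult[of "Z \<omega>"]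
        by (intro mult_right_mono Zb[OF that] norm_ge_zero)
    qed
    finally show ?thesis by simp
  qed
  have "(\<lambda>j. B * expectation (\<lambda>\<omega>. ?d j \<omega>)) \<longlonglongrightarrow> 0"
    using tendsto_mult_left[OF 1, of B] by simp
  then have "(\<lambda>j. expectation (\<lambda>\<omega>. ?Z (J j) \<omega>) - expectation (\<lambda>\<omega>. ?Z Y \<omega>)) \<longlonglongrightarrow> 0"
    by (rule Lim_null_comparison[rotated]) (intro always_eventually allI le)
  then have lim1: "(\<lambda>j. expectation (\<lambda>\<omega>. ?Z (J j) \<omega>)) \<longlonglongrightarrow> expectation (\<lambda>\<omega>. ?Z Y \<omega>)"
    by (simp only: LIM_zero_iff)
  let ?h = "\<lambda>y. iexp (w * y) - 1 - \<i> * of_real (w * y)"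
  let ?H = "\<lambda>j. \<integral>y. indicator (?E j) y *\<^sub>R ?h y \<partial>\<nu>"
  let ?u = "\<lambda>j y. indicator (?E j) y *\<^sub>R (iexp (w * y) - 1)"
  have eq: "expectation (\<lambda>\<omega>. ?Z (J j) \<omega>) = c * exp (of_real t * ?H j)" for j
  proof -
    have i1: "integrable \<nu> (\<lambda>y. indicator (?E j) y * y)"
      using int[OF e[of j]] by (simp add: set_integrable_def)
    have i2: "integrable \<nu> (\<lambda>y. ?u j y)"
    proof (rule Bochner_Integration.integrable_bound[OF integrable_mult_right[OF i1, of w]])
      show "AE y in \<nu>. norm (?u j y) \<le> norm (w * (indicator (?E j) y * y))"
      proof (rule AE_I2)
        fix y
        show "norm (?u j y) \<le> norm (w * (indicator (?E j) y * y))"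
          using iexp_lipschitz[of "w * y" 0] by (simp add: indicator_def)
      qed
    qed measurable
    have "?H j
      = (\<integral>y. ?u j y - \<i> * of_real w * of_real (indicator (?E j) y * y) \<partial>\<nu>)"
      by (intro Bochner_Integration.integral_cong refl) (simp add: indicator_def)
    also have "\<dots> = (\<integral>y. ?u j y \<partial>\<nu>) -
        (\<integral>y. \<i> * of_real w * of_real (indicator (?E j) y * y) \<partial>\<nu>)"
      by (intro Bochner_Integration.integral_diff i2 integrable_mult_right integrable_of_real i1)
    also have "(\<integral>y. \<i> * of_real w * of_real (indicator (?E j) y * y) \<partial>\<nu>) = \<i> * of_real w * of_real (b j)"
      by (simp only: integral_mult_right_zero integral_complex_of_real b_def set_lebesgue_integral_def real_scaleR_def)
    finally have e1: "(\<integral>y. ?u j y \<partial>\<nu>)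
      = ?H j + \<i> * of_real w * of_real (b j)" by simp
    have "expectation (\<lambda>\<omega>. ?Z (J j) \<omega>)
      = expectation (\<lambda>\<omega>. exp (- (\<i> * of_real (w * (t * b j)))) * (Z \<omega> * iexp (w * (LINT y:?E j|N t \<omega>. y))))"
      by (intro Bochner_Integration.integral_cong refl)
        (simp add: J_def right_diff_distrib exp_diff exp_minus field_simps)
    also have "\<dots> = exp (- (\<i> * of_real (w * (t * b j)))) * (c * exp (of_real t * (\<integral>y. ?u j y \<partial>\<nu>)))"
      using jc(2)[of j] by simp
    also have "\<dots> = c * exp (of_real t * ?H j)"
      unfolding e1 by (simp add: distrib_left exp_add exp_minus field_simps)
    finally show ?thesis .
  qed
  obtain G where G: "integrable \<nu> G" "\<And>y. norm (?h y) \<le> G y"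
    using levy_integrand_integrable[OF int[of 1], of w] by auto
  have "(\<lambda>j. ?H j) \<longlonglongrightarrow> (\<integral>y. ?h y \<partial>\<nu>)"
  proof (rule integral_dominated_convergence[OF _ _ G(1)])
    show "AE y in \<nu>. (\<lambda>j. indicator (?E j) y *\<^sub>R ?h y) \<longlonglongrightarrow> ?h y"
    proof (rule AE_I2)
      fix y :: real
      show "(\<lambda>j. indicator (?E j) y *\<^sub>R ?h y) \<longlonglongrightarrow> ?h y"
      proof (cases "y = 0")
        case False
        then have "eventually (\<lambda>j. e j < \<bar>y\<bar>) sequentially"
          by (intro order_tendstoD(2)[OF elim]) auto
        then have "eventually (\<lambda>j. indicator (?E j) y *\<^sub>R ?h y = ?h y) sequentially"
          by eventually_elim simp
        then show ?thesis by (rule tendsto_eventually)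
      qed simp
    qed
    show "AE y in \<nu>. norm (indicator (?E j) y *\<^sub>R ?h y) \<le> G y" for j
    proof (rule AE_I2)
      fix y
      have "norm (indicator (?E j) y *\<^sub>R ?h y) \<le> norm (?h y)" by (simp add: indicator_def)
      also have "\<dots> \<le> G y" by (rule G(2))
      finally show "norm (indicator (?E j) y *\<^sub>R ?h y) \<le> G y" .
    qed
  qed measurable
  then have "(\<lambda>j. ?H j) \<longlonglongrightarrow> levy_exponent \<nu> w"
    unfolding levy_exponent_def .
  then have "(\<lambda>j. c * exp (of_real t * ?H j)) \<longlonglongrightarrow> c * exp (of_real t * levy_exponent \<nu> w)"
    by (intro tendsto_intros)
  then show ?thesis
    using lim1 unfolding eq by (intro LIMSEQ_unique)
qed

text \<open>The real part integrates \<open>cos (w * y) - 1\<close>. This sign later keeps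
  \<open>exp (of_real h * symbol w x)\<close> in the unit disc.\<close>

lemma Re_levy_exponent_le_0:
  assumes "set_integrable \<nu> {y. 1 < \<bar>y\<bar>} (\<lambda>y. y)"
  shows "Re (levy_exponent \<nu> w) \<le> 0"
proof -
  let ?h = "\<lambda>y. iexp (w * y) - 1 - \<i> * of_real (w * y)"
  obtain G where G: "integrable \<nu> G" "\<And>y. norm (?h y) \<le> G y"
    using levy_integrand_integrable[OF assms, of w] by auto
  have "integrable \<nu> ?h"
    by (rule Bochner_Integration.integrable_bound[OF G(1)])
      (measurable, use G(2) in \<open>intro AE_I2, metis abs_ge_self order_trans real_norm_def\<close>)
  then have "Re (levy_exponent \<nu> w) = (\<integral>y. Re (?h y) \<partial>\<nu>)"
    unfolding levy_exponent_def by (rule integral_Re[symmetric])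
  also have "\<dots> = - (\<integral>y. 1 - cos (w * y) \<partial>\<nu>)"
    by (subst Bochner_Integration.integral_minus[symmetric])
      (intro Bochner_Integration.integral_cong refl, simp add: Re_exp)
  also have "\<dots> \<le> 0" by (simp add: integral_nonneg_AE)
  finally show ?thesis .
qed

lemma measurable_simple_integral:
  assumes K: "simple_process M F m \<tau> K" and t: "0 \<le> t"
  shows "simple_integral W m \<tau> K t \<in> borel_measurable M"
    and "simple_variation m \<tau> K t \<in> borel_measurable M"
proof -
  note tau0 = simple_process_mono(1)[OF K order_refl]
  have Km: "K i \<in> borel_measurable M" if "i < m" for i
    using K that by (auto simp: simple_process_def intro: measurable_F)
  show "simple_integral W m \<tau> K t \<in> borel_measurable M"
    unfolding simple_integral_def[abs_def]
    using t tau0 by (intro borel_measurable_sum borel_measurable_times borel_measurable_diff Km measurable_W') auto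
  show "simple_variation m \<tau> K t \<in> borel_measurable M"
    unfolding simple_variation_def[abs_def]
    by (intro borel_measurable_sum borel_measurable_times borel_measurable_power Km) auto
qed

text \<open>The bound \<open>R\<close> on the variation makes the exponential weight bounded, so
  that weight, Wiener exponential and \<open>V\<close> together can act as the factor
  \<open>Z\<close> of \<open>compensated_char\<close>.\<close>

lemma exponential_identity:
  fixes V :: "'w \<Rightarrow> complex"
  assumes K: "simple_process M F m \<tau> K" and t: "0 \<le> t"
    and var: "\<And>\<omega>. \<omega> \<in> space M \<Longrightarrow> simple_variation m \<tau> K t \<omega> \<le> R"
    and V: "V \<in> borel_measurable (F 0)" "\<And>\<omega>. \<omega> \<in> space M \<Longrightarrow> norm (V \<omega>) \<le> B"
    and comp: "has_compensated_integral M N \<nu> t Y"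
  shows "expectation (\<lambda>\<omega>. V \<omega> * (iexp (w * simple_integral W m \<tau> K t \<omega>) *
           of_real (exp (w\<^sup>2 / 2 * simple_variation m \<tau> K t \<omega>))) * iexp (w * Y \<omega>))
    = expectation V * exp (of_real t * levy_exponent \<nu> w)"
proof (rule compensated_char[OF _ _ t comp])
  let ?e = "\<lambda>\<omega>. iexp (w * simple_integral W m \<tau> K t \<omega>) *
    of_real (exp (w\<^sup>2 / 2 * simple_variation m \<tau> K t \<omega>))"
  have [measurable]: "simple_integral W m \<tau> K t \<in> borel_measurable M"
    "simple_variation m \<tau> K t \<in> borel_measurable M" "V \<in> borel_measurable M"
    using measurable_simple_integral[OF K t] measurable_F[OF V(1)] by auto
  show "(\<lambda>\<omega>. V \<omega> * ?e \<omega>) \<in> borel_measurable M"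
    by measurable
  show "norm (V \<omega> * ?e \<omega>) \<le> B * exp (w\<^sup>2 / 2 * R)"
    if "\<omega> \<in> space M" for \<omega>
  proof -
    have "w\<^sup>2 / 2 * simple_variation m \<tau> K t \<omega> \<le> w\<^sup>2 / 2 * R"
      by (intro mult_left_mono var[OF that]) simp
    then show ?thesis
      unfolding norm_mult norm_exp_i_times norm_of_real
      by (intro mult_mono V(2)[OF that] order_trans[OF norm_ge_zero V(2)[OF that]]) auto
  qed
  show "expectation (\<lambda>\<omega>. V \<omega> * ?e \<omega> * iexp (w * jump_sum k z A 0 t \<omega>))
    = expectation V * exp (of_real t * jump_rate w k z A)"
    if "range A \<subseteq> jump_sets" "disjoint_family A" for k z A
    using simple_process_identity[OF that K t V] by (simp add: mult.assoc)
qed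

end

section \<open>Truncation and passage to the Ito integral\<close>

context levy_noise begin

text \<open>Stopping the integrand before its quadratic variation exceeds 1 keeps it a simple process, and
  makes the exponential weights bounded.\<close>
lemma truncate_simple_process:
  assumes K: "simple_process M F m \<tau> K" and t: "0 \<le> t"
  obtains K' where "simple_process M F m \<tau> K'"
    "\<And>\<omega>. simple_variation m \<tau> K' t \<omega> \<le> 1"
    "\<And>\<omega>. simple_variation m \<tau> K t \<omega> \<le> 1 \<Longrightarrow> simple_integral W m \<tau> K' t \<omega> = simple_integral W m \<tau> K t \<omega>"
    "\<And>\<omega>. simple_variation m \<tau> K t \<omega> \<le> 1 \<Longrightarrow> simple_variation m \<tau> K' t \<omega> = simple_variation m \<tau> K t \<omega>"
proof -
  define S where "S i \<omega> = simple_variation i \<tau> K t \<omega>" for i \<omega>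
  \<comment> \<open>The test uses \<open>S (Suc i)\<close>, the variation through the end of the
    coming interval. It depends only on \<open>K 0, ..., K i\<close>, hence is known at
    \<open>\<tau> i\<close>, and so the integrand stops before the excess and not after it.\<close>
  define K' where "K' i \<omega> = (if S (Suc i) \<omega> \<le> 1 then K i \<omega> else 0)" for i \<omega>
  have S_Suc: "S (Suc i) \<omega> = S i \<omega> + (K i \<omega>)\<^sup>2 * (min t (\<tau> (Suc i)) - min t (\<tau> i))" for i \<omega>
    by (simp add: S_def simple_variation_def)
  have d: "0 \<le> min t (\<tau> (Suc i)) - min t (\<tau> i)" if "i < m" for i
    using K that by (auto simp: simple_process_def min_def)
  have Sstep: "S i \<omega> \<le> S (Suc i) \<omega>" if "i < m" for i \<omega>
    unfolding S_Suc using d[OF that] by simp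
  have Smono: "S i \<omega> \<le> S j \<omega>" if "i \<le> j" "j \<le> m" for i j \<omega>
    using that
  proof (induction j rule: dec_induct)
    case (step n)
    then show ?case using Sstep[of n \<omega>] by simp
  qed simp
  have Kmeas: "K' i \<in> borel_measurable (F (\<tau> i))" if i: "i < m" for i
  proof -
    have Kj: "K j \<in> borel_measurable (F (\<tau> i))" if "j < Suc i" for j
    proof (rule measurable_F_mono[where s="\<tau> j"])
      show "K j \<in> borel_measurable (F (\<tau> j))" using K that i by (simp add: simple_process_def)
      show "\<tau> j \<le> \<tau> i" using simple_process_mono(2)[OF K, of j i] that i by simp
    qed
    have "S (Suc i) \<in> borel_measurable (F (\<tau> i))"
      unfolding S_def[abs_def] simple_variation_def[abs_def]
      by (intro borel_measurable_sum borel_measurable_times borel_measurable_power Kj) auto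
    then show ?thesis
      using Kj[of i] unfolding K'_def[abs_def] by measurable
  qed
  have 1: "simple_process M F m \<tau> K'"
    unfolding simple_process_def
  proof (intro conjI allI impI)
    fix i assume i: "i < m"
    obtain C where C: "\<forall>\<omega>\<in>space M. \<bar>K i \<omega>\<bar> \<le> C" using K i by (auto simp: simple_process_def)
    show "\<exists>C. \<forall>\<omega>\<in>space M. \<bar>K' i \<omega>\<bar> \<le> C"
      using C by (intro exI[of _ "\<bar>C\<bar>"]) (auto simp: K'_def)
  qed (use K Kmeas in \<open>auto simp: simple_process_def\<close>)
  \<comment> \<open>Both halves are proved together: either
    \<open>S (Suc n) \<omega> \<le> 1\<close>, then \<open>S n \<omega> \<le> 1\<close> by
    monotonicity and the variations agree so far, or the new weight is 0 and the old bound
    persists.\<close>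
  have 2: "simple_variation n \<tau> K' t \<omega> \<le> 1 \<and> (S n \<omega> \<le> 1 \<longrightarrow> simple_variation n \<tau> K' t \<omega> = S n \<omega>)" if "n \<le> m" for n \<omega>
    using that
  proof (induction n)
    case 0 then show ?case by (simp add: simple_variation_def S_def)
  next
    case (Suc n)
    have "simple_variation (Suc n) \<tau> K' t \<omega> = simple_variation n \<tau> K' t \<omega> + (K' n \<omega>)\<^sup>2 * (min t (\<tau> (Suc n)) - min t (\<tau> n))"
      by (simp add: simple_variation_def)
    moreover have "K' n \<omega> = (if S (Suc n) \<omega> \<le> 1 then K n \<omega> else 0)" by (simp add: K'_def)
    ultimately show ?case
      using Suc Sstep[of n \<omega>] unfolding S_Suc[of n \<omega>] by (simp split: if_splits)
  qed
  have 3: "K' i \<omega> = K i \<omega>" if "simple_variation m \<tau> K t \<omega> \<le> 1" "i < m" for i \<omega>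
    using that Smono[of "Suc i" m \<omega>] by (simp add: K'_def S_def)
  show ?thesis
  proof (rule that[of K'])
    show "simple_integral W m \<tau> K' t \<omega> = simple_integral W m \<tau> K t \<omega>" if "simple_variation m \<tau> K t \<omega> \<le> 1" for \<omega>
      using 3[OF that] by (simp add: simple_integral_def)
    show "simple_variation m \<tau> K' t \<omega> = simple_variation m \<tau> K t \<omega>" if "simple_variation m \<tau> K t \<omega> \<le> 1" for \<omega>
      using 2[of m \<omega>] that by (simp add: S_def)
  qed (use 1 2[of m] in auto)
qed

lemma nn_integral_simple_value:
  assumes K: "simple_process M F m \<tau> K" and t: "0 \<le> t"
  shows "(\<integral>\<^sup>+s\<in>{0..t}. ennreal ((simple_value m \<tau> K s \<omega>)\<^sup>2) \<partial>lborel) = ennreal (simple_variation m \<tau> K t \<omega>)"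
proof -
  \<comment> \<open>There are no cross terms: the intervals are disjoint, so at most one summand of
    the simple process is nonzero at a given time.\<close>
  have sq: "(simple_value n \<tau> K s \<omega>)\<^sup>2 = (\<Sum>i<n. (K i \<omega>)\<^sup>2 * indicator {\<tau> i<..\<tau> (Suc i)} s)" if "n \<le> m" for n s
    using that
  proof (induction n)
    case (Suc n)
    have "simple_value n \<tau> K s \<omega> = 0" if s: "s \<in> {\<tau> n<..\<tau> (Suc n)}"
      unfolding simple_value_def
    proof (rule sum.neutral, rule ballI)
      fix i assume "i \<in> {..<n}"
      then have "\<tau> (Suc i) \<le> \<tau> n" using simple_process_mono(2)[OF K, of "Suc i" n] Suc.prems by simp
      then show "K i \<omega> * indicator {\<tau> i<..\<tau> (Suc i)} s = 0" using s by (simp add: indicator_def)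
    qed
    then have "(simple_value n \<tau> K s \<omega> + K n \<omega> * indicator {\<tau> n<..\<tau> (Suc n)} s)\<^sup>2
       = (simple_value n \<tau> K s \<omega>)\<^sup>2 + (K n \<omega>)\<^sup>2 * indicator {\<tau> n<..\<tau> (Suc n)} s"
      by (cases "s \<in> {\<tau> n<..\<tau> (Suc n)}") (auto simp: indicator_def)
    moreover have "simple_value (Suc n) \<tau> K s \<omega> = simple_value n \<tau> K s \<omega> + K n \<omega> * indicator {\<tau> n<..\<tau> (Suc n)} s"
      by (simp add: simple_value_def)
    ultimately show ?case using Suc by simp
  qed (simp add: simple_value_def)
  have "(\<integral>\<^sup>+s\<in>{0..t}. ennreal ((simple_value m \<tau> K s \<omega>)\<^sup>2) \<partial>lborel)
     = (\<integral>\<^sup>+s. (\<Sum>i<m. ennreal ((K i \<omega>)\<^sup>2) * indicator ({\<tau> i<..\<tau> (Suc i)} \<inter> {0..t}) s) \<partial>lborel)"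
    unfolding sq[OF order_refl]
    by (intro nn_integral_cong)
      (auto simp: sum_distrib_right sum_nonneg sum_ennreal[symmetric] ennreal_mult indicator_def intro!: sum.cong simp del: sum_ennreal)
  also have "\<dots> = (\<Sum>i<m. ennreal ((K i \<omega>)\<^sup>2) * emeasure lborel ({\<tau> i<..\<tau> (Suc i)} \<inter> {0..t}))"
    by (subst nn_integral_sum) (auto simp: nn_integral_cmult_indicator)
  also have "\<dots> = (\<Sum>i<m. ennreal ((K i \<omega>)\<^sup>2 * (min t (\<tau> (Suc i)) - min t (\<tau> i))))"
  proof (rule sum.cong[OF refl])
    fix i assume "i \<in> {..<m}"
    then have i: "0 \<le> \<tau> i" "\<tau> i \<le> \<tau> (Suc i)" "i < m"
      using simple_process_mono[OF K, of i "Suc i"] by auto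
    have "{\<tau> i<..\<tau> (Suc i)} \<inter> {0..t} = {min t (\<tau> i)<..min t (\<tau> (Suc i))}"
      using i by auto
    then show "ennreal ((K i \<omega>)\<^sup>2) * emeasure lborel ({\<tau> i<..\<tau> (Suc i)} \<inter> {0..t})
        = ennreal ((K i \<omega>)\<^sup>2 * (min t (\<tau> (Suc i)) - min t (\<tau> i)))"
      using i by (simp add: ennreal_mult min_def)
  qed
  also have "\<dots> = ennreal (simple_variation m \<tau> K t \<omega>)"
  proof -
    have "0 \<le> (K i \<omega>)\<^sup>2 * (min t (\<tau> (Suc i)) - min t (\<tau> i))" if "i < m" for i
      using K that by (auto simp: simple_process_def min_def)
    then show ?thesis unfolding simple_variation_def by (subst sum_ennreal) auto
  qed
  finally show ?thesis .
qed

end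

text \<open>Young's inequality for the cross term 2h(k - h). The free parameter \<open>e\<close>
  will be taken small against the typical size of the integral of h^2, so that no uniform bound on h
  is called for.\<close>

lemma abs_square_diff_le:
  fixes k h e :: real
  assumes "0 < e"
  shows "\<bar>k\<^sup>2 - h\<^sup>2\<bar> \<le> (1 + 1 / e) * (k - h)\<^sup>2 + e * h\<^sup>2"
proof -
  have "0 \<le> (sqrt e * h - (k - h) / sqrt e)\<^sup>2" "0 \<le> (sqrt e * h + (k - h) / sqrt e)\<^sup>2" by simp_all
  then have "\<bar>2 * h * (k - h)\<bar> \<le> e * h\<^sup>2 + (k - h)\<^sup>2 / e"
    using assms by (auto simp: power2_sum power2_diff power_mult_distrib power_divide abs_le_iff)
  moreover have "k\<^sup>2 - h\<^sup>2 = (k - h)\<^sup>2 + 2 * h * (k - h)"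
    by (simp add: power2_eq_square algebra_simps)
  moreover have "(1 + 1 / e) * (k - h)\<^sup>2 = (k - h)\<^sup>2 + (k - h)\<^sup>2 / e" by (simp add: distrib_right)
  ultimately show ?thesis using zero_le_power2[of "k - h"] by linarith
qed

lemma nn_integral_square_diff:
  fixes k h :: "'a \<Rightarrow> real"
  assumes [measurable]: "k \<in> borel_measurable \<mu>" "h \<in> borel_measurable \<mu>"
    and k: "(\<integral>\<^sup>+s. ennreal ((k s)\<^sup>2) \<partial>\<mu>) = ennreal v" "0 \<le> v"
    and h: "(\<integral>\<^sup>+s. ennreal ((h s)\<^sup>2) \<partial>\<mu>) = ennreal q" "0 \<le> q"
    and d: "(\<integral>\<^sup>+s. ennreal ((k s - h s)\<^sup>2) \<partial>\<mu>) \<le> ennreal d" "0 \<le> d" and e: "0 < e"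
  shows "\<bar>v - q\<bar> \<le> (1 + 1 / e) * d + e * q"
proof -
  let ?c = "1 + 1 / e"
  let ?r = "\<lambda>s. ?c * (k s - h s)\<^sup>2 + e * (h s)\<^sup>2"
  have c: "0 \<le> ?c" using e by simp
  have R: "(\<integral>\<^sup>+s. ennreal (?r s) \<partial>\<mu>) \<le> ennreal (?c * d + e * q)"
  proof -
    have "(\<integral>\<^sup>+s. ennreal (?r s) \<partial>\<mu>)
       = (\<integral>\<^sup>+s. ennreal ?c * ennreal ((k s - h s)\<^sup>2) + ennreal e * ennreal ((h s)\<^sup>2) \<partial>\<mu>)"
      using e c by (intro nn_integral_cong) (simp add: ennreal_mult[symmetric] ennreal_plus[symmetric] del: ennreal_plus)
    also have "\<dots> = ennreal ?c * (\<integral>\<^sup>+s. ennreal ((k s - h s)\<^sup>2) \<partial>\<mu>) + ennreal e * (\<integral>\<^sup>+s. ennreal ((h s)\<^sup>2) \<partial>\<mu>)"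
      by (subst nn_integral_add) (auto simp: nn_integral_cmult)
    also have "\<dots> \<le> ennreal ?c * ennreal d + ennreal e * ennreal q"
      unfolding h using d by (intro add_mono mult_left_mono) auto
    also have "\<dots> = ennreal (?c * d + e * q)"
      using c e d h(2) by (simp add: ennreal_mult[symmetric] ennreal_plus[symmetric] del: ennreal_plus)
    finally show ?thesis .
  qed
  \<comment> \<open>Formulated for arbitrary \<open>a\<close> and \<open>b\<close> so that
    exchanging the roles of \<open>k\<close> and \<open>h\<close> yields both signs of
    \<open>v - q\<close>.\<close>
  have main: "x \<le> y + (?c * d + e * q)"
    if xy: "(\<integral>\<^sup>+s. ennreal ((a s)\<^sup>2) \<partial>\<mu>) = ennreal x" "(\<integral>\<^sup>+s. ennreal ((b s)\<^sup>2) \<partial>\<mu>) = ennreal y" "0 \<le> y"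
      and le: "\<And>s. (a s)\<^sup>2 \<le> (b s)\<^sup>2 + (?r s)"
      and [measurable]: "a \<in> borel_measurable \<mu>" "b \<in> borel_measurable \<mu>"
    for a b :: "'a \<Rightarrow> real" and x y
  proof -
    have "ennreal x \<le> (\<integral>\<^sup>+s. ennreal ((b s)\<^sup>2) + ennreal (?r s) \<partial>\<mu>)"
      unfolding xy(1)[symmetric] using c e le
      by (intro nn_integral_mono) (simp add: ennreal_plus[symmetric] ennreal_leI del: ennreal_plus)
    also have "\<dots> = ennreal y + (\<integral>\<^sup>+s. ennreal (?r s) \<partial>\<mu>)"
      by (subst nn_integral_add) (auto simp: xy)
    also have "\<dots> \<le> ennreal y + ennreal (?c * d + e * q)"
      by (intro add_left_mono R)
    also have "\<dots> = ennreal (y + (?c * d + e * q))"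
      using c e d h(2) xy(3) by (simp add: ennreal_plus[symmetric] del: ennreal_plus)
    finally have "ennreal x \<le> ennreal (y + (?c * d + e * q))" .
    moreover have "0 \<le> y + (?c * d + e * q)"
      using c e d h(2) xy(3) by (intro add_nonneg_nonneg mult_nonneg_nonneg) auto
    ultimately show ?thesis by (simp only: ennreal_le_iff)
  qed
  have "v \<le> q + (?c * d + e * q)"
    by (rule main[OF k(1) h]) (use abs_square_diff_le[OF e] in \<open>auto simp: abs_le_iff algebra_simps\<close>)
  moreover have "q \<le> v + (?c * d + e * q)"
    by (rule main[OF h(1) k]) (use abs_square_diff_le[OF e] in \<open>auto simp: abs_le_iff algebra_simps\<close>)
  ultimately show ?thesis by linarith
qed

section \<open>Quadratic variation of the Ito integrand\<close>

context levy_noise begin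

text \<open>Progressive measurability at time \<open>t\<close>, with \<open>F t\<close> enlarged to
  \<open>M\<close> and the coordinates swapped, so that integrating over time leaves a random
  variable.\<close>

lemma measurable_ito_integrand:
  assumes ito: "has_ito_integral M F W H t I" and t: "0 \<le> t"
  shows "(\<lambda>(\<omega>, s). H s \<omega>) \<in> borel_measurable (M \<Otimes>\<^sub>M restrict_space lborel {0..t})"
proof -
  let ?B = "restrict_space borel {0..t}" and ?L = "restrict_space lborel {0..t}"
  have H: "(\<lambda>(s, \<omega>). H s \<omega>) \<in> borel_measurable (?B \<Otimes>\<^sub>M F t)"
    using ito t by (simp add: has_ito_integral_def)
  have sets_eq: "sets (?B) = sets (?L)"
    by (simp add: sets_restrict_space)
  have "subalgebra (?L \<Otimes>\<^sub>M M) (?B \<Otimes>\<^sub>M F t)"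
  proof -
    have id: "(\<lambda>x. x) \<in> M \<rightarrow>\<^sub>M F t"
      by (rule measurable_F[of _ t]) (rule measurable_ident_sets[OF refl])
    have "(\<lambda>x. (fst x, snd x)) \<in> ?L \<Otimes>\<^sub>M M \<rightarrow>\<^sub>M ?B \<Otimes>\<^sub>M F t"
    proof (rule measurable_Pair)
      show "fst \<in> ?L \<Otimes>\<^sub>M M \<rightarrow>\<^sub>M ?B"
        by (subst measurable_cong_sets[OF refl sets_eq]) (rule measurable_fst)
      show "snd \<in> ?L \<Otimes>\<^sub>M M \<rightarrow>\<^sub>M F t"
        by (rule measurable_compose[OF measurable_snd id])
    qed
    then have m: "(\<lambda>x. x) \<in> ?L \<Otimes>\<^sub>M M \<rightarrow>\<^sub>M ?B \<Otimes>\<^sub>M F t"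
      by simp
    show ?thesis
      unfolding subalgebra_def
    proof
      show sp: "space (?B \<Otimes>\<^sub>M F t) = space (?L \<Otimes>\<^sub>M M)"
        by (simp add: space_pair_measure space_restrict_space space_F)
      show "sets (?B \<Otimes>\<^sub>M F t) \<subseteq> sets (?L \<Otimes>\<^sub>M M)"
      proof
        fix A assume A: "A \<in> sets (?B \<Otimes>\<^sub>M F t)"
        have "(\<lambda>x. x) -` A \<inter> space (?L \<Otimes>\<^sub>M M) = A"
          using sets.sets_into_space[OF A] sp by auto
        then show "A \<in> sets (?L \<Otimes>\<^sub>M M)"
          using measurable_sets[OF m A] by simp
      qed
    qed
  qed
  from measurable_from_subalg[OF this H] have "(\<lambda>(s, \<omega>). H s \<omega>) \<in> borel_measurable (?L \<Otimes>\<^sub>M M)"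
    .
  from measurable_pair_swap[OF this] show ?thesis
    by (simp add: split_beta')
qed

text \<open>The definition of the Ito integral controls the integral of
  \<open>(K p - H)\<^sup>2\<close>; what is wanted is the difference of the integrals of the
  squares. \<open>nn_integral_square_diff\<close> bridges the two wherever \<open>Q\<close> is not
  too large, and integrability makes a large \<open>Q\<close> improbable.\<close>

lemma variation_tendsto_in_prob:
  assumes ito: "has_ito_integral M F W H t I" and t: "0 \<le> t"
    and Q: "integrable M Q" "\<And>\<omega>. \<omega> \<in> space M \<Longrightarrow> 0 \<le> Q \<omega>"
      "AE \<omega> in M. (\<integral>\<^sup>+s\<in>{0..t}. ennreal ((H s \<omega>)\<^sup>2) \<partial>lborel) = ennreal (Q \<omega>)"
  obtains m \<tau> K where "\<And>p. simple_process M F (m p) (\<tau> p) (K p)"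
    "tendsto_in_prob M (\<lambda>p. simple_integral W (m p) (\<tau> p) (K p) t) I sequentially"
    "tendsto_in_prob M (\<lambda>p. simple_variation (m p) (\<tau> p) (K p) t) Q sequentially"
proof -
  let ?\<mu> = "restrict_space lborel {0..t}"
  interpret mu: sigma_finite_measure ?\<mu>
    by (rule sigma_finite_measure_restrict_space) (auto intro: lborel.sigma_finite_measure_axioms)
  have int: "(\<integral>\<^sup>+s\<in>{0..t}. f s \<partial>lborel) = (\<integral>\<^sup>+s. f s \<partial>?\<mu>)" for f
    by (simp add: nn_integral_restrict_space)
  obtain m \<tau> K where K: "\<And>p. simple_process M F (m p) (\<tau> p) (K p)"
    and D0: "\<And>\<delta>. 0 < \<delta> \<Longrightarrow> (\<lambda>p. measure M {\<omega> \<in> space M. ennreal \<delta> <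
            (\<integral>\<^sup>+s\<in>{0..t}. ennreal ((simple_value (m p) (\<tau> p) (K p) s \<omega> - H s \<omega>)\<^sup>2) \<partial>lborel)}) \<longlonglongrightarrow> 0"
    and I: "tendsto_in_prob M (\<lambda>p. simple_integral W (m p) (\<tau> p) (K p) t) I sequentially"
    using ito unfolding has_ito_integral_def by blast
  let ?V = "\<lambda>p. simple_variation (m p) (\<tau> p) (K p) t"
  let ?k = "\<lambda>p \<omega> s. simple_value (m p) (\<tau> p) (K p) s \<omega>"
  define D where "D p \<omega> = (\<integral>\<^sup>+s. ennreal ((?k p \<omega> s - H s \<omega>)\<^sup>2) \<partial>?\<mu>)" for p \<omega>
  have H[measurable]: "(\<lambda>x. H (snd x) (fst x)) \<in> borel_measurable (M \<Otimes>\<^sub>M ?\<mu>)"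
    using measurable_ito_integrand[OF ito t] by (simp add: split_beta')
  have Km[measurable]: "K p i \<in> borel_measurable M" if "i < m p" for p i
    using K[of p] that by (auto simp: simple_process_def intro: measurable_F)
  have idm[measurable]: "(\<lambda>s. s) \<in> borel_measurable ?\<mu>"
    by (rule measurable_restrict_space1) simp
  have kM[measurable]: "(\<lambda>x. ?k p (fst x) (snd x)) \<in> borel_measurable (M \<Otimes>\<^sub>M ?\<mu>)" for p
  proof -
    have "(\<lambda>x. K p i (fst x)) \<in> borel_measurable (M \<Otimes>\<^sub>M ?\<mu>)" if "i < m p" for i
      using measurable_compose[OF measurable_fst Km[OF that]] .
    moreover have "(\<lambda>x. indicator {\<tau> p i<..\<tau> p (Suc i)} (snd x) :: real) \<in> borel_measurable (M \<Otimes>\<^sub>M ?\<mu>)" for i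
    proof -
      have "(\<lambda>x. snd x) \<in> borel_measurable (M \<Otimes>\<^sub>M ?\<mu>)"
        using measurable_compose[OF measurable_snd idm] .
      then show ?thesis by measurable
    qed
    ultimately show ?thesis
      unfolding simple_value_def by (intro borel_measurable_sum borel_measurable_times) auto
  qed
  have Dm[measurable]: "D p \<in> borel_measurable M" for p
    unfolding D_def by measurable
  have Vm[measurable]: "?V p \<in> borel_measurable M" for p
    by (rule measurable_simple_integral(2)[OF K t])
  have Qm[measurable]: "Q \<in> borel_measurable M" using Q(1) by auto
  have V0: "0 \<le> ?V p \<omega>" for p \<omega>
    using K[of p] unfolding simple_variation_def
    by (intro sum_nonneg mult_nonneg_nonneg) (auto simp: simple_process_def min_def)
  have key: "\<bar>?V p \<omega> - Q \<omega>\<bar> \<le> (1 + 1 / e) * d + e * Q \<omega>"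
    if w: "\<omega> \<in> space M" and q: "(\<integral>\<^sup>+s\<in>{0..t}. ennreal ((H s \<omega>)\<^sup>2) \<partial>lborel) = ennreal (Q \<omega>)"
      and "D p \<omega> \<le> ennreal d" "0 \<le> d" "0 < e" for p \<omega> e d
  proof (rule nn_integral_square_diff[where \<mu>="?\<mu>" and k="?k p \<omega>" and h="\<lambda>s. H s \<omega>"])
    show "?k p \<omega> \<in> borel_measurable ?\<mu>"
      using measurable_Pair2[OF kM w] by simp
    show "(\<lambda>s. H s \<omega>) \<in> borel_measurable ?\<mu>"
      using measurable_Pair2[OF H w] by simp
    show "(\<integral>\<^sup>+s. ennreal ((?k p \<omega> s)\<^sup>2) \<partial>?\<mu>) = ennreal (?V p \<omega>)"
      using nn_integral_simple_value[OF K t, of p \<omega>] by (simp only: int)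
    show "(\<integral>\<^sup>+s. ennreal ((H s \<omega>)\<^sup>2) \<partial>?\<mu>) = ennreal (Q \<omega>)"
      using q by (simp only: int)
    show "(\<integral>\<^sup>+s. ennreal ((?k p \<omega> s - H s \<omega>)\<^sup>2) \<partial>?\<mu>) \<le> ennreal d"
      using that by (simp add: D_def)
  qed (use V0 Q(2)[OF w] that in auto)
  have EQ0: "0 \<le> expectation Q" using Q by (intro integral_nonneg_AE) auto
  have "tendsto_in_prob M ?V Q sequentially"
    unfolding tendsto_in_prob_def
  proof (intro allI impI LIMSEQ_I)
    fix \<delta> r :: real assume \<delta>: "0 < \<delta>" and r: "0 < r"
    \<comment> \<open>Chosen such that Markov's inequality gives probability at most
      \<open>r / 2\<close> to \<open>Q > \<delta> / (2 * e)\<close>; off this event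
      \<open>e * Q\<close> is at most \<open>\<delta> / 2\<close>. The number \<open>d\<close> below
      uses up the other half through \<open>(1 + 1 / e) * d = \<delta> / 2\<close>. The summand 1
      avoids a zero denominator.\<close>
    define e where "e = \<delta> * r / (4 * (expectation Q + 1))"
    have e: "0 < e" using \<delta> r EQ0 by (simp add: e_def)
    define d where "d = \<delta> / (2 * (1 + 1 / e))"
    have d: "0 < d" using \<delta> e by (simp add: d_def add_pos_pos)
    let ?U = "\<lambda>p. {\<omega> \<in> space M. \<delta> < \<bar>?V p \<omega> - Q \<omega>\<bar>}" and ?E = "\<lambda>p. {\<omega> \<in> space M. ennreal d < D p \<omega>}"
      and ?Q = "{\<omega> \<in> space M. \<delta> / (2 * e) < Q \<omega>}"
    have d2: "(1 + 1 / e) * d = \<delta> / 2"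
    proof -
      have cancel: "x * (\<delta> / (2 * x)) = \<delta> / 2" if "0 < x" for x using that by simp
      show ?thesis unfolding d_def by (rule cancel) (use e in \<open>simp add: add_pos_pos\<close>)
    qed
    have P1: "prob ?Q \<le> r / 2"
    proof -
      have "prob ?Q \<le> prob {\<omega> \<in> space M. \<delta> / (2 * e) \<le> Q \<omega>}"
        by (rule finite_measure_mono) auto
      also have "\<dots> \<le> expectation Q / (\<delta> / (2 * e))"
        using \<delta> e Q by (intro integral_Markov_inequality_measure[where A="{}"]) auto
      also have "\<dots> = expectation Q / (expectation Q + 1) * (r / 2)"
      proof -
        have cancel: "y / (\<delta> / (2 * (\<delta> * r / (4 * X)))) = y / X * (r / 2)" if "0 < X" for y X
          using \<delta> r that by (simp add: field_simps)
        show ?thesis unfolding e_def by (rule cancel) (use EQ0 in simp)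
      qed
      also have "\<dots> \<le> 1 * (r / 2)"
        using r EQ0 by (intro mult_right_mono) (auto simp: divide_le_eq_1)
      finally show ?thesis by simp
    qed
    have le: "prob (?U p)
        \<le> prob (?E p) + r / 2" for p
    proof -
      have "prob (?U p)
          \<le> prob ((?E p) \<union> ?Q)"
      proof (rule finite_measure_mono_AE)
        show "AE \<omega> in M. \<omega> \<in> (?U p) \<longrightarrow>
            \<omega> \<in> (?E p) \<union> ?Q"
          using Q(3)
        proof eventually_elim
          case (elim \<omega>)
          show ?case
          proof (rule impI, rule ccontr)
            assume a: "\<omega> \<in> (?U p)"
              and "\<omega> \<notin> (?E p) \<union> ?Q"
            then have w: "\<omega> \<in> space M" "D p \<omega> \<le> ennreal d" "Q \<omega> \<le> \<delta> / (2 * e)" by auto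
            have "\<bar>?V p \<omega> - Q \<omega>\<bar> \<le> \<delta> / 2 + e * Q \<omega>"
              using key[OF w(1) elim w(2) less_imp_le[OF d] e] unfolding d2 .
            also have "\<dots> \<le> \<delta> / 2 + e * (\<delta> / (2 * e))"
              using w(3) e by (intro add_left_mono mult_left_mono) auto
            also have "\<dots> = \<delta>" using e by simp
            finally show False using a by simp
          qed
        qed
      qed measurable
      also have "\<dots> \<le> prob (?E p) + prob ?Q"
        by (rule measure_Un_le) measurable
      finally show ?thesis using P1 by simp
    qed
    have "(\<lambda>p. prob (?E p)) \<longlonglongrightarrow> 0"
      using D0[OF d] unfolding D_def int .
    from LIMSEQ_D[OF this, of "r / 2"] r obtain n0 where
      n0: "\<And>p. n0 \<le> p \<Longrightarrow> prob (?E p) < r / 2" by auto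
    show "\<exists>n0. \<forall>p\<ge>n0. norm (prob (?U p) - 0) < r"
    proof (intro exI allI impI)
      fix p assume "n0 \<le> p"
      from n0[OF this] le[of p] show "norm (prob (?U p) - 0) < r" by simp
    qed
  qed
  then show ?thesis using that K I by blast
qed

end

section \<open>Exponential estimate for the Ito integral\<close>

lemma abs_exp_diff_le:
  fixes x c :: real
  assumes "x \<le> c" "0 \<le> c"
  shows "\<bar>1 - exp x\<bar> \<le> exp c * \<bar>x\<bar>"
proof (cases "0 \<le> x")
  case True
  have "exp x - 1 = exp x * (1 - exp (- x))" by (simp add: right_diff_distrib exp_minus)
  also have "\<dots> \<le> exp c * x"
    using True assms exp_ge_add_one_self[of "- x"] by (intro mult_mono) auto
  finally show ?thesis using True by simp
next
  case False
  have "1 - exp x \<le> - x" using exp_ge_add_one_self[of x] by linarith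
  also have "\<dots> \<le> exp c * \<bar>x\<bar>" using False assms by (simp add: mult_le_cancel_right1)
  finally show ?thesis using False by simp
qed

lemma (in prob_space) expectation_if:
  assumes "{\<omega> \<in> space M. P \<omega>} \<in> events"
  shows "expectation (\<lambda>\<omega>. if P \<omega> then 1 else 0 :: real) = prob {\<omega> \<in> space M. P \<omega>}"
proof -
  have "expectation (\<lambda>\<omega>. if P \<omega> then 1 else 0 :: real)
      = expectation (indicator {\<omega> \<in> space M. P \<omega>})"
    by (intro Bochner_Integration.integral_cong) (auto simp: indicator_def)
  then show ?thesis using assms by simp
qed

text \<open>The variation \<open>Q\<close> of the integrand is compared with a quantity
  \<open>q\<close> known at time 0. Thus exp(-cq) can be joined to \<open>V\<close>, where it nearly
  cancels the weight exp(cQ). The multiple of the mean of |Q - q| pays for inexact cancellation and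
  for part of the truncation; the probability pays for the rest of the truncation.\<close>

lemma (in levy_noise) ito_exponential_estimate:
  fixes V :: "'w \<Rightarrow> complex"
  assumes ito: "has_ito_integral M F W H t I" and t: "0 \<le> t"
    and comp: "has_compensated_integral M N \<nu> t Y"
    and Q: "integrable M Q" "\<And>\<omega>. \<omega> \<in> space M \<Longrightarrow> 0 \<le> Q \<omega>"
      "AE \<omega> in M. (\<integral>\<^sup>+s\<in>{0..t}. ennreal ((H s \<omega>)\<^sup>2) \<partial>lborel) = ennreal (Q \<omega>)"
    and q: "q \<in> borel_measurable (F 0)" "integrable M q" "\<And>\<omega>. \<omega> \<in> space M \<Longrightarrow> 0 \<le> q \<omega>"
    and V: "V \<in> borel_measurable (F 0)" "\<And>\<omega>. \<omega> \<in> space M \<Longrightarrow> norm (V \<omega>) \<le> 1"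
    and c: "c = w\<^sup>2 / 2"
  shows "norm (expectation (\<lambda>\<omega>. V \<omega> * iexp (w * I \<omega>) * iexp (w * Y \<omega>))
      - expectation (\<lambda>\<omega>. V \<omega> * of_real (exp (- (c * q \<omega>)))) * exp (of_real t * levy_exponent \<nu> w))
    \<le> (c * exp c + 4 * (3 + exp c)) * expectation (\<lambda>\<omega>. \<bar>Q \<omega> - q \<omega>\<bar>)
      + (3 + exp c) * prob {\<omega> \<in> space M. 1 / 4 < q \<omega>}" (is "norm (?L - ?R) \<le> ?B")
proof -
  obtain m \<tau> K where K: "\<And>p. simple_process M F (m p) (\<tau> p) (K p)"
    and Ilim: "tendsto_in_prob M (\<lambda>p. simple_integral W (m p) (\<tau> p) (K p) t) I sequentially"
    and Vlim: "tendsto_in_prob M (\<lambda>p. simple_variation (m p) (\<tau> p) (K p) t) Q sequentially"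
    using variation_tendsto_in_prob[OF ito t Q] by blast
  let ?v = "\<lambda>p. simple_variation (m p) (\<tau> p) (K p) t"
  let ?i = "\<lambda>p. simple_integral W (m p) (\<tau> p) (K p) t"
  have "\<exists>K'. simple_process M F (m p) (\<tau> p) K' \<and>
      (\<forall>\<omega>. simple_variation (m p) (\<tau> p) K' t \<omega> \<le> 1) \<and>
      (\<forall>\<omega>. ?v p \<omega> \<le> 1 \<longrightarrow> simple_integral W (m p) (\<tau> p) K' t \<omega> = ?i p \<omega> \<and>
         simple_variation (m p) (\<tau> p) K' t \<omega> = ?v p \<omega>)" for p
    by (rule truncate_simple_process[OF K[of p] t]) blast
  then obtain K' where K': "\<And>p. simple_process M F (m p) (\<tau> p) (K' p)"
    and K'1: "\<And>p \<omega>. simple_variation (m p) (\<tau> p) (K' p) t \<omega> \<le> 1"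
    and K'2: "\<And>p \<omega>. ?v p \<omega> \<le> 1 \<Longrightarrow> simple_integral W (m p) (\<tau> p) (K' p) t \<omega> = ?i p \<omega>"
      "\<And>p \<omega>. ?v p \<omega> \<le> 1 \<Longrightarrow> simple_variation (m p) (\<tau> p) (K' p) t \<omega> = ?v p \<omega>"
    by metis
  let ?v' = "\<lambda>p. simple_variation (m p) (\<tau> p) (K' p) t"
  let ?i' = "\<lambda>p. simple_integral W (m p) (\<tau> p) (K' p) t"
  have [measurable]: "?v p \<in> borel_measurable M" "?i p \<in> borel_measurable M"
      "?v' p \<in> borel_measurable M" "?i' p \<in> borel_measurable M" for p
    using measurable_simple_integral[OF K t] measurable_simple_integral[OF K' t] by auto
  have [measurable]: "I \<in> borel_measurable M" "Y \<in> borel_measurable M" "Q \<in> borel_measurable M"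
      "q \<in> borel_measurable M" "V \<in> borel_measurable M"
    using ito comp Q q measurable_F[OF V(1)] by (auto simp: has_ito_integral_def has_compensated_integral_def)
  have c0: "0 \<le> c" by (simp add: c)
  let ?T = "\<lambda>\<omega>. V \<omega> * iexp (w * I \<omega>) * iexp (w * Y \<omega>)"
  \<comment> \<open>The error is split into \<open>D1\<close>, \<open>D2\<close>, \<open>D3\<close>,
    whose means vanish with \<open>p\<close>, and \<open>E\<close>, which does not depend on
    \<open>p\<close> and has mean \<open>?B\<close>. The minimum in \<open>D2\<close> keeps it
    bounded, so that convergence in probability suffices for its mean.\<close>
  define D1 where "D1 p \<omega> = norm (iexp (w * ?i p \<omega>) - iexp (w * I \<omega>))" for p \<omega>
  define D2 where "D2 p \<omega> = min (1 + exp c) (c * exp c * \<bar>?v p \<omega> - Q \<omega>\<bar>)" for p \<omega>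
  define D3 where "D3 p \<omega> = (if 1 / 2 < \<bar>?v p \<omega> - Q \<omega>\<bar> then 1 else 0 :: real)" for p \<omega>
  define E where "E \<omega> = (c * exp c + 4 * (3 + exp c)) * \<bar>Q \<omega> - q \<omega>\<bar> + (3 + exp c) * (if 1 / 4 < q \<omega> then 1 else 0)" for \<omega>
  define A where "A p \<omega> = V \<omega> * of_real (exp (- (c * q \<omega>))) * (iexp (w * ?i' p \<omega>) * of_real (exp (c * ?v' p \<omega>))) * iexp (w * Y \<omega>)" for p \<omega>
  have [measurable]: "D1 p \<in> borel_measurable M" "D2 p \<in> borel_measurable M" "D3 p \<in> borel_measurable M"
    "E \<in> borel_measurable M" "A p \<in> borel_measurable M" for p
    unfolding D1_def D2_def D3_def E_def A_def by measurable
  have D1b: "0 \<le> D1 p \<omega>" "D1 p \<omega> \<le> 2" for p \<omega>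
    using norm_triangle_ineq4[of "iexp (w * ?i p \<omega>)" "iexp (w * I \<omega>)"]
    unfolding D1_def norm_exp_i_times by auto
  have D2b: "0 \<le> D2 p \<omega>" "D2 p \<omega> \<le> 1 + exp c" for p \<omega>
    using c0 by (auto simp: D2_def add_nonneg_nonneg)
  have D3b: "0 \<le> D3 p \<omega>" "D3 p \<omega> \<le> 1" for p \<omega>
    by (auto simp: D3_def)
  have i1: "integrable M (D1 p)" for p using D1b by (intro integrable_const_bound[where B=2]) auto
  have i2: "integrable M (D2 p)" for p using D2b by (intro integrable_const_bound[where B="1 + exp c"]) auto
  have i3: "integrable M (D3 p)" for p using D3b by (intro integrable_const_bound[where B=1]) auto
  have iI: "integrable M (\<lambda>\<omega>. (if 1 / 4 < q \<omega> then 1 else 0) :: real)"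
    by (intro integrable_const_bound[where B=1]) auto
  have iQ: "integrable M (\<lambda>\<omega>. \<bar>Q \<omega> - q \<omega>\<bar>)" using Q q by auto
  have iE: "integrable M E"
    unfolding E_def using iI iQ by (intro Bochner_Integration.integrable_add integrable_mult_right)
  have eE: "expectation E = ?B"
  proof -
    have "expectation (\<lambda>\<omega>. (if 1 / 4 < q \<omega> then 1 else 0) :: real) = prob {\<omega> \<in> space M. 1 / 4 < q \<omega>}"
      by (rule expectation_if) measurable
    then show ?thesis
      unfolding E_def using iI iQ by (subst Bochner_Integration.integral_add) auto
  qed
  \<comment> \<open>The product of \<open>V\<close> and \<open>exp (- (c * q \<omega>))\<close> is
    known at time 0 and still bounded by 1, so it takes the place of \<open>V\<close> in
    \<open>exponential_identity\<close>; the truncation supplies the variation bound 1.\<close>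
  have eA: "expectation (A p) = ?R" for p
    unfolding A_def c
    by (rule exponential_identity[OF K' t K'1 _ _ comp, where B=1])
      (use q V measurable_F in \<open>auto simp: norm_mult intro!: mult_le_one\<close>)
  have iA: "integrable M (A p)" for p
  proof (rule integrable_const_bound[where B="exp c"])
    show "AE \<omega> in M. norm (A p \<omega>) \<le> exp c"
    proof (rule AE_I2)
      fix \<omega> assume w: "\<omega> \<in> space M"
      have "exp (- (c * q \<omega>)) \<le> 1" using c0 q(3)[OF w] by simp
      moreover have "exp (c * ?v' p \<omega>) \<le> exp c"
        using mult_left_mono[OF K'1[of p \<omega>] c0] by simp
      ultimately have "(norm (V \<omega>) * exp (- (c * q \<omega>))) * exp (c * ?v' p \<omega>) \<le> (1 * 1) * exp c"
        by (intro mult_mono V(2)[OF w]) auto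
      then show "norm (A p \<omega>) \<le> exp c"
        unfolding A_def norm_mult norm_exp_i_times norm_of_real by simp
    qed
  qed measurable
  have iL: "integrable M (\<lambda>\<omega>. ?T \<omega>)"
    by (rule integrable_const_bound[where B=1], rule AE_I2)
      (unfold norm_mult norm_exp_i_times, simp_all add: V(2))
  have point: "norm (?T \<omega> - A p \<omega>)
      \<le> D1 p \<omega> + D2 p \<omega> + (3 + exp c) * D3 p \<omega> + E \<omega>" if w: "\<omega> \<in> space M" for p \<omega>
  proof -
    \<comment> \<open>What is left of the exponent after the truncated variation has been set off
      against \<open>q\<close>; it stays below \<open>c\<close> because that variation is at most
      1.\<close>
    define x where "x = c * (?v' p \<omega> - q \<omega>)"
    have x: "x \<le> c"
      using mult_left_mono[OF _ c0, of "?v' p \<omega> - q \<omega>" 1] K'1[of p \<omega>] q(3)[OF w] by (simp add: x_def)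
    have "of_real (exp x) = complex_of_real (exp (- (c * q \<omega>)) * exp (c * ?v' p \<omega>))"
      by (simp add: x_def exp_add[symmetric] right_diff_distrib del: of_real_mult)
    then have "?T \<omega> - A p \<omega>
      = V \<omega> * (iexp (w * Y \<omega>) * (iexp (w * I \<omega>) - iexp (w * ?i' p \<omega>) * of_real (exp x)))"
      by (simp add: A_def right_diff_distrib mult_ac)
    then have "norm (?T \<omega> - A p \<omega>)
      = norm (V \<omega>) * norm (iexp (w * I \<omega>) - iexp (w * ?i' p \<omega>) * of_real (exp x))"
      by (simp only: norm_mult norm_exp_i_times mult_1)
    also have "\<dots> \<le> 1 * norm (iexp (w * I \<omega>) - iexp (w * ?i' p \<omega>) * of_real (exp x))"
      by (intro mult_right_mono V(2)[OF w]) simp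
    also have "iexp (w * I \<omega>) - iexp (w * ?i' p \<omega>) * of_real (exp x)
      = (iexp (w * I \<omega>) - iexp (w * ?i' p \<omega>)) + iexp (w * ?i' p \<omega>) * of_real (1 - exp x)"
      by (simp add: algebra_simps)
    also have "1 * norm \<dots> \<le> norm (iexp (w * I \<omega>) - iexp (w * ?i' p \<omega>)) + \<bar>1 - exp x\<bar>"
      using norm_triangle_ineq[of "iexp (w * I \<omega>) - iexp (w * ?i' p \<omega>)" "iexp (w * ?i' p \<omega>) * of_real (1 - exp x)"]
      by (simp only: mult_1 norm_mult norm_exp_i_times norm_of_real)
    finally have main: "norm (?T \<omega> - A p \<omega>)
      \<le> norm (iexp (w * I \<omega>) - iexp (w * ?i' p \<omega>)) + \<bar>1 - exp x\<bar>" .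
    \<comment> \<open>Crude bounds for sample points where truncation changed the integrand: 2 and
      \<open>1 + exp c\<close>, whose sum is the constant \<open>3 + exp c\<close>.\<close>
    have a2: "norm (iexp (w * I \<omega>) - iexp (w * ?i' p \<omega>)) \<le> 2"
      using norm_triangle_ineq4[of "iexp (w * I \<omega>)" "iexp (w * ?i' p \<omega>)"] unfolding norm_exp_i_times by simp
    have "exp x \<le> exp c" using x by simp
    then have b2: "\<bar>1 - exp x\<bar> \<le> 1 + exp c" using exp_gt_zero[of x] by linarith
    have E0: "0 \<le> (c * exp c) * \<bar>Q \<omega> - q \<omega>\<bar>" "0 \<le> (3 + exp c) * (4 * \<bar>Q \<omega> - q \<omega>\<bar>)"
      using c0 by (auto intro!: mult_nonneg_nonneg add_nonneg_nonneg)
    have I0: "0 \<le> (3 + exp c) * (if 1 / 4 < q \<omega> then 1 else 0)" "0 \<le> (3 + exp c) * D3 p \<omega>"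
      using D3b[of p \<omega>] by (auto intro!: mult_nonneg_nonneg add_nonneg_nonneg)
    have E': "E \<omega> = (c * exp c) * \<bar>Q \<omega> - q \<omega>\<bar> + (3 + exp c) * (4 * \<bar>Q \<omega> - q \<omega>\<bar>) + (3 + exp c) * (if 1 / 4 < q \<omega> then 1 else 0)"
      unfolding E_def by (simp add: algebra_simps)
    show ?thesis
    proof (cases "?v p \<omega> \<le> 1")
      case True
      have a: "norm (iexp (w * I \<omega>) - iexp (w * ?i' p \<omega>)) = D1 p \<omega>"
        unfolding D1_def K'2(1)[OF True] by (rule norm_minus_commute)
      have "\<bar>1 - exp x\<bar> \<le> exp c * \<bar>x\<bar>" by (rule abs_exp_diff_le[OF x c0])
      also have "\<bar>x\<bar> = c * \<bar>?v p \<omega> - q \<omega>\<bar>"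
        unfolding x_def K'2(2)[OF True] abs_mult using c0 by simp
      also have "exp c * (c * \<bar>?v p \<omega> - q \<omega>\<bar>) \<le> exp c * (c * (\<bar>?v p \<omega> - Q \<omega>\<bar> + \<bar>Q \<omega> - q \<omega>\<bar>))"
        using c0 by (intro mult_left_mono) auto
      also have "\<dots> = c * exp c * \<bar>?v p \<omega> - Q \<omega>\<bar> + (c * exp c) * \<bar>Q \<omega> - q \<omega>\<bar>"
        by (simp add: algebra_simps)
      finally have "\<bar>1 - exp x\<bar> \<le> D2 p \<omega> + (c * exp c) * \<bar>Q \<omega> - q \<omega>\<bar>"
        using b2 E0(1) unfolding D2_def by (simp add: min_def)
      then show ?thesis using main a E0 I0 unfolding E' by linarith
    next
      case False
      \<comment> \<open>Because 1/2 + 1/4 + 1/4 = 1, a variation above 1 requires a deviation above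
        1/2 from \<open>Q\<close>, a gap of at least 1/4 between \<open>Q\<close> and
        \<open>q\<close>, or \<open>q > 1/4\<close>. The factor 4 converts the second event into a
        multiple of the gap.\<close>
      have "1 \<le> D3 p \<omega> + 4 * \<bar>Q \<omega> - q \<omega>\<bar> + (if 1 / 4 < q \<omega> then 1 else 0)"
      proof (rule ccontr)
        assume n: "\<not> ?thesis"
        then have "D3 p \<omega> \<noteq> 1" "(if 1 / 4 < q \<omega> then 1 else 0 :: real) \<noteq> 1"
          using D3b(1)[of p \<omega>] by auto
        then have "\<bar>?v p \<omega> - Q \<omega>\<bar> \<le> 1 / 2" "q \<omega> \<le> 1 / 4"
          by (auto simp: D3_def split: if_splits)
        moreover have "4 * \<bar>Q \<omega> - q \<omega>\<bar> < 1"
        proof -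
          have "0 \<le> (if 1 / 4 < q \<omega> then 1 else 0 :: real)" by simp
          then show ?thesis using n D3b(1)[of p \<omega>] by linarith
        qed
        ultimately have "?v p \<omega> - Q \<omega> \<le> 1 / 2" "q \<omega> \<le> 1 / 4" "4 * (Q \<omega> - q \<omega>) < 1"
          by (simp_all add: abs_le_iff abs_if split: if_splits)
        then show False using False by simp
      qed
      then have "(3 + exp c) * 1 \<le> (3 + exp c) * (D3 p \<omega> + 4 * \<bar>Q \<omega> - q \<omega>\<bar> + (if 1 / 4 < q \<omega> then 1 else 0))"
        by (intro mult_left_mono) (auto intro: add_nonneg_nonneg)
      then have "3 + exp c \<le> (3 + exp c) * D3 p \<omega> + (3 + exp c) * (4 * \<bar>Q \<omega> - q \<omega>\<bar>) + (3 + exp c) * (if 1 / 4 < q \<omega> then 1 else 0)"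
        by (simp only: distrib_left mult_1_right)
      then show ?thesis using main a2 b2 D1b(1)[of p \<omega>] D2b(1)[of p \<omega>] E0 unfolding E' by linarith
    qed
  qed
  have bound: "norm (?L - ?R) \<le> expectation (D1 p) + expectation (D2 p) + (3 + exp c) * expectation (D3 p) + ?B" for p
  proof -
    have "?L - ?R = expectation (\<lambda>\<omega>. ?T \<omega> - A p \<omega>)"
      unfolding eA[of p, symmetric] by (rule Bochner_Integration.integral_diff[OF iL iA, symmetric])
    also have "norm \<dots> \<le> expectation (\<lambda>\<omega>. norm (?T \<omega> - A p \<omega>))"
      by (rule integral_norm_bound)
    also have "\<dots> \<le> expectation (\<lambda>\<omega>. D1 p \<omega> + D2 p \<omega> + (3 + exp c) * D3 p \<omega> + E \<omega>)"
      by (intro integral_mono point integrable_norm Bochner_Integration.integrable_diff iL iA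
          Bochner_Integration.integrable_add integrable_mult_right i1 i2 i3 iE)
    also have "\<dots> = expectation (D1 p) + expectation (D2 p) + (3 + exp c) * expectation (D3 p) + expectation E"
      using i1[of p] i2[of p] i3[of p] iE by simp
    finally show ?thesis unfolding eE .
  qed
  have l1: "(\<lambda>p. expectation (D1 p)) \<longlonglongrightarrow> 0"
    unfolding D1_def by (rule iexp_tendsto_in_prob[OF _ _ Ilim]) measurable
  have P0: "(\<lambda>p. prob {\<omega> \<in> space M. d < \<bar>?v p \<omega> - Q \<omega>\<bar>}) \<longlonglongrightarrow> 0" if "0 < d" for d
    using Vlim that unfolding tendsto_in_prob_def by blast
  have l3: "(\<lambda>p. expectation (D3 p)) \<longlonglongrightarrow> 0"
  proof -
    have "expectation (D3 p) = prob {\<omega> \<in> space M. 1 / 2 < \<bar>?v p \<omega> - Q \<omega>\<bar>}" for p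
      unfolding D3_def by (rule expectation_if) measurable
    then show ?thesis using P0[of "1 / 2"] by simp
  qed
  have l2: "(\<lambda>p. expectation (D2 p)) \<longlonglongrightarrow> 0"
  proof (rule expectation_tendsto_0[OF _ D2b])
    fix d :: real assume d: "0 < d"
    let ?d = "d / (c * exp c + 1)"
    have pos: "0 < c * exp c + 1" using c0 by (intro add_nonneg_pos) auto
    have "prob {\<omega> \<in> space M. d < D2 p \<omega>} \<le> prob {\<omega> \<in> space M. ?d < \<bar>?v p \<omega> - Q \<omega>\<bar>}" for p
    proof (rule finite_measure_mono)
      show "{\<omega> \<in> space M. d < D2 p \<omega>} \<subseteq> {\<omega> \<in> space M. ?d < \<bar>?v p \<omega> - Q \<omega>\<bar>}"
      proof safe
        fix \<omega> assume "d < D2 p \<omega>"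
        also have "\<dots> \<le> c * exp c * \<bar>?v p \<omega> - Q \<omega>\<bar>" by (simp add: D2_def)
        also have "\<dots> \<le> (c * exp c + 1) * \<bar>?v p \<omega> - Q \<omega>\<bar>" by (intro mult_right_mono) auto
        finally show "?d < \<bar>?v p \<omega> - Q \<omega>\<bar>"
          using pos by (simp add: pos_divide_less_eq mult.commute)
      qed
    qed measurable
    then show "(\<lambda>p. prob {\<omega> \<in> space M. d < D2 p \<omega>}) \<longlonglongrightarrow> 0"
      by (intro tendsto_0_le[OF P0[of ?d], where K=1]) (use pos d in auto)
  qed measurable
  have "(\<lambda>p. expectation (D1 p) + expectation (D2 p) + (3 + exp c) * expectation (D3 p) + ?B)
     \<longlonglongrightarrow> 0 + 0 + (3 + exp c) * 0 + ?B"
    by (intro tendsto_intros l1 l2 l3)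
  then have "norm (?L - ?R) \<le> 0 + 0 + (3 + exp c) * 0 + ?B"
    by (rule LIMSEQ_le_const) (use bound in blast)
  then show ?thesis by simp
qed

section \<open>Short-time expansion of the stationary process\<close>

text \<open>The summand 1 puts the grid point strictly to the right of \<open>s\<close>, so that
  right limits apply even when \<open>s\<close> itself lies on the grid.\<close>

lemma filterlim_grid_right:
  fixes s :: real
  assumes "0 \<le> s"
  shows "filterlim (\<lambda>n. (real (nat \<lfloor>s * real (Suc n)\<rfloor>) + 1) / real (Suc n)) (at_right s) sequentially"
proof -
  let ?r = "\<lambda>n. (real (nat \<lfloor>s * real (Suc n)\<rfloor>) + 1) / real (Suc n)"
  have b: "s < ?r n \<and> ?r n \<le> s + inverse (real (Suc n))" for n
  proof -
    have f: "real (nat \<lfloor>s * real (Suc n)\<rfloor>) = of_int \<lfloor>s * real (Suc n)\<rfloor>"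
      using assms by (simp del: of_nat_Suc)
    have "s * real (Suc n) < of_int \<lfloor>s * real (Suc n)\<rfloor> + 1" "of_int \<lfloor>s * real (Suc n)\<rfloor> \<le> s * real (Suc n)"
      by linarith+
    then show ?thesis unfolding f by (simp add: field_simps del: of_nat_Suc)
  qed
  have "?r \<longlonglongrightarrow> s"
  proof (rule tendsto_sandwich[of "\<lambda>_. s" ?r sequentially "\<lambda>n. s + inverse (real (Suc n))"])
    have "(\<lambda>n. s + inverse (real (Suc n))) \<longlonglongrightarrow> s + 0"
      by (intro tendsto_intros LIMSEQ_inverse_real_of_nat)
    then show "(\<lambda>n. s + inverse (real (Suc n))) \<longlonglongrightarrow> s" by simp
  qed (use b in \<open>auto intro!: always_eventually less_imp_le simp del: of_nat_Suc\<close>)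
  then show ?thesis
    unfolding at_within_def using b by (auto simp: filterlim_inf filterlim_principal simp del: of_nat_Suc)
qed

text \<open>Right continuity makes the process a pointwise limit of processes that are constant in
  time between grid points; each of these involves only countably many random variables. The maximum
  with 0 keeps times in the half-line where the process has meaning.\<close>

lemma measurable_cadlag_process:
  fixes X :: "real \<Rightarrow> 'w \<Rightarrow> real"
  assumes X: "\<And>t. 0 \<le> t \<Longrightarrow> X t \<in> borel_measurable M"
    and path: "\<And>\<omega>. \<omega> \<in> space M \<Longrightarrow> cadlag (\<lambda>t. X t \<omega>)"
  shows "(\<lambda>x. X (max 0 (snd x)) (fst x)) \<in> borel_measurable (M \<Otimes>\<^sub>M borel)"
proof -
  define Y where "Y n x = X ((real (nat \<lfloor>max 0 (snd x) * real (Suc n)\<rfloor>) + 1) / real (Suc n)) (fst x)" for n and x :: "'w \<times> real"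
  have Ym: "Y n \<in> borel_measurable (M \<Otimes>\<^sub>M borel)" for n
    unfolding Y_def
  proof (rule measurable_compose_countable[where f="\<lambda>i x. X ((real i + 1) / real (Suc n)) (fst x)"
        and g="\<lambda>x. nat \<lfloor>max 0 (snd x) * real (Suc n)\<rfloor>"])
    show "(\<lambda>x. X ((real i + 1) / real (Suc n)) (fst x)) \<in> borel_measurable (M \<Otimes>\<^sub>M borel)" for i :: nat
      by (rule measurable_compose[OF measurable_fst X]) simp
    show "(\<lambda>x. nat \<lfloor>max 0 (snd x) * real (Suc n)\<rfloor>) \<in> M \<Otimes>\<^sub>M borel \<rightarrow>\<^sub>M count_space UNIV"
      by measurable
  qed
  show ?thesis
  proof (rule borel_measurable_LIMSEQ_metric[OF Ym])
    fix x assume "x \<in> space (M \<Otimes>\<^sub>M (borel :: real measure))"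
    then have w: "fst x \<in> space M" by (auto simp: space_pair_measure)
    have "((\<lambda>t. X t (fst x)) \<longlongrightarrow> X (max 0 (snd x)) (fst x)) (at_right (max 0 (snd x)))"
      using path[OF w] by (simp add: cadlag_def)
    from filterlim_compose[OF this filterlim_grid_right]
    show "(\<lambda>n. Y n x) \<longlonglongrightarrow> X (max 0 (snd x)) (fst x)"
      by (simp add: Y_def)
  qed
qed

section \<open>The stationary process and its mean oscillation\<close>

locale stationary_ito_levy = prob_space M for M :: "'w measure" +
  fixes F :: "real \<Rightarrow> 'w measure" and W L X :: "real \<Rightarrow> 'w \<Rightarrow> real"
    and N :: "real \<Rightarrow> 'w \<Rightarrow> real measure" and \<nu> \<pi> :: "real measure" and f g :: "real \<Rightarrow> real"
    and pf pg :: "real poly"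
  assumes sde: "ito_levy_process M F W N \<nu> L f g X"
    and stationary: "stationary_distribution M X \<pi>"
    and f_poly: "\<And>x. f x = poly pf x"
    and g_poly: "\<And>x. (g x)\<^sup>2 = poly pg x"
    and int_pf: "integrable \<pi> (poly pf)"
    and int_pg: "integrable \<pi> (poly pg)"

sublocale stationary_ito_levy \<subseteq> levy_noise M F W N \<nu>
  using sde by unfold_locales (simp_all add: ito_levy_process_def)

context stationary_ito_levy begin

lemma pg_nonneg: "0 \<le> poly pg x"
  using zero_le_power2[of "g x"] by (simp only: g_poly)

lemma adapted_X: "0 \<le> t \<Longrightarrow> X t \<in> borel_measurable (F t)"
  using sde by (simp add: ito_levy_process_def)

lemma measurable_X[measurable]: "0 \<le> t \<Longrightarrow> X t \<in> borel_measurable M"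
  by (rule measurable_F[OF adapted_X])

lemma cadlag_X: "\<omega> \<in> space M \<Longrightarrow> cadlag (\<lambda>t. X t \<omega>)"
  using sde by (simp add: ito_levy_process_def)

lemma distr_X: "0 \<le> t \<Longrightarrow> distr M borel (X t) = \<pi>"
  using stationary by (simp add: stationary_distribution_def)

lemma sets_pi[measurable_cong]: "sets \<pi> = sets borel"
  using distr_X[of 0] by (metis sets_distr order_refl)

lemma prob_space_pi: "prob_space \<pi>"
  using prob_space_distr[of "X 0" borel] distr_X[of 0] by simp

lemma measurable_poly[measurable]: "poly p \<in> borel_measurable (borel :: real measure)"
  by (intro borel_measurable_continuous_onI continuous_intros)

lemma measurable_X_pair[measurable]:
  "(\<lambda>x. X (max 0 (snd x)) (fst x)) \<in> borel_measurable (M \<Otimes>\<^sub>M borel)"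
  by (rule measurable_cadlag_process[OF measurable_X cadlag_X])

lemma integrable_X:
  fixes u :: "real \<Rightarrow> 'b :: {banach, second_countable_topology}"
  assumes "0 \<le> t" "u \<in> borel_measurable borel"
  shows "integrable M (\<lambda>\<omega>. u (X t \<omega>)) \<longleftrightarrow> integrable \<pi> u"
  using integrable_distr_eq[of "X t" M borel u] assms distr_X[of t] by simp

lemma integral_X:
  fixes u :: "real \<Rightarrow> 'b :: {banach, second_countable_topology}"
  assumes "0 \<le> t" "u \<in> borel_measurable borel"
  shows "expectation (\<lambda>\<omega>. u (X t \<omega>)) = (\<integral>x. u x \<partial>\<pi>)"
  using integral_distr[of "X t" M borel u] assms distr_X[of t] by simp

text \<open>All \<open>X t\<close> have the same law, so pathwise right continuity at 0 upgrades to convergence in mean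
  by Scheffe's lemma.\<close>
lemma mean_continuity:
  assumes p: "integrable \<pi> (poly p)"
  shows "((\<lambda>t. \<integral>\<^sup>+\<omega>. ennreal \<bar>poly p (X t \<omega>) - poly p (X 0 \<omega>)\<bar> \<partial>M) \<longlongrightarrow> 0) (at_right 0)"
proof (rule tendsto_at_right_sequentially[of 0 1])
  fix S :: "nat \<Rightarrow> real"
  assume S: "\<And>n. 0 < S n" "S \<longlonglongrightarrow> 0"
  have filt: "filterlim S (at_right 0) sequentially"
    unfolding at_within_def using S by (auto simp: filterlim_inf filterlim_principal)
  have eq: "(\<integral>\<^sup>+\<omega>. ennreal (norm (poly p (X t \<omega>))) \<partial>M) = (\<integral>\<^sup>+x. ennreal (norm (poly p x)) \<partial>\<pi>)" if "0 \<le> t" for t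
  proof -
    have "(\<integral>\<^sup>+x. ennreal (norm (poly p x)) \<partial>\<pi>) = (\<integral>\<^sup>+x. ennreal (norm (poly p x)) \<partial>distr M borel (X t))"
      using distr_X[OF that] by simp
    also have "\<dots> = (\<integral>\<^sup>+\<omega>. ennreal (norm (poly p (X t \<omega>))) \<partial>M)"
      using that by (intro nn_integral_distr) measurable
    finally show ?thesis by simp
  qed
  have "(\<lambda>n. \<integral>\<^sup>+\<omega>. ennreal (norm (poly p (X (S n) \<omega>) - poly p (X 0 \<omega>))) \<partial>M) \<longlonglongrightarrow> 0"
  proof (rule Scheffe_lemma2)
    show "(\<lambda>\<omega>. poly p (X (S n) \<omega>)) \<in> borel_measurable M" for n
      using S(1)[of n] by (intro measurable_compose[OF measurable_X measurable_poly]) simp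
    show "integrable M (\<lambda>\<omega>. poly p (X 0 \<omega>))"
      using p by (subst integrable_X) auto
    show "AE \<omega> in M. (\<lambda>n. poly p (X (S n) \<omega>)) \<longlonglongrightarrow> poly p (X 0 \<omega>)"
    proof (rule AE_I2)
      fix \<omega> assume w: "\<omega> \<in> space M"
      have "((\<lambda>t. X t \<omega>) \<longlongrightarrow> X 0 \<omega>) (at_right 0)"
        using cadlag_X[OF w] by (simp add: cadlag_def)
      from filterlim_compose[OF this filt]
      show "(\<lambda>n. poly p (X (S n) \<omega>)) \<longlonglongrightarrow> poly p (X 0 \<omega>)"
        by (intro tendsto_intros)
    qed
    show "(\<integral>\<^sup>+\<omega>. ennreal (norm (poly p (X (S n) \<omega>))) \<partial>M) \<le> (\<integral>\<^sup>+\<omega>. ennreal (norm (poly p (X 0 \<omega>))) \<partial>M)" for n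
      using eq[of "S n"] eq[of 0] S(1)[of n] by simp
  qed
  then show "(\<lambda>n. \<integral>\<^sup>+\<omega>. ennreal \<bar>poly p (X (S n) \<omega>) - poly p (X 0 \<omega>)\<bar> \<partial>M) \<longlonglongrightarrow> 0"
    by simp
qed simp

text \<open>Takes values in \<open>ennreal\<close>, so that Tonelli's theorem and bounds in mean
  apply before anything is known about integrability along a path.\<close>

definition path_oscillation :: "real poly \<Rightarrow> real \<Rightarrow> 'w \<Rightarrow> ennreal" where
  "path_oscillation p h \<omega> = (\<integral>\<^sup>+s\<in>{0..h}. ennreal \<bar>poly p (X s \<omega>) - poly p (X 0 \<omega>)\<bar> \<partial>lborel)"

lemma path_oscillation_alt:
  "path_oscillation p h \<omega> = (\<integral>\<^sup>+s. ennreal \<bar>poly p (X (max 0 s) \<omega>) - poly p (X 0 \<omega>)\<bar> * indicator {0..h} s \<partial>lborel)"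
  unfolding path_oscillation_def by (intro nn_integral_cong) (auto simp: indicator_def max_def)

lemma measurable_pair_gap:
  "(\<lambda>x. ennreal \<bar>poly p (X (max 0 (snd x)) (fst x)) - poly p (X 0 (fst x))\<bar> * indicator {0..h} (snd x))
    \<in> borel_measurable (M \<Otimes>\<^sub>M lborel)"
proof -
  have "(\<lambda>x. X 0 (fst x)) \<in> borel_measurable (M \<Otimes>\<^sub>M (borel :: real measure))"
    by (rule measurable_compose[OF measurable_fst measurable_X]) simp
  then have "(\<lambda>x. ennreal \<bar>poly p (X (max 0 (snd x)) (fst x)) - poly p (X 0 (fst x))\<bar> * indicator {0..h} (snd x))
    \<in> borel_measurable (M \<Otimes>\<^sub>M (borel :: real measure))"
    by measurable
  then show ?thesis
    by (simp cong: measurable_cong_sets)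
qed

lemma measurable_path_oscillation[measurable]: "path_oscillation p h \<in> borel_measurable M"
  unfolding path_oscillation_alt[abs_def]
  using lborel.borel_measurable_nn_integral_fst[OF measurable_pair_gap] by simp

text \<open>By Tonelli's theorem the expectation is the time integral over \<open>{0..h}\<close> of
  the mean gaps, each of which is below \<open>e\<close> for small times by
  \<open>mean_continuity\<close>.\<close>

lemma path_oscillation_small:
  assumes p: "integrable \<pi> (poly p)" and e: "0 < e"
  obtains h0 where "0 < h0" "\<And>h. 0 < h \<Longrightarrow> h < h0 \<Longrightarrow> (\<integral>\<^sup>+\<omega>. path_oscillation p h \<omega> \<partial>M) \<le> ennreal (e * h)"
proof -
  interpret P: pair_sigma_finite M lborel ..
  let ?m = "\<lambda>t. \<integral>\<^sup>+\<omega>. ennreal \<bar>poly p (X t \<omega>) - poly p (X 0 \<omega>)\<bar> \<partial>M"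
  have "eventually (\<lambda>t. ?m t < ennreal e) (at_right 0)"
    by (rule order_tendstoD(2)[OF mean_continuity[OF p]]) (use e in simp)
  then obtain h0 where h0: "0 < h0" "\<And>t. 0 < t \<Longrightarrow> t < h0 \<Longrightarrow> ?m t < ennreal e"
    unfolding eventually_at_right_field by blast
  show ?thesis
  proof (rule that[OF h0(1)])
    fix h assume h: "0 < h" "h < h0"
    have "(\<integral>\<^sup>+\<omega>. path_oscillation p h \<omega> \<partial>M)
      = (\<integral>\<^sup>+s. \<integral>\<^sup>+\<omega>. ennreal \<bar>poly p (X (max 0 s) \<omega>) - poly p (X 0 \<omega>)\<bar> * indicator {0..h} s \<partial>M \<partial>lborel)"
      unfolding path_oscillation_alt
      by (rule P.Fubini'[symmetric]) (use measurable_pair_gap[of p h] in \<open>simp add: split_beta'\<close>)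
    also have "\<dots> \<le> (\<integral>\<^sup>+s. ennreal e * indicator {0..h} s \<partial>lborel)"
    proof (rule nn_integral_mono)
      fix s
      show "(\<integral>\<^sup>+\<omega>. ennreal \<bar>poly p (X (max 0 s) \<omega>) - poly p (X 0 \<omega>)\<bar> * indicator {0..h} s \<partial>M) \<le> ennreal e * indicator {0..h} s"
      proof (cases "s \<in> {0..h}")
        case True
        then have "?m s \<le> ennreal e"
          using h0(2)[of s] h e by (cases "s = 0") (auto simp: less_imp_le)
        then show ?thesis using True by (simp add: max_def)
      qed simp
    qed
    also have "\<dots> = ennreal (e * h)"
      using h e by (simp add: nn_integral_cmult_indicator ennreal_mult)
    finally show "(\<integral>\<^sup>+\<omega>. path_oscillation p h \<omega> \<partial>M) \<le> ennreal (e * h)" .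
  qed
qed

end

text \<open>The left half-plane is convex and exp has derivative of modulus at most 1 there. This
  dominates the difference quotients in \<open>stationary_equation\<close>.\<close>

lemma norm_exp_minus_1_le:
  fixes z :: complex
  assumes "Re z \<le> 0"
  shows "norm (exp z - 1) \<le> norm z"
proof -
  have "norm (exp z - exp 0) \<le> 1 * norm (z - 0)"
  proof (rule field_differentiable_bound[where S="{z. Re z \<le> 0}" and f'=exp])
    show "convex {z. Re z \<le> 0}" by (rule convex_halfspace_Re_le)
    show "(exp has_field_derivative exp z) (at z within {z. Re z \<le> 0})" for z :: complex
      by (rule DERIV_subset[OF DERIV_exp]) simp
  qed (use assms in \<open>auto simp: norm_exp_eq_Re\<close>)
  then show ?thesis by simp
qed

lemma exp_difference_quotient:
  fixes z :: complex and h :: "nat \<Rightarrow> real"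
  assumes h: "\<And>j. h j \<noteq> 0" "h \<longlonglongrightarrow> 0"
  shows "(\<lambda>j. (exp (of_real (h j) * z) - 1) / of_real (h j)) \<longlonglongrightarrow> z"
proof (cases "z = 0")
  case False
  have "(\<lambda>j. of_real (h j) * z) \<longlonglongrightarrow> of_real 0 * z"
    by (intro tendsto_intros h)
  then have "filterlim (\<lambda>j. of_real (h j) * z) (at 0) sequentially"
    using h False by (auto simp: filterlim_at)
  from filterlim_compose[OF lim_exp_minus_1 this]
  have "(\<lambda>j. (exp (of_real (h j) * z) - 1) / (of_real (h j) * z) * z) \<longlonglongrightarrow> 1 * z"
    by (intro tendsto_intros)
  then show ?thesis using False h by simp
qed (simp add: h)

section \<open>Quadratic variation, drift and tails over a short interval\<close>

context stationary_ito_levy begin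

lemma measurable_path: "\<omega> \<in> space M \<Longrightarrow> (\<lambda>s. X (max 0 s) \<omega>) \<in> borel_measurable borel"
  using measurable_Pair2[OF measurable_X_pair] by simp

text \<open>\<open>enn2real\<close> yields the value 0 where the path integral is infinite; for
  small \<open>h\<close> this happens with probability 0 by
  \<open>quad_var_estimate\<close>.\<close>

definition quad_var :: "real \<Rightarrow> 'w \<Rightarrow> real" where
  "quad_var h \<omega> = enn2real (\<integral>\<^sup>+s\<in>{0..h}. ennreal (poly pg (X s \<omega>)) \<partial>lborel)"

lemma nn_integral_path_alt:
  "(\<integral>\<^sup>+s\<in>{0..h}. ennreal (poly p (X s \<omega>)) \<partial>lborel)
    = (\<integral>\<^sup>+s. ennreal (poly p (X (max 0 s) \<omega>)) * indicator {0..h} s \<partial>lborel)"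
  by (intro nn_integral_cong) (auto simp: indicator_def max_def)

lemma measurable_quad_var[measurable]: "quad_var h \<in> borel_measurable M"
proof -
  have "(\<lambda>x. ennreal (poly pg (X (max 0 (snd x)) (fst x))) * indicator {0..h} (snd x))
    \<in> borel_measurable (M \<Otimes>\<^sub>M (borel :: real measure))"
    by measurable
  then have "(\<lambda>x. ennreal (poly pg (X (max 0 (snd x)) (fst x))) * indicator {0..h} (snd x))
    \<in> borel_measurable (M \<Otimes>\<^sub>M lborel)"
    by (simp cong: measurable_cong_sets)
  from lborel.borel_measurable_nn_integral_fst[OF this]
  show ?thesis unfolding quad_var_def[abs_def] nn_integral_path_alt by simp
qed

text \<open>The triangle inequality is carried out in both directions with nonnegative integrals,
  since finiteness of the quadratic variation is itself part of what is shown.\<close>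

lemma quad_var_gap:
  assumes w: "\<omega> \<in> space M" and h: "0 \<le> h" and fin: "path_oscillation pg h \<omega> \<noteq> \<infinity>"
  shows "(\<integral>\<^sup>+s\<in>{0..h}. ennreal (poly pg (X s \<omega>)) \<partial>lborel) = ennreal (quad_var h \<omega>)"
    and "ennreal \<bar>quad_var h \<omega> - h * poly pg (X 0 \<omega>)\<bar> \<le> path_oscillation pg h \<omega>"
proof -
  let ?G = "\<lambda>s. poly pg (X (max 0 s) \<omega>)" and ?g = "poly pg (X 0 \<omega>)" and ?i = "\<lambda>s. indicator {0..h} s :: ennreal"
  let ?P = "\<integral>\<^sup>+s. ennreal (?G s) * ?i s \<partial>lborel"
  have [measurable]: "(\<lambda>s. X (max 0 s) \<omega>) \<in> borel_measurable borel" by (rule measurable_path[OF w])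
  obtain r where r: "0 \<le> r" "path_oscillation pg h \<omega> = ennreal r"
    using fin by (cases "path_oscillation pg h \<omega>") auto
  have r': "(\<integral>\<^sup>+s. ennreal \<bar>?G s - ?g\<bar> * ?i s \<partial>lborel) = ennreal r"
    using r(2) unfolding path_oscillation_alt .
  have c: "(\<integral>\<^sup>+s. ennreal ?g * ?i s \<partial>lborel) = ennreal (h * ?g)"
    using h pg_nonneg by (subst nn_integral_cmult_indicator) (simp_all add: ennreal_mult mult.commute)
  have "?P \<le> (\<integral>\<^sup>+s. ennreal ?g * ?i s + ennreal \<bar>?G s - ?g\<bar> * ?i s \<partial>lborel)"
    using pg_nonneg by (intro nn_integral_mono)
      (auto simp: indicator_def ennreal_plus[symmetric] simp del: ennreal_plus intro!: ennreal_leI)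
  also have "\<dots> = ennreal (h * ?g) + ennreal r"
    by (subst nn_integral_add) (simp_all add: c r')
  finally have up: "?P \<le> ennreal (h * ?g + r)"
    using h pg_nonneg r by (simp add: ennreal_plus[symmetric] del: ennreal_plus)
  then have Pfin: "?P < \<infinity>" by (rule le_less_trans) simp
  then have Pq: "?P = ennreal (quad_var h \<omega>)"
    unfolding quad_var_def nn_integral_path_alt by simp
  then show "(\<integral>\<^sup>+s\<in>{0..h}. ennreal (poly pg (X s \<omega>)) \<partial>lborel) = ennreal (quad_var h \<omega>)"
    unfolding nn_integral_path_alt .
  have q0: "0 \<le> quad_var h \<omega>" by (simp add: quad_var_def)
  have "ennreal (h * ?g) \<le> (\<integral>\<^sup>+s. ennreal (?G s) * ?i s + ennreal \<bar>?G s - ?g\<bar> * ?i s \<partial>lborel)"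
    unfolding c[symmetric] using pg_nonneg by (intro nn_integral_mono)
      (auto simp: indicator_def ennreal_plus[symmetric] simp del: ennreal_plus intro!: ennreal_leI)
  also have "\<dots> = ennreal (quad_var h \<omega>) + ennreal r"
    by (subst nn_integral_add) (simp_all add: Pq r')
  finally have "ennreal (h * ?g) \<le> ennreal (quad_var h \<omega> + r)"
    using q0 r by (simp add: ennreal_plus[symmetric] del: ennreal_plus)
  then have "h * ?g \<le> quad_var h \<omega> + r"
    using q0 r by (subst (asm) ennreal_le_iff) auto
  moreover have "quad_var h \<omega> \<le> h * ?g + r"
  proof -
    have "0 \<le> h * ?g + r" using h pg_nonneg r by (intro add_nonneg_nonneg mult_nonneg_nonneg) auto
    then show ?thesis using up unfolding Pq by (simp only: ennreal_le_iff)
  qed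
  ultimately have "\<bar>quad_var h \<omega> - h * ?g\<bar> \<le> r" by linarith
  then show "ennreal \<bar>quad_var h \<omega> - h * ?g\<bar> \<le> path_oscillation pg h \<omega>"
    unfolding r by (rule ennreal_leI)
qed

lemma quad_var_estimate:
  assumes h: "0 \<le> h" and gap: "(\<integral>\<^sup>+\<omega>. path_oscillation pg h \<omega> \<partial>M) \<le> ennreal b" and b: "0 \<le> b"
  shows "integrable M (quad_var h)"
    and "AE \<omega> in M. (\<integral>\<^sup>+s\<in>{0..h}. ennreal (poly pg (X s \<omega>)) \<partial>lborel) = ennreal (quad_var h \<omega>)"
    and "expectation (\<lambda>\<omega>. \<bar>quad_var h \<omega> - h * poly pg (X 0 \<omega>)\<bar>) \<le> b"
proof -
  let ?d = "\<lambda>\<omega>. \<bar>quad_var h \<omega> - h * poly pg (X 0 \<omega>)\<bar>"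
  have fin: "AE \<omega> in M. path_oscillation pg h \<omega> \<noteq> \<infinity>"
    using gap by (intro nn_integral_noteq_infinite measurable_path_oscillation) (auto simp: top_unique)
  then show "AE \<omega> in M. (\<integral>\<^sup>+s\<in>{0..h}. ennreal (poly pg (X s \<omega>)) \<partial>lborel) = ennreal (quad_var h \<omega>)"
    using AE_space
  proof eventually_elim
    case (elim \<omega>)
    show ?case by (rule quad_var_gap(1)[OF elim(2) h elim(1)])
  qed
  have g0: "integrable M (\<lambda>\<omega>. poly pg (X 0 \<omega>))"
    using int_pg by (subst integrable_X) auto
  have [measurable]: "(\<lambda>\<omega>. poly pg (X 0 \<omega>)) \<in> borel_measurable M" using g0 by auto
  have "(\<integral>\<^sup>+\<omega>. ennreal (?d \<omega>) \<partial>M) \<le> (\<integral>\<^sup>+\<omega>. path_oscillation pg h \<omega> \<partial>M)"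
  proof (rule nn_integral_mono_AE)
    show "AE \<omega> in M. ennreal (?d \<omega>) \<le> path_oscillation pg h \<omega>"
      using fin AE_space
    proof eventually_elim
      case (elim \<omega>)
      show ?case by (rule quad_var_gap(2)[OF elim(2) h elim(1)])
    qed
  qed
  then have le: "(\<integral>\<^sup>+\<omega>. ennreal (?d \<omega>) \<partial>M) \<le> ennreal b"
    using gap by (rule order_trans)
  then have "integrable M (\<lambda>\<omega>. quad_var h \<omega> - h * poly pg (X 0 \<omega>))"
    by (intro integrableI_bounded) (auto simp: le_less_trans)
  then have i: "integrable M (\<lambda>\<omega>. quad_var h \<omega> - h * poly pg (X 0 \<omega>))" .
  have "integrable M (\<lambda>\<omega>. (quad_var h \<omega> - h * poly pg (X 0 \<omega>)) + h * poly pg (X 0 \<omega>))"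
    by (intro Bochner_Integration.integrable_add i integrable_mult_right g0)
  then show "integrable M (quad_var h)" by simp
  have "ennreal (expectation (\<lambda>\<omega>. (?d \<omega>))) \<le> ennreal b"
    using le i by (subst nn_integral_eq_integral[symmetric]) auto
  then show "expectation (\<lambda>\<omega>. (?d \<omega>)) \<le> b"
    using b by (simp add: ennreal_le_iff)
qed

lemma drift_estimate:
  assumes w: "\<omega> \<in> space M" and h: "0 \<le> h"
    and int: "set_integrable lborel {0..h} (\<lambda>s. f (X s \<omega>))"
  shows "ennreal \<bar>(LINT s:{0..h}|lborel. f (X s \<omega>)) - h * f (X 0 \<omega>)\<bar> \<le> path_oscillation pf h \<omega>"
proof -
  let ?i = "\<lambda>s. indicator {0..h} s :: real"
  have i1: "integrable lborel (\<lambda>s. ?i s *\<^sub>R f (X s \<omega>))"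
    using int by (simp add: set_integrable_def)
  have i2: "integrable lborel (\<lambda>s. ?i s *\<^sub>R f (X 0 \<omega>))"
    by (intro integrable_scaleR_left integrable_real_indicator) (use h in auto)
  have "(LINT s:{0..h}|lborel. f (X s \<omega>)) - h * f (X 0 \<omega>)
    = (\<integral>s. ?i s *\<^sub>R f (X s \<omega>) \<partial>lborel) - (\<integral>s. ?i s *\<^sub>R f (X 0 \<omega>) \<partial>lborel)"
    using h by (simp add: set_lebesgue_integral_def)
  also have "\<dots> = (\<integral>s. ?i s *\<^sub>R f (X s \<omega>) - ?i s *\<^sub>R f (X 0 \<omega>) \<partial>lborel)"
    by (rule Bochner_Integration.integral_diff[OF i1 i2, symmetric])
  also have "ennreal \<bar>\<dots>\<bar> \<le> (\<integral>\<^sup>+s. ennreal (norm (?i s *\<^sub>R f (X s \<omega>) - ?i s *\<^sub>R f (X 0 \<omega>))) \<partial>lborel)"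
    using integral_norm_bound_ennreal[OF Bochner_Integration.integrable_diff[OF i1 i2]] by simp
  also have "\<dots> = path_oscillation pf h \<omega>"
    unfolding path_oscillation_def by (intro nn_integral_cong) (auto simp: indicator_def f_poly)
  finally show ?thesis .
qed

text \<open>On the event, \<open>1 < 4 * h * ?G \<omega>\<close>, so its probability is at most
  \<open>4 * h\<close> times the expectation of \<open>?G\<close> over the event. This truncated
  expectation tends to 0 with \<open>h\<close> by dominated convergence, which improves Markov's
  O(h) to o(h).\<close>

lemma tail_small:
  assumes e: "0 < e"
  obtains h0 where "0 < h0" "\<And>h. 0 < h \<Longrightarrow> h < h0 \<Longrightarrow> prob {\<omega> \<in> space M. 1 / 4 < h * poly pg (X 0 \<omega>)} \<le> 4 * e * h"
proof -
  let ?G = "\<lambda>\<omega>. poly pg (X 0 \<omega>)"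
  let ?T = "\<lambda>h \<omega>. if 1 / 4 < h * ?G \<omega> then ?G \<omega> else 0"
  let ?S = "\<lambda>h. {\<omega> \<in> space M. 1 / 4 < h * ?G \<omega>}"
  have g0: "integrable M ?G"
    using int_pg by (subst integrable_X) auto
  then have [measurable]: "?G \<in> borel_measurable M" by auto
  have Tm[measurable]: "?T h \<in> borel_measurable M" for h by measurable
  have iT: "integrable M (?T h)" for h
    by (rule Bochner_Integration.integrable_bound[OF g0]) (auto intro!: AE_I2)
  have "((\<lambda>h. expectation (?T h)) \<longlongrightarrow> 0) (at_right 0)"
  proof (rule tendsto_at_right_sequentially[of 0 1])
    fix S :: "nat \<Rightarrow> real" assume S: "\<And>n. 0 < S n" "S \<longlonglongrightarrow> 0"
    have "(\<lambda>n. expectation (?T (S n))) \<longlonglongrightarrow> expectation (\<lambda>_. 0 :: real)"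
    proof (rule integral_dominated_convergence[OF _ _ g0])
      show "AE \<omega> in M. (\<lambda>n. ?T (S n) \<omega>) \<longlonglongrightarrow> 0"
      proof (rule AE_I2)
        fix \<omega>
        have "(\<lambda>n. S n * ?G \<omega>) \<longlonglongrightarrow> 0 * ?G \<omega>" by (intro tendsto_intros S)
        then have "eventually (\<lambda>n. S n * ?G \<omega> < 1 / 4) sequentially"
          by (intro order_tendstoD(2)) auto
        then have "eventually (\<lambda>n. ?T (S n) \<omega> = 0) sequentially"
          by eventually_elim auto
        then show "(\<lambda>n. ?T (S n) \<omega>) \<longlonglongrightarrow> 0" by (rule tendsto_eventually)
      qed
      show "AE \<omega> in M. norm (?T (S n) \<omega>) \<le> ?G \<omega>" for n
        using pg_nonneg by (intro AE_I2) auto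
    qed auto
    then show "(\<lambda>n. expectation (?T (S n))) \<longlonglongrightarrow> 0" by simp
  qed simp
  then have "eventually (\<lambda>h. expectation (?T h) < e) (at_right 0)"
    using e by (intro order_tendstoD(2)) auto
  then obtain h0 where h0: "0 < h0" "\<And>h. 0 < h \<Longrightarrow> h < h0 \<Longrightarrow> expectation (?T h) < e"
    unfolding eventually_at_right_field by blast
  show ?thesis
  proof (rule that[OF h0(1)])
    fix h assume h: "0 < h" "h < h0"
    have m: "(?S h) \<in> events" by measurable
    have "prob (?S h) = expectation (\<lambda>\<omega>. if 1 / 4 < h * ?G \<omega> then 1 else 0)"
      by (rule expectation_if[OF m, symmetric])
    also have "\<dots> \<le> expectation (\<lambda>\<omega>. 4 * h * ?T h \<omega>)"
      by (intro integral_mono integrable_mult_right iT integrable_const_bound[where B=1]) auto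
    also have "\<dots> = 4 * h * expectation (?T h)" by simp
    also have "\<dots> \<le> 4 * h * e" using h h0(2)[OF h] by (intro mult_left_mono) auto
    finally show "prob (?S h) \<le> 4 * e * h" by (simp add: mult_ac)
  qed
qed

end

section \<open>The stationary equation for the characteristic function\<close>

context stationary_ito_levy begin

text \<open>The Levy-Khintchine exponent of the process whose coefficients are frozen at
  \<open>x\<close>; equivalently, the factor by which the generator multiplies the function
  exp(iwx).\<close>

definition symbol :: "real \<Rightarrow> real \<Rightarrow> complex" where
  "symbol w x = \<i> * of_real (w * poly pf x) - of_real (w\<^sup>2 / 2 * poly pg x) + levy_exponent \<nu> w"

lemma Re_symbol: "Re (symbol w x) \<le> 0"
proof -
  have "set_integrable \<nu> {y. 1 < \<bar>y\<bar>} (\<lambda>y. y)"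
  proof -
    have "has_compensated_integral M N \<nu> 0 (L 0)"
      using sde unfolding ito_levy_process_def by blast
    then show ?thesis unfolding has_compensated_integral_def by simp
  qed
  from Re_levy_exponent_le_0[OF this, of w] have "Re (levy_exponent \<nu> w) \<le> 0" .
  moreover have "0 \<le> w\<^sup>2 / 2 * poly pg x" using pg_nonneg[of x] by (intro mult_nonneg_nonneg) auto
  moreover have "Re (symbol w x) = Re (levy_exponent \<nu> w) - w\<^sup>2 / 2 * poly pg x" by (simp add: symbol_def)
  ultimately show ?thesis by linarith
qed

text \<open>By stationarity the first integral is also the expectation of
  \<open>iexp (w * X h \<omega>)\<close>, while the second arises from it by freezing the
  coefficients at \<open>X 0\<close>. In the constant, \<open>\<bar>w\<bar>\<close> pays for the
  drift, the middle bracket for the gap between \<open>quad_var h\<close> and its frozen value, and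
  \<open>4 * (3 + exp c)\<close> for the tail, whose probability is at most
  \<open>4 * e * h\<close>.\<close>

lemma one_step_estimate:
  assumes e: "0 < e" and c: "c = w\<^sup>2 / 2"
  obtains h0 where "0 < h0" "\<And>h. 0 < h \<Longrightarrow> h < h0 \<Longrightarrow>
    norm ((\<integral>x. iexp (w * x) \<partial>\<pi>) - (\<integral>x. iexp (w * x) * exp (of_real h * symbol w x) \<partial>\<pi>))
      \<le> (\<bar>w\<bar> + (c * exp c + 4 * (3 + exp c)) + 4 * (3 + exp c)) * e * h"
proof -
  obtain h1 where h1: "0 < h1" "\<And>h. 0 < h \<Longrightarrow> h < h1 \<Longrightarrow> (\<integral>\<^sup>+\<omega>. path_oscillation pf h \<omega> \<partial>M) \<le> ennreal (e * h)"
    using path_oscillation_small[OF int_pf e] by blast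
  obtain h2 where h2: "0 < h2" "\<And>h. 0 < h \<Longrightarrow> h < h2 \<Longrightarrow> (\<integral>\<^sup>+\<omega>. path_oscillation pg h \<omega> \<partial>M) \<le> ennreal (e * h)"
    using path_oscillation_small[OF int_pg e] by blast
  obtain h3 where h3: "0 < h3" "\<And>h. 0 < h \<Longrightarrow> h < h3 \<Longrightarrow> prob {\<omega> \<in> space M. 1 / 4 < h * poly pg (X 0 \<omega>)} \<le> 4 * e * h"
    using tail_small[OF e] by blast
  show ?thesis
  proof (rule that[of "min h1 (min h2 h3)"])
    show "0 < min h1 (min h2 h3)" using h1 h2 h3 by simp
    fix h assume h: "0 < h" and "h < min h1 (min h2 h3)"
    then have gf: "(\<integral>\<^sup>+\<omega>. path_oscillation pf h \<omega> \<partial>M) \<le> ennreal (e * h)"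
      and gg: "(\<integral>\<^sup>+\<omega>. path_oscillation pg h \<omega> \<partial>M) \<le> ennreal (e * h)"
      and tl: "prob {\<omega> \<in> space M. 1 / 4 < h * poly pg (X 0 \<omega>)} \<le> 4 * e * h"
      using h1 h2 h3 by auto
    have h': "0 \<le> h" using h by simp
    let ?P = "prob {\<omega> \<in> space M. 1 / 4 < h * poly pg (X 0 \<omega>)}"
    obtain I where ito: "has_ito_integral M F W (\<lambda>s \<omega>. g (X s \<omega>)) h I"
      and eqn: "AE \<omega> in M. set_integrable lborel {0..h} (\<lambda>s. f (X s \<omega>)) \<and>
           X h \<omega> = X 0 \<omega> + (LINT s:{0..h}|lborel. f (X s \<omega>)) + I \<omega> + L h \<omega>"
      using sde h' unfolding ito_levy_process_def by meson
    have comp: "has_compensated_integral M N \<nu> h (L h)"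
      using sde h' unfolding ito_levy_process_def by blast
    have [measurable]: "I \<in> borel_measurable M" "L h \<in> borel_measurable M" "X h \<in> borel_measurable M" "X 0 \<in> borel_measurable M"
      using ito comp h' by (auto simp: has_ito_integral_def has_compensated_integral_def)
    have X0F[measurable]: "X 0 \<in> borel_measurable (F 0)" by (rule adapted_X) simp
    define V where "V \<omega> = iexp (w * (X 0 \<omega> + h * poly pf (X 0 \<omega>)))" for \<omega>
    have VF: "V \<in> borel_measurable (F 0)" unfolding V_def by measurable
    have [measurable]: "V \<in> borel_measurable M" by (rule measurable_F[OF VF])
    note qv = quad_var_estimate[OF h' gg, OF mult_nonneg_nonneg[OF less_imp_le[OF e] h']]
    let ?D = "expectation (\<lambda>\<omega>. \<bar>quad_var h \<omega> - h * poly pg (X 0 \<omega>)\<bar>)"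
    let ?R = "expectation (\<lambda>\<omega>. V \<omega> * of_real (exp (- (c * (h * poly pg (X 0 \<omega>)))))) * exp (of_real h * levy_exponent \<nu> w)"
    let ?L = "expectation (\<lambda>\<omega>. V \<omega> * iexp (w * I \<omega>) * iexp (w * L h \<omega>))"
    let ?I = "\<integral>x. iexp (w * x) \<partial>\<pi>" and ?J = "\<integral>x. iexp (w * x) * exp (of_real h * symbol w x) \<partial>\<pi>"
    have est: "norm (?L
      - ?R)
    \<le> (c * exp c + 4 * (3 + exp c)) * ?D
      + (3 + exp c) * ?P"
    proof (rule ito_exponential_estimate[OF ito h' comp qv(1) _ _ _ _ _ VF _ c])
      show "0 \<le> quad_var h \<omega>" for \<omega> by (simp add: quad_var_def)
      show "AE \<omega> in M. (\<integral>\<^sup>+s\<in>{0..h}. ennreal ((g (X s \<omega>))\<^sup>2) \<partial>lborel) = ennreal (quad_var h \<omega>)"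
        using qv(2) by (simp add: g_poly)
      show "(\<lambda>\<omega>. h * poly pg (X 0 \<omega>)) \<in> borel_measurable (F 0)" by measurable
      show "integrable M (\<lambda>\<omega>. h * poly pg (X 0 \<omega>))"
        using int_pg by (intro integrable_mult_right) (subst integrable_X, auto)
      show "0 \<le> h * poly pg (X 0 \<omega>)" for \<omega> using h pg_nonneg by simp
      show "norm (V \<omega>) \<le> 1" for \<omega> unfolding V_def norm_exp_i_times by simp
    qed
    have c0: "0 \<le> c" by (simp add: c)
    have "(c * exp c + 4 * (3 + exp c)) * ?D
        \<le> (c * exp c + 4 * (3 + exp c)) * (e * h)"
      using c0 by (intro mult_left_mono qv(3)) (auto intro!: add_nonneg_nonneg)
    moreover have "(3 + exp c) * ?P \<le> (3 + exp c) * (4 * e * h)"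
      by (intro mult_left_mono tl) (auto intro!: add_nonneg_nonneg)
    ultimately have est': "norm (?L
      - ?R)
      \<le> (c * exp c + 4 * (3 + exp c)) * (e * h) + (3 + exp c) * (4 * e * h)"
      using est by linarith
    have drift: "norm (expectation (\<lambda>\<omega>. iexp (w * X h \<omega>)) - ?L)
      \<le> \<bar>w\<bar> * (e * h)"
    proof -
      let ?U = "\<lambda>\<omega>. X 0 \<omega> + h * poly pf (X 0 \<omega>) + I \<omega> + L h \<omega>"
      let ?d = "\<lambda>\<omega>. norm (iexp (w * X h \<omega>) - iexp (w * ?U \<omega>))"
      let ?A = "\<lambda>\<omega>. (LINT s:{0..h}|lborel. f (X s \<omega>)) - h * f (X 0 \<omega>)"
      have Veq: "V \<omega> * iexp (w * I \<omega>) * iexp (w * L h \<omega>) = iexp (w * ?U \<omega>)" for \<omega>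
        unfolding V_def by (simp add: distrib_left exp_add mult_ac)
      have i1: "integrable M (\<lambda>\<omega>. iexp (w * X h \<omega>))" "integrable M (\<lambda>\<omega>. iexp (w * ?U \<omega>))"
        by (intro integrable_iexp; simp)+
      have i2: "integrable M (\<lambda>\<omega>. ?d \<omega>)"
        by (intro integrable_norm Bochner_Integration.integrable_diff i1)
      have "norm (expectation (\<lambda>\<omega>. iexp (w * X h \<omega>)) - expectation (\<lambda>\<omega>. iexp (w * ?U \<omega>)))
        = norm (expectation (\<lambda>\<omega>. iexp (w * X h \<omega>) - iexp (w * ?U \<omega>)))"
        by (subst Bochner_Integration.integral_diff[OF i1]) simp
      also have "\<dots> \<le> expectation (\<lambda>\<omega>. ?d \<omega>)"
        by (rule integral_norm_bound)
      finally have a: "norm (expectation (\<lambda>\<omega>. iexp (w * X h \<omega>)) - expectation (\<lambda>\<omega>. iexp (w * ?U \<omega>)))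
        \<le> expectation (\<lambda>\<omega>. ?d \<omega>)" .
      have "ennreal (expectation (\<lambda>\<omega>. ?d \<omega>))
        = (\<integral>\<^sup>+\<omega>. ennreal (?d \<omega>) \<partial>M)"
        by (rule nn_integral_eq_integral[OF i2, symmetric]) simp
      also have "\<dots> \<le> (\<integral>\<^sup>+\<omega>. ennreal \<bar>w\<bar> * path_oscillation pf h \<omega> \<partial>M)"
      proof (rule nn_integral_mono_AE)
        show "AE \<omega> in M. ennreal (?d \<omega>) \<le> ennreal \<bar>w\<bar> * path_oscillation pf h \<omega>"
          using eqn AE_space
        proof eventually_elim
          case (elim \<omega>)
          have "?d \<omega> \<le> \<bar>w * X h \<omega> - w * ?U \<omega>\<bar>"
            by (rule iexp_lipschitz)
          also have "w * X h \<omega> - w * ?U \<omega> = w * (?A \<omega>)"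
            using elim(1) by (simp add: algebra_simps f_poly)
          also have "\<bar>\<dots>\<bar> = \<bar>w\<bar> * \<bar>?A \<omega>\<bar>"
            by (rule abs_mult)
          finally have "ennreal (?d \<omega>)
            \<le> ennreal \<bar>w\<bar> * ennreal \<bar>?A \<omega>\<bar>"
            by (simp add: ennreal_mult[symmetric] ennreal_leI)
          also have "\<dots> \<le> ennreal \<bar>w\<bar> * path_oscillation pf h \<omega>"
            using elim by (intro mult_left_mono drift_estimate h') auto
          finally show ?case .
        qed
      qed
      also have "\<dots> = ennreal \<bar>w\<bar> * (\<integral>\<^sup>+\<omega>. path_oscillation pf h \<omega> \<partial>M)"
        by (rule nn_integral_cmult) simp
      also have "\<dots> \<le> ennreal \<bar>w\<bar> * ennreal (e * h)"
        by (intro mult_left_mono gf) simp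
      also have "\<dots> = ennreal (\<bar>w\<bar> * (e * h))"
        using e h by (simp add: ennreal_mult)
      finally have "expectation (\<lambda>\<omega>. ?d \<omega>) \<le> \<bar>w\<bar> * (e * h)"
        using e h by (subst (asm) ennreal_le_iff) auto
      then show ?thesis using a unfolding Veq by linarith
    qed
    have 1: "expectation (\<lambda>\<omega>. iexp (w * X h \<omega>)) = ?I"
      by (rule integral_X[OF h']) measurable
    have 2: "?R
      = ?J"
    proof -
      have "?R
        = expectation (\<lambda>\<omega>. V \<omega> * of_real (exp (- (c * (h * poly pg (X 0 \<omega>))))) * exp (of_real h * levy_exponent \<nu> w))"
        by simp
      also have "\<dots> = expectation (\<lambda>\<omega>. iexp (w * X 0 \<omega>) * exp (of_real h * symbol w (X 0 \<omega>)))"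
      proof (intro Bochner_Integration.integral_cong refl)
        fix \<omega>
        have "V \<omega> = iexp (w * X 0 \<omega>) * exp (\<i> * of_real (h * (w * poly pf (X 0 \<omega>))))"
          unfolding V_def by (simp add: distrib_left exp_add mult_ac)
        moreover have "complex_of_real (exp (- (c * (h * poly pg (X 0 \<omega>))))) = exp (of_real (- (h * (c * poly pg (X 0 \<omega>)))))"
          by (simp only: exp_of_real[symmetric] mult.left_commute[of c h])
        moreover have "of_real h * symbol w (X 0 \<omega>) = \<i> * of_real (h * (w * poly pf (X 0 \<omega>)))
            + of_real (- (h * (c * poly pg (X 0 \<omega>)))) + of_real h * levy_exponent \<nu> w"
          unfolding symbol_def c by (simp add: algebra_simps)
        ultimately show "V \<omega> * of_real (exp (- (c * (h * poly pg (X 0 \<omega>))))) * exp (of_real h * levy_exponent \<nu> w)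
          = iexp (w * X 0 \<omega>) * exp (of_real h * symbol w (X 0 \<omega>))"
          by (simp only: exp_add mult.assoc)
      qed
      also have "\<dots> = ?J"
        by (rule integral_X[OF order_refl]) (unfold symbol_def, measurable)
      finally show ?thesis .
    qed
    have "norm (?I - ?J)
      \<le> \<bar>w\<bar> * (e * h) + ((c * exp c + 4 * (3 + exp c)) * (e * h) + (3 + exp c) * (4 * e * h))"
      using norm_triangle_le[OF add_mono[OF drift est']] unfolding 1 2 by simp
    also have "\<dots> = (\<bar>w\<bar> + (c * exp c + 4 * (3 + exp c)) + 4 * (3 + exp c)) * e * h"
      by (simp add: algebra_simps)
    finally show "norm (?I - ?J)
      \<le> (\<bar>w\<bar> + (c * exp c + 4 * (3 + exp c)) + 4 * (3 + exp c)) * e * h" .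
  qed
qed

text \<open>The difference quotient at 0 of \<open>?J\<close> tends to the integral in question by
  dominated convergence. It also tends to 0, because \<open>one_step_estimate\<close> bounds the
  increment of \<open>?J\<close> by a constant times \<open>e * h\<close> with \<open>e\<close>
  arbitrary.\<close>

lemma stationary_equation: "(\<integral>x. iexp (w * x) * symbol w x \<partial>\<pi>) = 0"
proof -
  interpret pi: prob_space \<pi> by (rule prob_space_pi)
  define h where "h j = inverse (real (Suc j))" for j
  let ?J = "\<lambda>h. \<integral>x. iexp (w * x) * exp (of_real h * symbol w x) \<partial>\<pi>" and ?I = "\<integral>x. iexp (w * x) \<partial>\<pi>"
  have h: "0 < h j" for j by (simp add: h_def)
  have hlim: "h \<longlonglongrightarrow> 0" unfolding h_def by (rule LIMSEQ_inverse_real_of_nat)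
  have sm[measurable]: "symbol w \<in> borel_measurable borel"
    unfolding symbol_def[abs_def] by measurable
  have int_symbol: "integrable \<pi> (symbol w)"
  proof -
    have "integrable \<pi> (\<lambda>x. \<i> * of_real (w * poly pf x))" "integrable \<pi> (\<lambda>x. complex_of_real (w\<^sup>2 / 2 * poly pg x))"
      by (intro integrable_mult_right integrable_of_real int_pf int_pg)+
    then show ?thesis unfolding symbol_def[abs_def]
      by (intro Bochner_Integration.integrable_add Bochner_Integration.integrable_diff) auto
  qed
  have i1: "integrable \<pi> (\<lambda>x. iexp (w * x))" by (intro pi.integrable_iexp) auto
  have i2: "integrable \<pi> (\<lambda>x. iexp (w * x) * exp (of_real (h j) * symbol w x))" for j
  proof (rule pi.integrable_const_bound[where B=1])
    show "AE x in \<pi>. norm (iexp (w * x) * exp (of_real (h j) * symbol w x)) \<le> 1"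
    proof (rule AE_I2)
      fix x
      have "h j * Re (symbol w x) \<le> 0" using Re_symbol[of w x] h[of j] by (simp add: mult_nonneg_nonpos)
      then show "norm (iexp (w * x) * exp (of_real (h j) * symbol w x)) \<le> 1"
        unfolding norm_mult norm_exp_i_times by (simp add: norm_exp_eq_Re)
    qed
  qed measurable
  let ?q = "\<lambda>j x. iexp (w * x) * ((exp (of_real (h j) * symbol w x) - 1) / of_real (h j))"
  have "(\<lambda>j. \<integral>x. ?q j x \<partial>\<pi>) \<longlonglongrightarrow> (\<integral>x. iexp (w * x) * symbol w x \<partial>\<pi>)"
  proof (rule integral_dominated_convergence[where w="\<lambda>x. norm (symbol w x)"])
    show "AE x in \<pi>. (\<lambda>j. ?q j x) \<longlonglongrightarrow> iexp (w * x) * symbol w x"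
      using h by (intro AE_I2 tendsto_mult tendsto_const exp_difference_quotient hlim) (auto simp: less_imp_neq[symmetric])
    show "AE x in \<pi>. norm (?q j x) \<le> norm (symbol w x)" for j
    proof (rule AE_I2)
      fix x
      have "norm (exp (of_real (h j) * symbol w x) - 1) \<le> norm (of_real (h j) * symbol w x)"
        using Re_symbol[of w x] h[of j] by (intro norm_exp_minus_1_le) (simp add: mult_nonneg_nonpos)
      also have "\<dots> = norm (symbol w x) * h j" using h[of j] by (simp add: norm_mult)
      finally show "norm (?q j x) \<le> norm (symbol w x)"
        using h[of j] unfolding norm_mult norm_exp_i_times norm_divide by (simp add: pos_divide_le_eq)
    qed
    show "integrable \<pi> (\<lambda>x. norm (symbol w x))" by (intro integrable_norm int_symbol)
  qed measurable
  moreover have "(\<lambda>j. \<integral>x. ?q j x \<partial>\<pi>) \<longlonglongrightarrow> 0"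
  proof -
    define c where "c = w\<^sup>2 / 2"
    have c0: "0 \<le> c" by (simp add: c_def)
    let ?K = "\<bar>w\<bar> + (c * exp c + 4 * (3 + exp c)) + 4 * (3 + exp c)"
    have K: "0 < ?K" using c0 by (intro add_nonneg_pos add_nonneg_nonneg mult_nonneg_nonneg) (auto intro: add_pos_pos)
    have eq: "(\<integral>x. ?q j x \<partial>\<pi>) = - (?I - ?J (h j)) / of_real (h j)" for j
    proof -
      have "(\<integral>x. ?q j x \<partial>\<pi>) = (\<integral>x. (iexp (w * x) * exp (of_real (h j) * symbol w x) - iexp (w * x)) / of_real (h j) \<partial>\<pi>)"
        by (intro Bochner_Integration.integral_cong refl) (simp add: right_diff_distrib diff_divide_distrib)
      also have "\<dots> = (?J (h j) - ?I) / of_real (h j)"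
        using i1 i2 by simp
      finally show ?thesis by simp
    qed
    show ?thesis
    proof (rule LIMSEQ_I)
      fix r :: real assume r: "0 < r"
      define e where "e = r / (2 * ?K)"
      have e: "0 < e" using r K by (simp add: e_def)
      obtain h0 where h0: "0 < h0" "\<And>h. 0 < h \<Longrightarrow> h < h0 \<Longrightarrow>
          norm (?I - ?J h) \<le> ?K * e * h"
        using one_step_estimate[OF e c_def] by blast
      obtain j0 where j0: "\<And>j. j0 \<le> j \<Longrightarrow> h j < h0"
        using order_tendstoD(2)[OF hlim h0(1)] by (auto simp: eventually_sequentially)
      show "\<exists>j0. \<forall>j\<ge>j0. norm ((\<integral>x. ?q j x \<partial>\<pi>) - 0) < r"
      proof (intro exI allI impI)
        fix j assume "j0 \<le> j"
        from h0(2)[OF h j0[OF this]] have "norm (\<integral>x. ?q j x \<partial>\<pi>) \<le> ?K * e * h j / h j"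
          using h[of j] unfolding eq norm_divide norm_minus_cancel norm_of_real abs_of_pos[OF h]
          by (intro divide_right_mono) auto
        also have "\<dots> = ?K * e" using h[of j] by simp
        also have "\<dots> = r / 2"
        proof -
          have "k * (r / (2 * k)) = r / 2" if "0 < k" for k using that by simp
          then show ?thesis unfolding e_def using K by blast
        qed
        also have "\<dots> < r" using r by simp
        finally show "norm ((\<integral>x. ?q j x \<partial>\<pi>) - 0) < r" by simp
      qed
    qed
  qed
  ultimately show ?thesis by (rule LIMSEQ_unique)
qed

end

section \<open>Characteristic functions and the semidefinite program\<close>

lemma integrable_power_le:
  fixes \<pi> :: "real measure"
  assumes "prob_space \<pi>" and sets: "sets \<pi> = sets borel"
    and int: "integrable \<pi> (\<lambda>x. \<bar>x\<bar> ^ n)" and "l \<le> n"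
  shows "integrable \<pi> (\<lambda>x. \<bar>x\<bar> ^ l)"
proof -
  interpret prob_space \<pi> by fact
  note [measurable_cong] = sets
  show ?thesis
  proof (rule Bochner_Integration.integrable_bound)
    show "integrable \<pi> (\<lambda>x. 1 + \<bar>x\<bar> ^ n)" using int by simp
    show "AE x in \<pi>. norm (\<bar>x\<bar> ^ l) \<le> norm (1 + \<bar>x\<bar> ^ n)"
    proof (rule AE_I2)
      fix x :: real
      have "\<bar>x\<bar> ^ l \<le> 1 + \<bar>x\<bar> ^ n"
      proof (cases "1 \<le> \<bar>x\<bar>")
        case True
        then have "\<bar>x\<bar> ^ l \<le> \<bar>x\<bar> ^ n" using \<open>l \<le> n\<close> by (rule power_increasing[rotated])
        then show ?thesis by simp
      next
        case False
        then have "\<bar>x\<bar> ^ l \<le> 1" by (intro power_le_one) auto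
        moreover have "0 \<le> \<bar>x\<bar> ^ n" by simp
        ultimately show ?thesis by linarith
      qed
      then show "norm (\<bar>x\<bar> ^ l) \<le> norm (1 + \<bar>x\<bar> ^ n)" by simp
    qed
  qed measurable
qed

text \<open>The result of differentiating the characteristic function \<open>l\<close> times under
  the integral; index 0 is the characteristic function itself.\<close>

definition char_deriv :: "real measure \<Rightarrow> nat \<Rightarrow> real \<Rightarrow> complex" where
  "char_deriv \<pi> l w = (\<integral>x. (\<i> * of_real x) ^ l * iexp (w * x) \<partial>\<pi>)"

lemma integrable_char_deriv:
  assumes "sets \<pi> = sets borel" "integrable \<pi> (\<lambda>x. \<bar>x\<bar> ^ l)"
  shows "integrable \<pi> (\<lambda>x. (\<i> * of_real x) ^ l * iexp (w * x))"
proof (rule Bochner_Integration.integrable_bound[OF assms(2)])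
  note [measurable_cong] = assms(1)
  show "(\<lambda>x. (\<i> * of_real x) ^ l * iexp (w * x)) \<in> borel_measurable \<pi>" by measurable
  show "AE x in \<pi>. norm ((\<i> * of_real x) ^ l * iexp (w * x)) \<le> norm (\<bar>x\<bar> ^ l)"
    by (rule AE_I2) (simp only: norm_mult norm_exp_i_times norm_power norm_ii norm_of_real real_norm_def mult_1 mult_1_right power_abs abs_abs order_refl)
qed

text \<open>Two bounds on the remainder exp(iu) - 1 - iu do different jobs: the quadratic one gives
  pointwise convergence of the difference quotient, the linear one gives the dominating function
  \<open>2 * \<bar>x\<bar> ^ Suc l\<close>. In this way the moment of order \<open>Suc l\<close>
  suffices.\<close>

lemma has_vector_derivative_char_deriv:
  assumes sets: "sets \<pi> = sets borel"
    and int: "integrable \<pi> (\<lambda>x. \<bar>x\<bar> ^ l)" "integrable \<pi> (\<lambda>x. \<bar>x\<bar> ^ Suc l)"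
  shows "(char_deriv \<pi> l has_vector_derivative char_deriv \<pi> (Suc l) w) (at w)"
  unfolding has_vector_derivative_def has_derivative_iff_norm
proof (intro conjI)
  note [measurable_cong] = sets
  show "bounded_linear (\<lambda>x. x *\<^sub>R char_deriv \<pi> (Suc l) w)"
    by (rule bounded_linear_scaleR_left)
  let ?f = "\<lambda>y. norm (char_deriv \<pi> l y - char_deriv \<pi> l w - (y - w) *\<^sub>R char_deriv \<pi> (Suc l) w) / norm (y - w)"
  show "(?f \<longlongrightarrow> 0) (at w)"
    unfolding tendsto_at_iff_sequentially
  proof (intro allI impI)
    fix y :: "nat \<Rightarrow> real" assume y: "\<forall>i. y i \<in> UNIV - {w}" "y \<longlonglongrightarrow> w"
    let ?r = "\<lambda>u. iexp u - 1 - \<i> * of_real u"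
    let ?k = "\<lambda>j x. (\<i> * of_real x) ^ l * iexp (w * x) * (?r ((y j - w) * x) / of_real (y j - w))"
    have nz: "y j - w \<noteq> 0" for j using y(1) by auto
    have r1: "norm (?r u) \<le> u\<^sup>2 / 2" for u
      using iexp_approx1[of u 1] by (simp add: numeral_2_eq_2 diff_diff_eq)
    have r2: "norm (?r u) \<le> 2 * \<bar>u\<bar>" for u
      using iexp_approx2[of u 1] by (simp add: diff_diff_eq)
    have nk: "norm (?k j x) = \<bar>x\<bar> ^ l * (norm (?r ((y j - w) * x)) / \<bar>y j - w\<bar>)" for j x
      by (simp only: norm_mult norm_exp_i_times norm_power norm_ii norm_of_real norm_divide mult_1 mult_1_right)
    have b1: "norm (?k j x) \<le> \<bar>y j - w\<bar> * (\<bar>x\<bar> ^ l * x\<^sup>2 / 2)" for j x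
    proof -
      have "norm (?r ((y j - w) * x)) / \<bar>y j - w\<bar> \<le> (((y j - w) * x)\<^sup>2 / 2) / \<bar>y j - w\<bar>"
        by (intro divide_right_mono r1) simp
      also have "\<dots> = \<bar>y j - w\<bar> * x\<^sup>2 / 2"
        using nz[of j] by (simp add: power_mult_distrib power2_eq_square abs_if field_simps)
      finally show ?thesis unfolding nk
        by (rule order_trans[OF mult_left_mono]) (simp_all add: mult_ac)
    qed
    have b2: "norm (?k j x) \<le> 2 * \<bar>x\<bar> ^ Suc l" for j x
    proof -
      have "norm (?r ((y j - w) * x)) / \<bar>y j - w\<bar> \<le> (2 * \<bar>(y j - w) * x\<bar>) / \<bar>y j - w\<bar>"
        by (intro divide_right_mono r2) simp
      also have "\<dots> = 2 * \<bar>x\<bar>"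
        using nz[of j] by (simp add: abs_mult)
      finally show ?thesis unfolding nk
        by (rule order_trans[OF mult_left_mono]) (simp_all add: mult_ac)
    qed
    have "(\<lambda>j. \<integral>x. ?k j x \<partial>\<pi>) \<longlonglongrightarrow> (\<integral>x. 0 \<partial>\<pi>)"
    proof (rule integral_dominated_convergence[where w="\<lambda>x. 2 * \<bar>x\<bar> ^ Suc l"])
      show "AE x in \<pi>. (\<lambda>j. ?k j x) \<longlonglongrightarrow> 0"
      proof (rule AE_I2)
        fix x
        have "(\<lambda>j. \<bar>y j - w\<bar> * (\<bar>x\<bar> ^ l * x\<^sup>2 / 2)) \<longlonglongrightarrow> \<bar>w - w\<bar> * (\<bar>x\<bar> ^ l * x\<^sup>2 / 2)"
          by (intro tendsto_intros y)
        then have "(\<lambda>j. \<bar>y j - w\<bar> * (\<bar>x\<bar> ^ l * x\<^sup>2 / 2)) \<longlonglongrightarrow> 0" by simp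
        then show "(\<lambda>j. ?k j x) \<longlonglongrightarrow> 0"
          by (rule Lim_null_comparison[rotated]) (intro always_eventually allI b1)
      qed
      show "AE x in \<pi>. norm (?k j x) \<le> 2 * \<bar>x\<bar> ^ Suc l" for j
        by (intro AE_I2 b2)
      show "integrable \<pi> (\<lambda>x. 2 * \<bar>x\<bar> ^ Suc l)" by (intro integrable_mult_right int)
    qed measurable
    then have lim: "(\<lambda>j. norm (\<integral>x. ?k j x \<partial>\<pi>)) \<longlonglongrightarrow> 0"
      by (simp add: tendsto_norm_zero_iff)
    have "?f (y j) = norm (\<integral>x. ?k j x \<partial>\<pi>)" for j
    proof -
      note i = integrable_char_deriv[OF sets int(1)] integrable_char_deriv[OF sets int(2)]
      let ?e = "char_deriv \<pi> l (y j) - char_deriv \<pi> l w - (y j - w) *\<^sub>R char_deriv \<pi> (Suc l) w"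
      have "?e
        = (\<integral>x. (\<i> * of_real x) ^ l * iexp (y j * x) - (\<i> * of_real x) ^ l * iexp (w * x)
            - (y j - w) *\<^sub>R ((\<i> * of_real x) ^ Suc l * iexp (w * x)) \<partial>\<pi>)"
        unfolding char_deriv_def using i by (simp del: power_Suc of_real_mult)
      also have "\<dots> = (\<integral>x. of_real (y j - w) * ?k j x \<partial>\<pi>)"
      proof (intro Bochner_Integration.integral_cong refl)
        fix x
        have "iexp (y j * x) = iexp (w * x) * iexp ((y j - w) * x)"
          by (simp add: exp_add[symmetric] algebra_simps)
        moreover have "of_real (y j - w) * ?k j x = (\<i> * of_real x) ^ l * iexp (w * x) * ?r ((y j - w) * x)"
          using nz[of j] by (simp del: of_real_diff)
        ultimately show "(\<i> * of_real x) ^ l * iexp (y j * x) - (\<i> * of_real x) ^ l * iexp (w * x)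
            - (y j - w) *\<^sub>R ((\<i> * of_real x) ^ Suc l * iexp (w * x)) = of_real (y j - w) * ?k j x"
          by (simp add: scaleR_conv_of_real algebra_simps)
      qed
      also have "\<dots> = of_real (y j - w) * (\<integral>x. ?k j x \<partial>\<pi>)" by (rule integral_mult_right_zero)
      finally have e: "?e
        = of_real (y j - w) * (\<integral>x. ?k j x \<partial>\<pi>)" .
      show ?thesis
        unfolding e norm_mult[of "of_real (y j - w)"] norm_of_real real_norm_def
        by (rule nonzero_mult_div_cancel_left) (use nz[of j] in simp)
    qed
    then show "(?f \<circ> y) \<longlonglongrightarrow> 0" using lim by (simp add: comp_def)
  qed
qed

lemma iter_deriv_char:
  assumes "prob_space \<pi>" and sets: "sets \<pi> = sets borel" and int: "integrable \<pi> (\<lambda>x. \<bar>x\<bar> ^ n)"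
  shows "l \<le> n \<Longrightarrow> iter_deriv l (char_deriv \<pi> 0) = char_deriv \<pi> l"
proof (induction l)
  case (Suc l)
  have "(char_deriv \<pi> l has_vector_derivative char_deriv \<pi> (Suc l) w) (at w)" for w
    using Suc.prems by (intro has_vector_derivative_char_deriv sets integrable_power_le[OF assms]) auto
  then have "vector_derivative (char_deriv \<pi> l) (at w) = char_deriv \<pi> (Suc l) w" for w
    by (rule vector_derivative_at)
  then show ?case using Suc by simp
qed simp

lemma times_differentiable_char:
  assumes "prob_space \<pi>" and sets: "sets \<pi> = sets borel" and int: "integrable \<pi> (\<lambda>x. \<bar>x\<bar> ^ n)"
  shows "times_differentiable n (char_deriv \<pi> 0)"
  unfolding times_differentiable_def
proof (intro allI impI)
  fix l w assume "l < n"
  then have "(char_deriv \<pi> l has_vector_derivative char_deriv \<pi> (Suc l) w) (at w)"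
    by (intro has_vector_derivative_char_deriv sets integrable_power_le[OF assms]) auto
  then show "iter_deriv l (char_deriv \<pi> 0) differentiable at w"
    using iter_deriv_char[OF assms, of l] \<open>l < n\<close> by (auto intro: differentiableI_vector)
qed

text \<open>The factor \<open>\<i> powi (- int l)\<close> undoes the \<open>\<i> ^ l\<close> brought
  down by the \<open>l\<close>-th derivative, so the differential operator multiplies the integrand
  by the polynomial.\<close>

lemma char_deriv_poly:
  assumes "prob_space \<pi>" and sets: "sets \<pi> = sets borel" and int: "integrable \<pi> (\<lambda>x. \<bar>x\<bar> ^ n)"
    and p: "degree p \<le> n"
  shows "(\<Sum>l\<le>degree p. complex_of_real (poly.coeff p l) * \<i> powi (- int l) * char_deriv \<pi> l w)
    = (\<integral>x. of_real (poly p x) * iexp (w * x) \<partial>\<pi>)"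
proof -
  let ?t = "\<lambda>l x. complex_of_real (poly.coeff p l) * \<i> powi (- int l) * ((\<i> * of_real x) ^ l * iexp (w * x))"
  have i: "integrable \<pi> (\<lambda>x. (\<i> * of_real x) ^ l * iexp (w * x))" if "l \<le> degree p" for l
    using that p by (intro integrable_char_deriv[OF sets] integrable_power_le[OF assms(1-3)]) simp
  have "(\<Sum>l\<le>degree p. complex_of_real (poly.coeff p l) * \<i> powi (- int l) * char_deriv \<pi> l w)
    = (\<Sum>l\<le>degree p. \<integral>x. ?t l x \<partial>\<pi>)"
    by (simp only: char_deriv_def integral_mult_right_zero)
  also have "\<dots> = (\<integral>x. (\<Sum>l\<le>degree p. ?t l x) \<partial>\<pi>)"
    using i by (intro Bochner_Integration.integral_sum[symmetric] integrable_mult_right) auto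
  also have "\<dots> = (\<integral>x. of_real (poly p x) * iexp (w * x) \<partial>\<pi>)"
  proof (intro Bochner_Integration.integral_cong refl)
    fix x
    have "?t l x
      = of_real (poly.coeff p l * x ^ l) * iexp (w * x)" for l
    proof -
      have "\<i> powi (- int l) * \<i> ^ l = 1"
        by (simp add: power_int_minus power_int_of_nat)
      then have "\<i> powi (- int l) * (\<i> * of_real x) ^ l = of_real x ^ l"
        by (simp add: power_mult_distrib mult.assoc[symmetric])
      then show ?thesis by (simp add: mult_ac)
    qed
    then show "(\<Sum>l\<le>degree p. ?t l x)
      = of_real (poly p x) * iexp (w * x)"
      by (simp only: poly_altdef of_real_sum sum_distrib_right)
  qed
  finally show ?thesis .
qed

section \<open>Positive semidefiniteness of test matrices\<close>

lemma positive_semidefinite_test_matrix_iff: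
  "positive_semidefinite (test_matrix \<phi> ws) \<longleftrightarrow>
    (\<forall>v :: nat \<Rightarrow> complex. 0 \<le> (\<Sum>r<length ws. \<Sum>s<length ws. \<phi> (ws ! r - ws ! s) * v s * cnj (v r)))"
proof -
  let ?n = "length ws" and ?A = "test_matrix \<phi> ws"
  have dim: "dim_row ?A = ?n" "dim_col ?A = ?n" by (auto simp: test_matrix_def)
  let ?s = "\<lambda>v. \<Sum>r<?n. \<Sum>s<?n. \<phi> (ws ! r - ws ! s) * v s * cnj (v r)"
  have eq: "scalar_prod (?A *\<^sub>v v) (conjugate v)
      = (\<Sum>r<?n. \<Sum>s<?n. \<phi> (ws ! r - ws ! s) * v $ s * cnj (v $ r))" if "v \<in> carrier_vec ?n" for v
  proof -
    have "scalar_prod (?A *\<^sub>v v) (conjugate v) = (\<Sum>r<?n. (\<Sum>s<?n. \<phi> (ws ! r - ws ! s) * v $ s) * cnj (v $ r))"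
      using that unfolding scalar_prod_def
      by (intro sum.cong)
        (auto simp: test_matrix_def scalar_prod_def lessThan_atLeast0 conjugate_complex_def intro!: sum.cong)
    then show ?thesis by (simp add: sum_distrib_right)
  qed
  show ?thesis
  proof
    assume psd: "positive_semidefinite ?A"
    show "\<forall>v :: nat \<Rightarrow> complex. 0 \<le> ?s v"
    proof
      fix v :: "nat \<Rightarrow> complex"
      have c: "Matrix.vec ?n v \<in> carrier_vec ?n" by simp
      then have "0 \<le> scalar_prod (?A *\<^sub>v Matrix.vec ?n v) (conjugate (Matrix.vec ?n v))"
        using psd unfolding positive_semidefinite_def dim by blast
      then show "0 \<le> ?s v"
        unfolding eq[OF c] by simp
    qed
  next
    assume "\<forall>v :: nat \<Rightarrow> complex. 0 \<le> ?s v"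
    then show "positive_semidefinite ?A"
      unfolding positive_semidefinite_def dim by (auto simp: eq dim)
  qed
qed

lemma positive_semidefinite_char:
  assumes "prob_space \<pi>" and sets: "sets \<pi> = sets borel"
  shows "positive_semidefinite (test_matrix (char_deriv \<pi> 0) ws)"
  unfolding positive_semidefinite_test_matrix_iff
proof
  interpret prob_space \<pi> by fact
  note [measurable_cong] = sets
  fix v :: "nat \<Rightarrow> complex"
  let ?n = "length ws"
  let ?t = "\<lambda>r s x. iexp ((ws ! r - ws ! s) * x) * v s * cnj (v r)"
  \<comment> \<open>The quadratic form is the expectation of the squared modulus of
    \<open>S\<close>. The minus sign is needed because \<open>v s\<close>, the unconjugated entry,
    is paired with the subtracted test point \<open>ws ! s\<close>.\<close>
  define S where "S x = (\<Sum>s<?n. v s * iexp (- (ws ! s * x)))" for x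
  have i: "integrable \<pi> (\<lambda>x. ?t r s x)" for r s
    by (intro integrable_mult_left integrable_iexp) auto
  have "(\<Sum>r<?n. \<Sum>s<?n. char_deriv \<pi> 0 (ws ! r - ws ! s) * v s * cnj (v r))
    = (\<Sum>r<?n. \<Sum>s<?n. \<integral>x. ?t r s x \<partial>\<pi>)"
    by (simp only: char_deriv_def power_0 mult_1 integral_mult_left_zero)
  also have "\<dots> = (\<integral>x. (\<Sum>r<?n. \<Sum>s<?n. ?t r s x) \<partial>\<pi>)"
    using i by (simp only: Bochner_Integration.integral_sum Bochner_Integration.integrable_sum)
  also have "\<dots> = (\<integral>x. of_real ((norm (S x))\<^sup>2) \<partial>\<pi>)"
  proof (intro Bochner_Integration.integral_cong refl)
    fix x
    have "complex_of_real ((norm (S x))\<^sup>2) = S x * cnj (S x)"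
      by (rule complex_norm_square)
    also have "\<dots> = cnj (S x) * S x" by (rule mult.commute)
    also have "\<dots> = (\<Sum>r<?n. \<Sum>s<?n. cnj (v r * iexp (- (ws ! r * x))) * (v s * iexp (- (ws ! s * x))))"
      unfolding S_def cnj_sum sum_product ..
    also have "\<dots> = (\<Sum>r<?n. \<Sum>s<?n. ?t r s x)"
    proof (intro sum.cong refl)
      fix r s
      have "cnj (iexp (- (ws ! r * x))) = iexp (ws ! r * x)"
        by (simp add: exp_cnj)
      moreover have "iexp ((ws ! r - ws ! s) * x) = iexp (ws ! r * x) * iexp (- (ws ! s * x))"
        by (simp add: exp_add[symmetric] algebra_simps)
      ultimately show "cnj (v r * iexp (- (ws ! r * x))) * (v s * iexp (- (ws ! s * x)))
        = ?t r s x"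
        by (simp only: complex_cnj_mult mult_ac)
    qed
    finally show "(\<Sum>r<?n. \<Sum>s<?n. ?t r s x) = of_real ((norm (S x))\<^sup>2)" by simp
  qed
  also have "\<dots> = of_real (\<integral>x. (norm (S x))\<^sup>2 \<partial>\<pi>)" by (rule integral_complex_of_real)
  also have "0 \<le> \<dots>"
    by (simp add: less_eq_complex_def integral_nonneg_AE)
  finally show "0 \<le> (\<Sum>r<?n. \<Sum>s<?n. char_deriv \<pi> 0 (ws ! r - ws ! s) * v s * cnj (v r))" .
qed

text \<open>Multiset inclusion disregards the order of the points and allows repetitions, so a
  permutation first brings the points of \<open>ws\<close> to the front of
  \<open>ws'\<close>.\<close>

lemma positive_semidefinite_mset_subset:
  assumes sub: "mset ws \<subseteq># mset ws'" and psd: "positive_semidefinite (test_matrix \<phi> ws')"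
  shows "positive_semidefinite (test_matrix \<phi> ws)"
  unfolding positive_semidefinite_test_matrix_iff
proof
  fix v :: "nat \<Rightarrow> complex"
  obtain zs where "mset zs = mset ws' - mset ws" using ex_mset by blast
  then have "mset (ws @ zs) = mset ws'" using sub by simp
  then obtain p where p: "p permutes {..<length ws'}" "permute_list p ws' = ws @ zs"
    by (rule mset_eq_permutation)
  let ?n = "length ws" and ?m = "length ws'"
  have len: "?n \<le> ?m" using arg_cong[OF p(2), of length] by simp
  have nth: "ws ! i = ws' ! p i" if "i < ?n" for i
    using p that len by (metis nth_append permute_list_nth order_less_le_trans)
  have inj: "inj_on p {..<?n}" using permutes_inj[OF p(1)] by (rule inj_on_subset) simp
  have img: "p ` {..<?n} \<subseteq> {..<?m}" using permutes_image[OF p(1)] len by auto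
  \<comment> \<open>The vector \<open>v\<close>, transported along \<open>p\<close> and extended by
    0. The quadratic form of the large matrix at \<open>v'\<close> is that of the small one at
    \<open>v\<close>.\<close>
  define v' where "v' j = (if j \<in> p ` {..<?n} then v (the_inv_into {..<?n} p j) else 0)" for j
  have v': "v' (p i) = v i" if "i < ?n" for i
    using that inj by (simp add: v'_def the_inv_into_f_f)
  have inner: "(\<Sum>s<?m. h s * v' s) = (\<Sum>s<?n. h (p s) * v s)" for h :: "nat \<Rightarrow> complex"
  proof -
    have "(\<Sum>s<?m. h s * v' s) = (\<Sum>s\<in>p ` {..<?n}. h s * v' s)"
      using img by (intro sum.mono_neutral_right) (auto simp: v'_def)
    also have "\<dots> = (\<Sum>s<?n. h (p s) * v s)"
      using v' by (simp add: sum.reindex[OF inj])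
    finally show ?thesis .
  qed
  have outer: "(\<Sum>r<?m. h r * cnj (v' r)) = (\<Sum>r<?n. h (p r) * cnj (v r))" for h :: "nat \<Rightarrow> complex"
  proof -
    have "(\<Sum>s<?m. h s * cnj (v' s)) = (\<Sum>s\<in>p ` {..<?n}. h s * cnj (v' s))"
      using img by (intro sum.mono_neutral_right) (auto simp: v'_def)
    also have "\<dots> = (\<Sum>s<?n. h (p s) * cnj (v s))"
      using v' by (simp add: sum.reindex[OF inj])
    finally show ?thesis .
  qed
  have "0 \<le> (\<Sum>r<?m. \<Sum>s<?m. \<phi> (ws' ! r - ws' ! s) * v' s * cnj (v' r))"
    using psd unfolding positive_semidefinite_test_matrix_iff by blast
  also have "\<dots> = (\<Sum>r<?m. (\<Sum>s<?m. \<phi> (ws' ! r - ws' ! s) * v' s) * cnj (v' r))"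
    by (simp only: sum_distrib_right)
  also have "\<dots> = (\<Sum>r<?n. (\<Sum>s<?n. \<phi> (ws' ! p r - ws' ! p s) * v s) * cnj (v r))"
    by (simp only: inner outer)
  also have "\<dots> = (\<Sum>r<?n. \<Sum>s<?n. \<phi> (ws ! r - ws ! s) * v s * cnj (v r))"
    by (simp add: sum_distrib_right nth)
  finally show "0 \<le> (\<Sum>r<?n. \<Sum>s<?n. \<phi> (ws ! r - ws ! s) * v s * cnj (v r))" .
qed

section \<open>Feasible points and the value of the program\<close>

lemma sdp_feasible_mset_subset:
  assumes "mset ws \<subseteq># mset ws'" "sdp_feasible pf pg \<nu> ws' \<phi> \<mu>"
  shows "sdp_feasible pf pg \<nu> ws \<phi> \<mu>"
  using assms positive_semidefinite_mset_subset[OF assms(1)] unfolding sdp_feasible_def Let_def by blast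

lemma integrable_poly:
  fixes p :: "real poly"
  assumes "prob_space \<pi>" and sets: "sets \<pi> = sets borel" and int: "integrable \<pi> (\<lambda>x. \<bar>x\<bar> ^ n)"
    and p: "degree p \<le> n"
  shows "integrable \<pi> (poly p)"
proof -
  note [measurable_cong] = sets
  have "integrable \<pi> (\<lambda>x. x ^ l)" if "l \<le> degree p" for l
    by (rule Bochner_Integration.integrable_bound[OF integrable_power_le[OF assms(1-3), of l]])
      (use that p in \<open>auto simp: power_abs\<close>)
  then have "integrable \<pi> (\<lambda>x. \<Sum>l\<le>degree p. poly.coeff p l * x ^ l)"
    by (intro Bochner_Integration.integrable_sum integrable_mult_right) auto
  then show ?thesis by (simp add: poly_altdef[abs_def])
qed

text \<open>By \<open>char_deriv_poly\<close> the differential operators become polynomial factors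
  under the integral, and as (iw)^2/2 = -w^2/2 the constraint is
  \<open>stationary_equation\<close>.\<close>

lemma (in stationary_ito_levy) char_feasible:
  assumes int: "integrable \<pi> (\<lambda>x. \<bar>x\<bar> ^ max (degree pf) (degree pg))"
  shows "sdp_feasible pf pg \<nu> ws (char_deriv \<pi> 0) (\<lambda>l. \<integral>x. x ^ l \<partial>\<pi>)"
  unfolding sdp_feasible_def Let_def
proof (intro conjI allI ballI)
  let ?n = "max (degree pf) (degree pg)"
  interpret pi: prob_space \<pi> by (rule prob_space_pi)
  note ps = prob_space_pi sets_pi int
  note it = iter_deriv_char[OF ps]
  show "times_differentiable ?n (char_deriv \<pi> 0)" by (rule times_differentiable_char[OF ps])
  show "positive_semidefinite (test_matrix (char_deriv \<pi> 0) ws)"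
    by (rule positive_semidefinite_char[OF prob_space_pi sets_pi])
  show "char_deriv \<pi> 0 0 = 1"
    using pi.prob_space by (simp add: char_deriv_def)
  show "iter_deriv l (char_deriv \<pi> 0) 0 = \<i> ^ l * complex_of_real (\<integral>x. x ^ l \<partial>\<pi>)" if "l \<in> {1..?n}" for l
  proof -
    have "iter_deriv l (char_deriv \<pi> 0) 0 = (\<integral>x. \<i> ^ l * complex_of_real (x ^ l) \<partial>\<pi>)"
      using it[of l] that by (simp add: char_deriv_def power_mult_distrib)
    also have "\<dots> = \<i> ^ l * complex_of_real (\<integral>x. x ^ l \<partial>\<pi>)"
      by (simp only: integral_mult_right_zero integral_complex_of_real)
    finally show ?thesis .
  qed
  fix w :: real
  have s: "(\<Sum>l\<le>degree p. complex_of_real (poly.coeff p l) * \<i> powi (- int l) * iter_deriv l (char_deriv \<pi> 0) w)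
    = (\<integral>x. of_real (poly p x) * iexp (w * x) \<partial>\<pi>)" if "degree p \<le> ?n" for p
    using char_deriv_poly[OF ps that, of w] it that by simp
  have i: "integrable \<pi> (\<lambda>x. complex_of_real (poly p x) * iexp (w * x))" if "degree p \<le> ?n" for p
  proof (rule Bochner_Integration.integrable_bound[OF integrable_poly[OF ps that]])
    show "AE x in \<pi>. norm (complex_of_real (poly p x) * iexp (w * x)) \<le> norm (poly p x)"
      by (rule AE_I2) (simp only: norm_mult norm_exp_i_times norm_of_real real_norm_def mult_1_right order_refl)
  qed measurable
  have i0: "integrable \<pi> (\<lambda>x. iexp (w * x))" by (intro pi.integrable_iexp) auto
  have "\<i> * complex_of_real w * (\<integral>x. of_real (poly pf x) * iexp (w * x) \<partial>\<pi>)
      + 1 / 2 * (\<i> * complex_of_real w)\<^sup>2 * (\<integral>x. of_real (poly pg x) * iexp (w * x) \<partial>\<pi>)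
      + levy_exponent \<nu> w * char_deriv \<pi> 0 w
    = (\<integral>x. \<i> * complex_of_real w * (of_real (poly pf x) * iexp (w * x))
      + 1 / 2 * (\<i> * complex_of_real w)\<^sup>2 * (of_real (poly pg x) * iexp (w * x))
      + levy_exponent \<nu> w * iexp (w * x) \<partial>\<pi>)"
    using i[of pf] i[of pg] i0 by (simp add: char_deriv_def del: of_real_mult)
  also have "\<dots> = (\<integral>x. iexp (w * x) * symbol w x \<partial>\<pi>)"
    by (intro Bochner_Integration.integral_cong refl)
      (simp add: symbol_def power_mult_distrib algebra_simps)
  also have "\<dots> = 0" by (rule stationary_equation)
  finally show "\<i> * complex_of_real w *
             (\<Sum>l\<le>degree pf. complex_of_real (poly.coeff pf l) * \<i> powi (- int l) * iter_deriv l (char_deriv \<pi> 0) w)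
           + 1 / 2 * (\<i> * complex_of_real w)\<^sup>2 *
             (\<Sum>l\<le>degree pg. complex_of_real (poly.coeff pg l) * \<i> powi (- int l) * iter_deriv l (char_deriv \<pi> 0) w)
           + levy_exponent \<nu> w * char_deriv \<pi> 0 w = 0"
    using s[of pf] s[of pg] by simp
qed

theorem theorem3:
  fixes M :: "'w measure" and F :: "real \<Rightarrow> 'w measure"
    and W L X :: "real \<Rightarrow> 'w \<Rightarrow> real" and N :: "real \<Rightarrow> 'w \<Rightarrow> real measure"
    and \<nu> \<pi> :: "real measure" and f g :: "real \<Rightarrow> real"
    and pf pg :: "real poly" and n k :: nat
  assumes prob: "prob_space M"
    and sde: "ito_levy_process M F W N \<nu> L f g X"
    and finite_variance: "\<And>t. t \<ge> 0 \<Longrightarrow> integrable M (\<lambda>\<omega>. (L t \<omega>)\<^sup>2)"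
    and stationary: "stationary_distribution M X \<pi>"
    and f_poly: "\<And>x. f x = poly pf x"
    and g_poly: "\<And>x. (g x)\<^sup>2 = poly pg x"
    and n_def: "n = max (degree pf) (degree pg)"
    and moments: "integrable \<pi> (\<lambda>x. \<bar>x\<bar> ^ n)"
    and k_range: "k \<in> {1..n}"
  shows "(\<forall>ws. sdp_value pf pg \<nu> k ws \<le> ereal (\<integral>x. x ^ k \<partial>\<pi>)) \<and>
    (\<forall>ws ws'. mset ws \<subseteq># mset ws' \<longrightarrow> sdp_value pf pg \<nu> k ws \<le> sdp_value pf pg \<nu> k ws')"
proof (intro conjI allI impI)
  have pi: "\<pi> = distr M borel (X 0)"
    using stationary by (simp add: stationary_distribution_def)
  have "subalgebra M (F 0)" "X 0 \<in> borel_measurable (F 0)"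
    using sde by (auto simp: ito_levy_process_def filtration_of_def filtration.space_F subalgebra_def)
  then have "X 0 \<in> borel_measurable M" by (rule measurable_from_subalg)
  then have ps: "prob_space \<pi>" "sets \<pi> = sets borel"
    unfolding pi using prob_space.prob_space_distr[OF prob] by auto
  interpret prob_space M by fact
  interpret stationary_ito_levy M F W L X N \<nu> \<pi> f g pf pg
    \<comment> \<open>The moment of order \<open>n\<close> makes both polynomials integrable under
      the stationary law, as the locale demands.\<close>
    using sde stationary f_poly g_poly integrable_poly[OF ps moments, of pf]
      integrable_poly[OF ps moments, of pg]
    by unfold_locales (simp_all add: n_def)
  fix ws
  show "sdp_value pf pg \<nu> k ws \<le> ereal (\<integral>x. x ^ k \<partial>\<pi>)"
    unfolding sdp_value_def
  proof (rule Inf_lower, intro CollectI exI conjI)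
    show "sdp_feasible pf pg \<nu> ws (char_deriv \<pi> 0) (\<lambda>l. \<integral>x. x ^ l \<partial>\<pi>)"
      by (rule char_feasible) (use moments n_def in simp)
  qed simp
next
  fix ws ws' :: "real list" assume "mset ws \<subseteq># mset ws'"
  then show "sdp_value pf pg \<nu> k ws \<le> sdp_value pf pg \<nu> k ws'"
    \<comment> \<open>Additional test points shrink the feasible set, and an infimum over fewer
      points is at least as large.\<close>
    unfolding sdp_value_def by (intro Inf_superset_mono) (auto dest: sdp_feasible_mset_subset)
qed

end
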